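(* Let $M$ be a manifold of dimension $2n+1$ and let $f\colon M\rightarrow\mathbb{R}^{2n+2}$ be a $\widetilde{J}$-tangent affine hypersphere (centred at the origin) with an involutive distribution $\mathcal{D}$. Then $f$ can be locally expressed in the form $$f(x_1,\ldots,x_n,y_1,\ldots,y_n,z)=\Big(\widetilde{J}\circ(f_1\times f_2)+f_1\times(-f_2)\Big)(x_1,\ldots,x_n,y_1,\ldots,y_n)\cosh z-\Big((f_1\times f_2)+\widetilde{J}\circ(f_1\times(-f_2))\Big)(x_1,\ldots,x_n,y_1,\ldots,y_n)\sinh z,$$ where $f_1$ and $f_2$ are proper $n$-dimensional affine hyperspheres (in $\mathbb{R}^{n+1}$, centred at the origin). Moreover, the converse is also true in the sense that if $f_1$ and $f_2$ are proper $n$-dimensional affine hyperspheres (in $\mathbb{R}^{n+1}$, centred at the origin, defined on open subsets of $\mathbb{R}^n$), then $f$ given by the formula $$f(x_1,\ldots,x_n,y_1,\ldots,y_n,z)=\Big(\widetilde{J}\circ(f_1\times f_2)+f_1\times(-f_2)\Big)(x_1,\ldots,x_n,y_1,\ldots,y_n)\cosh z-\Big((f_1\times f_2)+\widetilde{J}\circ(f_1\times(-f_2))\Big)(x_1,\ldots,x_n,y_1,\ldots,y_n)\sinh z$$ is a proper $\widetilde{J}$-tangent affine hypersphere with an involutive distribution $\mathcal{D}$.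
   Context: Let $n\ge1$. $\widetilde{J}$ is the standard para-complex structure on $\mathbb{R}^{2n+2}=\mathbb{R}^{n+1}\times\mathbb{R}^{n+1}$: $\widetilde{J}(x_1,\ldots,x_{n+1},y_1,\ldots,y_{n+1})=(y_1,\ldots,y_{n+1},x_1,\ldots,x_{n+1})$. For $f_i\colon U_i\to\mathbb{R}^{n+1}$, $U_i\subset\mathbb{R}^n$, $(f_1\times f_2)(x,y)=(f_1(x),f_2(y))\in\mathbb{R}^{2n+2}$. For an immersion $f\colon M^{N}\to\mathbb{R}^{N+1}$ ($M$ connected, orientable) with transversal field $C$, the objects $\nabla,h,S,\tau$ are defined by $\mathrm{D}_Xf_*Y=f_*(\nabla_XY)+h(X,Y)C$, $\mathrm{D}_XC=-f_*(SX)+\tau(X)C$, with $\mathrm{D}$ the flat connection. $f$ is nondegenerate if $h$ is. For nondegenerate $f$ the affine normal (Blaschke) field is the transversal field $C$, unique up to sign, such that the metric volume form $\omega_h(X_1,\ldots,X_N)=|\det[h(X_i,X_j)]|^{1/2}$ (bases positively oriented with respect to $\Theta$) is $\nabla$-parallel and equals $\Theta(X_1,\ldots,X_N)=\det[f_*X_1,\ldots,f_*X_N,C]$. With this $C$, $f$ is an affine hypersphere if $S=\lambda I$, $\lambda$ constant (proper if $\lambda\neq0$, improper if $\lambda=0$). A proper affine hypersphere is centred at the origin if $C=-\lambda f$. For $f\colon M^{2n+1}\to\mathbb{R}^{2n+2}$, $C$ is $\widetilde{J}$-tangent if $\widetilde{J}C_x\in f_*(T_xM)$ for all $x$; a $\widetilde{J}$-tangent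 affine hypersphere is an affine hypersphere whose Blaschke field is $\widetilde{J}$-tangent (such a hypersphere is always proper). The distribution $\mathcal{D}$ is $\mathcal{D}_x=f_*^{-1}(f_*(T_xM)\cap\widetilde{J}(f_*(T_xM)))$ (of constant dimension $2n$). "Locally expressed" means that every point of $M$ has a neighbourhood with coordinates $(x_1,\ldots,x_n,y_1,\ldots,y_n,z)$ in which $f$ is given by the formula. *)

theory Defs
  imports "HOL-Analysis.Analysis" "Jordan_Normal_Form.Determinant"
begin

section \<open>Smooth maps between Euclidean spaces\<close>

text \<open>\<open>flat_D X F\<close> is the flat derivative \<open>D\<^sub>X F\<close> of a vector-valued map \<open>F\<close> along the vector field
  \<open>X\<close>. In particular \<open>flat_D X f\<close> is \<open>f\<^sub>* X\<close>.\<close>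

definition flat_D ::
    "('a::euclidean_space \<Rightarrow> 'a) \<Rightarrow> ('a \<Rightarrow> 'b::real_normed_vector) \<Rightarrow> 'a \<Rightarrow> 'b" where
  "flat_D X F x = frechet_derivative F (at x) (X x)"

primrec C_k_on :: "nat \<Rightarrow> 'a::euclidean_space set \<Rightarrow> ('a \<Rightarrow> 'b::real_normed_vector) \<Rightarrow> bool" where
  "C_k_on 0 V F \<longleftrightarrow> continuous_on V F"
| "C_k_on (Suc k) V F \<longleftrightarrow>
     (\<forall>x\<in>V. F differentiable (at x)) \<and> (\<forall>v. C_k_on k V (flat_D (\<lambda>_. v) F))"

text \<open>Meaningful, and used, only for open \<open>V\<close>.\<close>

definition smooth_on :: "'a::euclidean_space set \<Rightarrow> ('a \<Rightarrow> 'b::real_normed_vector) \<Rightarrow> bool" where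
  "smooth_on V F \<longleftrightarrow> (\<forall>k. C_k_on k V F)"


section \<open>Determinants\<close>

text \<open>A fixed enumeration of the standard basis. Another enumeration changes \<open>vectors_det\<close> at most
  by a global sign, which leaves every notion below unchanged: \<open>linear_det\<close> does not depend on
  it, and replacing \<open>Theta\<close> by \<open>- Theta\<close> also replaces \<open>metric_volume\<close> by \<open>- metric_volume\<close>.\<close>

definition basis_enum :: "nat \<Rightarrow> 'b::euclidean_space" where
  "basis_enum = (SOME e. bij_betw e {..<DIM('b)} Basis)"

definition family_det :: "nat \<Rightarrow> (nat \<Rightarrow> nat \<Rightarrow> real) \<Rightarrow> real" where
  "family_det k A = Determinant.det (Matrix.mat k k (\<lambda>(i, j). A i j))"

definition vectors_det :: "(nat \<Rightarrow> 'b::euclidean_space) \<Rightarrow> real" where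
  "vectors_det v = family_det DIM('b) (\<lambda>i j. inner (v j) (basis_enum i))"

definition linear_det :: "('b::euclidean_space \<Rightarrow> 'b) \<Rightarrow> real" where
  "linear_det L = vectors_det (\<lambda>j. L (basis_enum j))"


section \<open>Smooth manifolds\<close>

text \<open>A chart is a pair of its domain and its coordinate map; only the values of the coordinate map
  on the domain matter. The dimension of the manifold is that of the model space \<open>'a\<close>.\<close>

type_synonym ('m, 'a) chart = "'m set \<times> ('m \<Rightarrow> 'a)"

definition chart_image :: "('m, 'a) chart \<Rightarrow> 'a set" where
  "chart_image c = snd c ` fst c"

definition in_chart :: "('m, 'a) chart \<Rightarrow> ('m \<Rightarrow> 'b) \<Rightarrow> 'a \<Rightarrow> 'b" where
  "in_chart c F = F \<circ> inv_into (fst c) (snd c)"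

definition is_chart :: "'m topology \<Rightarrow> ('m, 'a::euclidean_space) chart \<Rightarrow> bool" where
  "is_chart M c \<longleftrightarrow>
     openin M (fst c) \<and> open (chart_image c) \<and>
     homeomorphic_map (subtopology M (fst c)) (top_of_set (chart_image c)) (snd c)"

definition overlap :: "('m, 'a) chart \<Rightarrow> ('m, 'a) chart \<Rightarrow> 'a set" where
  "overlap c d = snd c ` (fst c \<inter> fst d)"

definition compatible_charts ::
    "('m, 'a::euclidean_space) chart \<Rightarrow> ('m, 'a) chart \<Rightarrow> bool" where
  "compatible_charts c d \<longleftrightarrow>
     smooth_on (overlap c d) (in_chart c (snd d)) \<and>
     smooth_on (overlap d c) (in_chart d (snd c))"

definition smooth_manifold ::
    "'m topology \<Rightarrow> ('m, 'a::euclidean_space) chart set \<Rightarrow> bool" where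
  "smooth_manifold M A \<longleftrightarrow>
     Hausdorff_space M \<and> second_countable M \<and>
     (\<forall>c\<in>A. is_chart M c) \<and> (\<Union>c\<in>A. fst c) = topspace M \<and>
     (\<forall>c\<in>A. \<forall>d\<in>A. compatible_charts c d)"

text \<open>The members of the maximal atlas containing \<open>A\<close>, i.e. the local coordinate systems of the
  manifold.\<close>

definition admissible_chart ::
    "'m topology \<Rightarrow> ('m, 'a::euclidean_space) chart set \<Rightarrow> ('m, 'a) chart \<Rightarrow> bool" where
  "admissible_chart M A c \<longleftrightarrow> is_chart M c \<and> (\<forall>d\<in>A. compatible_charts c d)"

definition orientable ::
    "'m topology \<Rightarrow> ('m, 'a::euclidean_space) chart set \<Rightarrow> bool" where
  "orientable M A \<longleftrightarrow>
     (\<exists>B. (\<forall>c\<in>B. admissible_chart M A c) \<and> (\<Union>c\<in>B. fst c) = topspace M \<and>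
          (\<forall>c\<in>B. \<forall>d\<in>B. \<forall>x\<in>overlap c d.
             linear_det (frechet_derivative (in_chart c (snd d)) (at x)) > 0))"

text \<open>An open subset of a Euclidean space with its standard smooth structure.\<close>

definition std_atlas :: "'a set \<Rightarrow> ('a, 'a) chart set" where
  "std_atlas U = {(U, id)}"


section \<open>Affine immersions in a coordinate domain\<close>

text \<open>Throughout this section \<open>g\<close> and \<open>C\<close> are the coordinate expressions of a hypersurface and of a
  transversal field on an open \<open>V \<subseteq> 'a\<close>, so \<open>DIM('b) = DIM('a) + 1\<close>. Vector fields on
  \<open>V\<close> are maps \<open>'a \<Rightarrow> 'a\<close>.\<close>

definition tangent_image ::
    "('a::euclidean_space \<Rightarrow> 'b::euclidean_space) \<Rightarrow> 'a \<Rightarrow> 'b set" where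
  "tangent_image g x = range (frechet_derivative g (at x))"

definition immersion_on ::
    "'a::euclidean_space set \<Rightarrow> ('a \<Rightarrow> 'b::euclidean_space) \<Rightarrow> bool" where
  "immersion_on V g \<longleftrightarrow> smooth_on V g \<and> (\<forall>x\<in>V. inj (frechet_derivative g (at x)))"

definition transversal_on ::
    "'a::euclidean_space set \<Rightarrow> ('a \<Rightarrow> 'b::euclidean_space) \<Rightarrow> ('a \<Rightarrow> 'b) \<Rightarrow> bool" where
  "transversal_on V g C \<longleftrightarrow> smooth_on V C \<and> (\<forall>x\<in>V. C x \<notin> tangent_image g x)"

text \<open>The two components of \<open>v = g\<^sub>* w + c C\<close>.\<close>

definition tangential_part ::
    "('a::euclidean_space \<Rightarrow> 'b::euclidean_space) \<Rightarrow> ('a \<Rightarrow> 'b) \<Rightarrow> 'a \<Rightarrow> 'b \<Rightarrow> 'a" where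
  "tangential_part g C x v = (THE w. \<exists>c. v = frechet_derivative g (at x) w + c *\<^sub>R C x)"

definition transversal_part ::
    "('a::euclidean_space \<Rightarrow> 'b::euclidean_space) \<Rightarrow> ('a \<Rightarrow> 'b) \<Rightarrow> 'a \<Rightarrow> 'b \<Rightarrow> real" where
  "transversal_part g C x v = (THE c. \<exists>w. v = frechet_derivative g (at x) w + c *\<^sub>R C x)"

text \<open>The decompositions \<open>D\<^sub>X g\<^sub>* Y = g\<^sub>* (\<nabla>\<^sub>X Y) + h(X, Y) C\<close> and
  \<open>D\<^sub>X C = - g\<^sub>* (S X) + \<tau>(X) C\<close>.\<close>

definition induced_connection ::
    "('a::euclidean_space \<Rightarrow> 'b::euclidean_space) \<Rightarrow> ('a \<Rightarrow> 'b) \<Rightarrow>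
     ('a \<Rightarrow> 'a) \<Rightarrow> ('a \<Rightarrow> 'a) \<Rightarrow> 'a \<Rightarrow> 'a" where
  "induced_connection g C X Y x = tangential_part g C x (flat_D X (flat_D Y g) x)"

definition second_form ::
    "('a::euclidean_space \<Rightarrow> 'b::euclidean_space) \<Rightarrow> ('a \<Rightarrow> 'b) \<Rightarrow>
     ('a \<Rightarrow> 'a) \<Rightarrow> ('a \<Rightarrow> 'a) \<Rightarrow> 'a \<Rightarrow> real" where
  "second_form g C X Y x = transversal_part g C x (flat_D X (flat_D Y g) x)"

definition shape_operator ::
    "('a::euclidean_space \<Rightarrow> 'b::euclidean_space) \<Rightarrow> ('a \<Rightarrow> 'b) \<Rightarrow>
     ('a \<Rightarrow> 'a) \<Rightarrow> 'a \<Rightarrow> 'a" where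
  "shape_operator g C X x = - tangential_part g C x (flat_D X C x)"

definition transversal_connection_form ::
    "('a::euclidean_space \<Rightarrow> 'b::euclidean_space) \<Rightarrow> ('a \<Rightarrow> 'b) \<Rightarrow>
     ('a \<Rightarrow> 'a) \<Rightarrow> 'a \<Rightarrow> real" where
  "transversal_connection_form g C X x = transversal_part g C x (flat_D X C x)"

text \<open>\<open>h\<close> is tensorial, so tangent vectors may be extended to constant fields.\<close>

definition nondegenerate_on ::
    "'a::euclidean_space set \<Rightarrow> ('a \<Rightarrow> 'b::euclidean_space) \<Rightarrow> ('a \<Rightarrow> 'b) \<Rightarrow> bool" where
  "nondegenerate_on V g C \<longleftrightarrow>
     (\<forall>x\<in>V. \<forall>u. u \<noteq> 0 \<longrightarrow> (\<exists>v. second_form g C (\<lambda>_. u) (\<lambda>_. v) x \<noteq> 0))"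

text \<open>The arguments of a volume form are vector fields \<open>X 0, \<dots>, X (N - 1)\<close> with \<open>N = DIM('a)\<close>.\<close>

definition Theta ::
    "('a::euclidean_space \<Rightarrow> 'b::euclidean_space) \<Rightarrow> ('a \<Rightarrow> 'b) \<Rightarrow>
     (nat \<Rightarrow> 'a \<Rightarrow> 'a) \<Rightarrow> 'a \<Rightarrow> real" where
  "Theta g C X x = vectors_det (\<lambda>j. if j < DIM('a) then flat_D (X j) g x else C x)"

text \<open>The volume form equal to \<open>\<bar>det h(X\<^sub>i, X\<^sub>j)\<bar>\<^sup>1\<^sup>/\<^sup>2\<close> on bases that are positively
  oriented with respect to \<open>Theta\<close>; being alternating, it has the opposite sign on negatively
  oriented ones and vanishes on linearly dependent vectors.\<close>

definition metric_volume ::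
    "('a::euclidean_space \<Rightarrow> 'b::euclidean_space) \<Rightarrow> ('a \<Rightarrow> 'b) \<Rightarrow>
     (nat \<Rightarrow> 'a \<Rightarrow> 'a) \<Rightarrow> 'a \<Rightarrow> real" where
  "metric_volume g C X x =
     sgn (Theta g C X x) *
     sqrt \<bar>family_det DIM('a) (\<lambda>i j. second_form g C (X i) (X j) x)\<bar>"

definition parallel_on ::
    "'a::euclidean_space set \<Rightarrow> ('a \<Rightarrow> 'b::euclidean_space) \<Rightarrow> ('a \<Rightarrow> 'b) \<Rightarrow>
     ((nat \<Rightarrow> 'a \<Rightarrow> 'a) \<Rightarrow> 'a \<Rightarrow> real) \<Rightarrow> bool" where
  "parallel_on V g C \<omega> \<longleftrightarrow>
     (\<forall>X Y. smooth_on V X \<and> (\<forall>i<DIM('a). smooth_on V (Y i)) \<longrightarrow>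
        (\<forall>x\<in>V. flat_D X (\<omega> Y) x =
           (\<Sum>i<DIM('a). \<omega> (Y(i := induced_connection g C X (Y i))) x)))"

definition blaschke_on ::
    "'a::euclidean_space set \<Rightarrow> ('a \<Rightarrow> 'b::euclidean_space) \<Rightarrow> ('a \<Rightarrow> 'b) \<Rightarrow> bool" where
  "blaschke_on V g C \<longleftrightarrow>
     transversal_on V g C \<and>
     parallel_on V g C (metric_volume g C) \<and>
     (\<forall>X. (\<forall>i<DIM('a). smooth_on V (X i)) \<longrightarrow>
        (\<forall>x\<in>V. metric_volume g C X x = Theta g C X x))"

definition distribution_D ::
    "('b \<Rightarrow> 'b) \<Rightarrow> ('a::euclidean_space \<Rightarrow> 'b::euclidean_space) \<Rightarrow> 'a \<Rightarrow> 'a set" where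
  "distribution_D J g x =
     {v. frechet_derivative g (at x) v \<in> tangent_image g x \<inter> J ` tangent_image g x}"

definition lie_bracket :: "('a::euclidean_space \<Rightarrow> 'a) \<Rightarrow> ('a \<Rightarrow> 'a) \<Rightarrow> 'a \<Rightarrow> 'a" where
  "lie_bracket X Y x = flat_D X Y x - flat_D Y X x"

definition involutive_on :: "'a::euclidean_space set \<Rightarrow> ('a \<Rightarrow> 'a set) \<Rightarrow> bool" where
  "involutive_on V E \<longleftrightarrow>
     (\<forall>W X Y. open W \<and> W \<subseteq> V \<and> smooth_on W X \<and> smooth_on W Y \<and>
        (\<forall>x\<in>W. X x \<in> E x \<and> Y x \<in> E x) \<longrightarrow>
        (\<forall>x\<in>W. lie_bracket X Y x \<in> E x))"


section \<open>Affine hyperspheres\<close>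

text \<open>\<open>f\<close> is an affine hypersphere with Blaschke field \<open>C\<close> and \<open>S = lam I\<close>.\<close>

definition affine_hypersphere ::
    "'m topology \<Rightarrow> ('m, 'a::euclidean_space) chart set \<Rightarrow> ('m \<Rightarrow> 'b::euclidean_space) \<Rightarrow>
     ('m \<Rightarrow> 'b) \<Rightarrow> real \<Rightarrow> bool" where
  "affine_hypersphere M A f C lam \<longleftrightarrow>
     smooth_manifold M A \<and> connected_space M \<and> orientable M A \<and>
     (\<forall>c\<in>A.
        immersion_on (chart_image c) (in_chart c f) \<and>
        blaschke_on (chart_image c) (in_chart c f) (in_chart c C) \<and>
        nondegenerate_on (chart_image c) (in_chart c f) (in_chart c C) \<and>
        (\<forall>X. smooth_on (chart_image c) X \<longrightarrow>
           (\<forall>x\<in>chart_image c.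
              shape_operator (in_chart c f) (in_chart c C) X x = lam *\<^sub>R X x)))"

definition centred_at_origin ::
    "'m topology \<Rightarrow> ('m \<Rightarrow> 'b::real_vector) \<Rightarrow> ('m \<Rightarrow> 'b) \<Rightarrow> real \<Rightarrow> bool" where
  "centred_at_origin M f C lam \<longleftrightarrow> lam \<noteq> 0 \<and> (\<forall>p\<in>topspace M. C p = - lam *\<^sub>R f p)"

definition J_tangent ::
    "('b \<Rightarrow> 'b) \<Rightarrow> ('m, 'a::euclidean_space) chart set \<Rightarrow> ('m \<Rightarrow> 'b::euclidean_space) \<Rightarrow>
     ('m \<Rightarrow> 'b) \<Rightarrow> bool" where
  "J_tangent J A f C \<longleftrightarrow>
     (\<forall>c\<in>A. \<forall>x\<in>chart_image c. J (in_chart c C x) \<in> tangent_image (in_chart c f) x)"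

definition involutive_D ::
    "('b \<Rightarrow> 'b) \<Rightarrow> ('m, 'a::euclidean_space) chart set \<Rightarrow> ('m \<Rightarrow> 'b::euclidean_space) \<Rightarrow>
     bool" where
  "involutive_D J A f \<longleftrightarrow>
     (\<forall>c\<in>A. involutive_on (chart_image c) (distribution_D J (in_chart c f)))"

definition proper_centred_hypersphere_on ::
    "'a::euclidean_space set \<Rightarrow> ('a \<Rightarrow> 'b::euclidean_space) \<Rightarrow> bool" where
  "proper_centred_hypersphere_on U f \<longleftrightarrow>
     (\<exists>C lam. affine_hypersphere (top_of_set U) (std_atlas U) f C lam \<and>
             centred_at_origin (top_of_set U) f C lam)"


section \<open>The para-complex structure and the parametrisation\<close>

text \<open>With \<open>R\<^sup>n = real ^ 'n\<close> we take \<open>R\<^sup>n\<^sup>+\<^sup>1 = (real ^ 'n) \<times> real\<close>,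
  \<open>R\<^sup>2\<^sup>n\<^sup>+\<^sup>2 = R\<^sup>n\<^sup>+\<^sup>1 \<times> R\<^sup>n\<^sup>+\<^sup>1\<close> and, for the coordinates \<open>(x, y, z)\<close>,
  \<open>R\<^sup>2\<^sup>n\<^sup>+\<^sup>1 = (real ^ 'n) \<times> (real ^ 'n) \<times> real\<close>.\<close>

type_synonym 'n affine_space = "(real ^ 'n) \<times> real"
type_synonym 'n coordinates = "(real ^ 'n) \<times> (real ^ 'n) \<times> real"

definition para_J :: "'b \<times> 'b \<Rightarrow> 'b \<times> 'b" where
  "para_J = (\<lambda>(x, y). (y, x))"

definition joined ::
    "('u \<Rightarrow> 'b::real_vector) \<Rightarrow> ('v \<Rightarrow> 'b) \<Rightarrow> 'u \<times> 'v \<times> real \<Rightarrow> 'b \<times> 'b" where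
  "joined f1 f2 = (\<lambda>(x, y, z).
     cosh z *\<^sub>R (para_J (map_prod f1 f2 (x, y)) + map_prod f1 (\<lambda>y. - f2 y) (x, y)) -
     sinh z *\<^sub>R (map_prod f1 f2 (x, y) + para_J (map_prod f1 (\<lambda>y. - f2 y) (x, y))))"

end

theory Submission
  imports Defs
begin

text \<open>In the eigenspace decomposition of the para-complex structure the formula for \<open>f\<close> reads
  \<open>(e\<^sup>-\<^sup>z f\<^sub>1(x), e\<^sup>z f\<^sub>2(y))\<close> up to a fixed linear isomorphism. A hypersurface \<open>g\<close> is a proper affine
  hypersphere centred at the origin precisely when the second fundamental form \<open>h\<close> relative to the
  transversal field \<open>g\<close> satisfies \<open>\<bar>det h\<bar> = r (det [g\<^sub>*, g])\<^sup>2\<close> with a constant \<open>r > 0\<close>. For the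
  formula both determinants factor into the contributions of \<open>f\<^sub>1\<close> and \<open>f\<^sub>2\<close>, so the condition holds
  for \<open>f\<close> iff it holds for both factors.

  Conversely let \<open>\<nu>\<close> be the conormal of \<open>g\<close> and \<open>\<eta>(v) = - \<nu>(J g\<^sub>* v)\<close>, a one-form with kernel \<open>\<D>\<close>.
  Involutivity makes \<open>\<eta>\<close> closed, hence locally \<open>\<eta> = dz\<close>. If \<open>a\<close> and \<open>b\<close> are the two eigencomponents
  of \<open>g\<close>, then \<open>e\<^sup>z a\<close> and \<open>e\<^sup>-\<^sup>z b\<close> have rank \<open>n\<close>; suitable projections \<open>x\<close> and \<open>y\<close> of them to \<open>\<real>\<^sup>n\<close>,
  together with \<open>z\<close>, are local coordinates, in which the two maps take the form \<open>f\<^sub>1(x)\<close> and \<open>f\<^sub>2(y)\<close>.\<close>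

section \<open>Determinants of linear maps\<close>

text \<open>Why one determinant condition suffices: for \<open>C = k g\<close> with
  \<open>k = - lam\<close> the derivative of \<open>C\<close> is tangent, so the shape operator is
  \<open>lam\<close> times the identity, tau vanishes and \<open>Theta\<close> is parallel. Only the
  volume normalisation is left. The Blaschke form is \<open>hess / k\<close> and
  \<open>Theta\<close> carries a factor \<open>k\<close>, so in dimension N the constant is r =
  |lam|^(N+2), and every r > 0 arises from some \<open>lam\<close>. Closedness of \<eta> has two
  halves. Pairings of its exterior derivative with the vector field \<xi> given by dg(\<xi>) = - J g
  vanish by the structure equations alone, since \<xi> is dual to \<eta> under \<open>hess\<close>.
  On pairs in the kernel of \<eta> the derivative reduces to a Lie bracket, and there involutivity
  enters. The rank is obtained in two moves. The map e^z a never lies in the range of its own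
  derivative, which bounds the rank by n everywhere; that n is attained is then forced by the
  inverse function theorem for (x, y, z). For the two factors the determinant condition becomes an
  identity between a function of x times a function of y, so freezing one variable gives a constant
  for the other.\<close>

lemma basis_enum_bij: "bij_betw (basis_enum :: nat \<Rightarrow> 'b::euclidean_space) {..<DIM('b)} Basis"
proof -
  have "\<exists>e :: nat \<Rightarrow> 'b. bij_betw e {..<DIM('b)} Basis"
    using ex_bij_betw_nat_finite[of "Basis :: 'b set"] by (auto simp: lessThan_atLeast0)
  then show ?thesis unfolding basis_enum_def by (rule someI_ex)
qed

lemma family_det_mult:
  "family_det n A * family_det n B = family_det n (\<lambda>i j. \<Sum>k<n. A i k * B k j)"
  unfolding family_det_def
  by (subst det_mult[symmetric, where n = n])
     (auto intro!: arg_cong[where f = Determinant.det] eq_matI simp: scalar_prod_def lessThan_atLeast0)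

lemma family_det_transpose: "family_det n (\<lambda>i j. A j i) = family_det n A"
proof -
  have "family_det n A = Determinant.det (transpose_mat (Matrix.mat n n (\<lambda>(i, j). A i j)))"
    unfolding family_det_def by (rule det_transpose[symmetric, where n = n]) simp
  also have "\<dots> = family_det n (\<lambda>i j. A j i)"
    unfolding family_det_def by (auto intro!: arg_cong[where f = Determinant.det] eq_matI)
  finally show ?thesis by simp
qed

lemma family_det_cong:
  "(\<And>i j. i < n \<Longrightarrow> j < n \<Longrightarrow> A i j = B i j) \<Longrightarrow> family_det n A = family_det n B"
  unfolding family_det_def by (auto intro!: arg_cong[where f = Determinant.det] eq_matI)

lemma family_det_one: "family_det n (\<lambda>i j. if i = j then 1 else 0) = 1"
proof -
  have "Matrix.mat n n (\<lambda>(i, j). if i = j then 1 else 0) = (1\<^sub>m n :: real mat)"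
    by (auto intro!: eq_matI)
  then show ?thesis by (simp add: family_det_def)
qed

lemma family_det_scale: "family_det n (\<lambda>i j. c * A i j) = c ^ n * family_det n A"
proof -
  have "Matrix.mat n n (\<lambda>(i, j). c * A i j) = c \<cdot>\<^sub>m Matrix.mat n n (\<lambda>(i, j). A i j)"
    by (auto intro!: eq_matI)
  then show ?thesis by (simp add: family_det_def)
qed

lemma enum_sum:
  assumes "bij_betw E {..<DIM('b)} (Basis :: 'b::euclidean_space set)"
  shows "(\<Sum>k<DIM('b). F (E k)) = (\<Sum>b\<in>Basis. F b)"
  using sum.reindex_bij_betw[OF assms] .

lemma enum_expand:
  assumes "bij_betw E {..<DIM('b)} (Basis :: 'b::euclidean_space set)"
  shows "(\<Sum>k<DIM('b). inner x (E k) *\<^sub>R E k) = x"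
  using enum_sum[OF assms, of "\<lambda>b. inner x b *\<^sub>R b"] by (simp add: euclidean_representation)

lemma enum_inner:
  assumes "bij_betw E {..<DIM('b)} (Basis :: 'b::euclidean_space set)"
  shows "(\<Sum>k<DIM('b). inner x (E k) * inner y (E k)) = inner x y"
  using enum_sum[OF assms, of "\<lambda>b. inner x b * inner y b"] by (simp add: euclidean_inner[symmetric])

lemma enum_orthonormal:
  assumes "bij_betw E {..<DIM('b)} (Basis :: 'b::euclidean_space set)" "i < DIM('b)" "j < DIM('b)"
  shows "inner (E i) (E j) = (if i = j then 1 else 0)"
  using assms by (auto simp: bij_betw_def inj_on_def intro!: inner_not_same_Basis inner_same_Basis)

text \<open>Unlike for \<open>linear_det\<close>, the two spaces may be different types of equal
  dimension. The sign then depends on how the two bases are enumerated, so the geometric statements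
  use only its square, its absolute value or its vanishing.\<close>

definition map_det :: "('c::euclidean_space \<Rightarrow> 'b::euclidean_space) \<Rightarrow> real" where
  "map_det L = vectors_det (\<lambda>j. L (basis_enum j))"

lemma vectors_det_linear:
  fixes L :: "'c::euclidean_space \<Rightarrow> 'b::euclidean_space"
  assumes L: "linear L" and dim: "DIM('c) = DIM('b)"
  shows "vectors_det (\<lambda>j. L (v j)) = map_det L * vectors_det v"
proof -
  have "inner (L (v j)) (basis_enum i)
      = (\<Sum>k<DIM('b). inner (L (basis_enum k)) (basis_enum i) * inner (v j) (basis_enum k))" for i j
  proof -
    have "L (v j) = L (\<Sum>k<DIM('c). inner (v j) (basis_enum k) *\<^sub>R basis_enum k)"
      by (simp add: enum_expand[OF basis_enum_bij])
    also have "\<dots> = (\<Sum>k<DIM('c). inner (v j) (basis_enum k) *\<^sub>R L (basis_enum k))"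
      by (simp add: linear_sum[OF L] linear_cmul[OF L])
    finally show ?thesis by (simp add: inner_sum_left dim mult.commute)
  qed
  then show ?thesis
    unfolding map_det_def vectors_det_def family_det_mult dim by (simp cong: sum.cong)
qed

lemma map_det_compose:
  fixes L :: "'c::euclidean_space \<Rightarrow> 'b::euclidean_space" and K :: "'d::euclidean_space \<Rightarrow> 'c"
  assumes "linear L" "DIM('c) = DIM('b)"
  shows "map_det (\<lambda>x. L (K x)) = map_det L * map_det K"
  unfolding map_det_def[of "\<lambda>x. L (K x)"] vectors_det_linear[OF assms] by (simp add: map_det_def)

lemma map_det_scale:
  fixes L :: "'c::euclidean_space \<Rightarrow> 'b::euclidean_space"
  shows "map_det (\<lambda>x. c *\<^sub>R L x) = c ^ DIM('b) * map_det L"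
  unfolding map_det_def vectors_det_def by (simp add: family_det_scale)

text \<open>The matrix of \<open>E\<close> in the reference basis is orthogonal, so its determinant
  has square one.\<close>

lemma abs_vectors_det_enum:
  assumes "bij_betw E {..<DIM('b)} (Basis :: 'b::euclidean_space set)"
  shows "\<bar>vectors_det E\<bar> = 1"
proof -
  have "vectors_det E * vectors_det E
      = family_det DIM('b) (\<lambda>i j. inner (E i) (basis_enum j)) * family_det DIM('b) (\<lambda>i j. inner (E j) (basis_enum i))"
    unfolding vectors_det_def
      family_det_transpose[of _ "\<lambda>i j. inner (E i) (basis_enum j)", symmetric] ..
  also have "\<dots> = family_det DIM('b) (\<lambda>i j. inner (E i) (E j))"
    unfolding family_det_mult enum_inner[OF basis_enum_bij] ..
  also have "\<dots> = 1"
    by (rule trans[OF family_det_cong family_det_one]) (simp add: enum_orthonormal[OF assms])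
  finally show ?thesis by (metis abs_mult_self_eq abs_one real_sqrt_abs2 real_sqrt_one)
qed

lemma map_det_id: "\<bar>map_det (\<lambda>x::'b::euclidean_space. x)\<bar> = 1"
  unfolding map_det_def by (rule abs_vectors_det_enum[OF basis_enum_bij])

lemma linear_det_id: "linear_det (\<lambda>x::'b::euclidean_space. x) = 1"
  unfolding linear_det_def vectors_det_def
  by (rule trans[OF family_det_cong family_det_one]) (simp add: enum_orthonormal[OF basis_enum_bij])

text \<open>Other enumerations multiply the matrix by orthogonal matrices on both sides. On a
  product type \<open>basis_enum\<close> is an arbitrary choice, and this allows the block-adapted
  enumeration of \<open>product_enum\<close> to replace it.\<close>

lemma map_det_enum:
  fixes L :: "'c::euclidean_space \<Rightarrow> 'b::euclidean_space"
  assumes L: "linear L" and dim: "DIM('c) = DIM('b)"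
    and E: "bij_betw E {..<DIM('c)} (Basis :: 'c set)" and E': "bij_betw E' {..<DIM('b)} (Basis :: 'b set)"
  shows "\<bar>family_det DIM('b) (\<lambda>i j. inner (L (E j)) (E' i))\<bar> = \<bar>map_det L\<bar>"
proof -
  have "family_det DIM('b) (\<lambda>i j. inner (L (E j)) (E' i))
      = family_det DIM('b) (\<lambda>i k. inner (E' i) (basis_enum k))
        * family_det DIM('b) (\<lambda>k j. inner (L (E j)) (basis_enum k))"
    unfolding family_det_mult enum_inner[OF basis_enum_bij] by (simp add: inner_commute)
  also have "\<dots> = vectors_det E' * vectors_det (\<lambda>j. L (E j))"
    unfolding vectors_det_def
      family_det_transpose[of _ "\<lambda>i k. inner (E' i) (basis_enum k)", symmetric] ..
  finally show ?thesis
    by (simp add: vectors_det_linear[OF L dim] abs_mult abs_vectors_det_enum[OF E] abs_vectors_det_enum[OF E'])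
qed

lemma product_enum:
  assumes E: "bij_betw E {..<DIM('c)} (Basis :: 'c::euclidean_space set)"
    and F: "bij_betw F {..<DIM('d)} (Basis :: 'd::euclidean_space set)"
  shows "bij_betw (\<lambda>j. if j < DIM('c) then (E j, 0) else (0, F (j - DIM('c))))
    {..<DIM('c \<times> 'd)} (Basis :: ('c \<times> 'd) set)"
proof -
  let ?G = "\<lambda>j. if j < DIM('c) then (E j, 0) else (0, F (j - DIM('c)))"
  have 1: "bij_betw ?G {..<DIM('c)} ((\<lambda>u. (u, 0::'d)) ` Basis)"
  proof -
    have "bij_betw (\<lambda>u. (u, 0::'d)) (Basis::'c set) ((\<lambda>u. (u, 0::'d)) ` Basis)"
      by (rule inj_on_imp_bij_betw) (auto intro: inj_onI)
    from bij_betw_trans[OF E this] show ?thesis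
      by (rule iffD1[OF bij_betw_cong, rotated]) simp
  qed
  have 2: "bij_betw ?G {DIM('c)..<DIM('c) + DIM('d)} ((\<lambda>v. (0::'c, v)) ` Basis)"
  proof -
    have s: "bij_betw (\<lambda>j. j - DIM('c)) {DIM('c)..<DIM('c) + DIM('d)} {..<DIM('d)}"
      by (rule bij_betwI[where g = "\<lambda>j. j + DIM('c)"]) auto
    have "bij_betw (\<lambda>v. (0::'c, v)) (Basis::'d set) ((\<lambda>v. (0::'c, v)) ` Basis)"
      by (rule inj_on_imp_bij_betw) (auto intro: inj_onI)
    from bij_betw_trans[OF bij_betw_trans[OF s F] this] show ?thesis
      by (rule iffD1[OF bij_betw_cong, rotated]) simp
  qed
  have "{..<DIM('c)} \<union> {DIM('c)..<DIM('c) + DIM('d)} = {..<DIM('c \<times> 'd)}" by auto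
  moreover have "(\<lambda>u. (u, 0::'d)) ` Basis \<inter> (\<lambda>v. (0::'c, v)) ` Basis = {}" by auto
  ultimately show ?thesis
    using bij_betw_combine[OF 1 2] by (simp add: Basis_prod_def)
qed

lemma family_det_block:
  assumes "\<And>i j. i < m \<Longrightarrow> m \<le> j \<Longrightarrow> j < m + n \<Longrightarrow> A i j = 0"
    and "\<And>i j. m \<le> i \<Longrightarrow> i < m + n \<Longrightarrow> j < m \<Longrightarrow> A i j = 0"
  shows "family_det (m + n) A = family_det m A * family_det n (\<lambda>i j. A (m + i) (m + j))"
proof -
  let ?P = "Matrix.mat m m (\<lambda>(i, j). A i j)"
  let ?Q = "Matrix.mat n n (\<lambda>(i, j). A (m + i) (m + j))"
  have "Matrix.mat (m + n) (m + n) (\<lambda>(i, j). A i j) = four_block_mat ?P (0\<^sub>m m n) (0\<^sub>m n m) ?Q"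
    by (rule eq_matI) (auto simp: assms)
  then show ?thesis
    unfolding family_det_def using det_four_block_mat_upper_right_zero[of ?P m "0\<^sub>m m n" n "0\<^sub>m n m" ?Q]
    by simp
qed

text \<open>Block diagonal in the concatenated bases. These may differ from
  \<open>basis_enum\<close> by an odd permutation, hence the absolute values.\<close>

lemma map_det_product:
  fixes P :: "'c::euclidean_space \<Rightarrow> 'b::euclidean_space" and Q :: "'d::euclidean_space \<Rightarrow> 'e::euclidean_space"
  assumes P: "linear P" and Q: "linear Q" and dims: "DIM('c) = DIM('b)" "DIM('d) = DIM('e)"
  shows "\<bar>map_det (\<lambda>(x, y). (P x, Q y))\<bar> = \<bar>map_det P\<bar> * \<bar>map_det Q\<bar>"
proof -
  let ?L = "\<lambda>(x, y). (P x, Q y)"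
  let ?E = "\<lambda>j. if j < DIM('c) then (basis_enum j :: 'c, 0) else (0, basis_enum (j - DIM('c)) :: 'd)"
  let ?E' = "\<lambda>j. if j < DIM('b) then (basis_enum j :: 'b, 0) else (0, basis_enum (j - DIM('b)) :: 'e)"
  let ?A = "\<lambda>i j. inner (?L (?E j)) (?E' i)"
  have L: "linear ?L"
    using P Q by (auto simp: linear_iff)
  have P0: "P 0 = 0" and Q0: "Q 0 = 0" using P Q by (simp_all add: linear_0)
  have "\<bar>map_det ?L\<bar> = \<bar>family_det (DIM('b) + DIM('e)) ?A\<bar>"
    using map_det_enum[OF L _ product_enum[OF basis_enum_bij basis_enum_bij]
        product_enum[OF basis_enum_bij basis_enum_bij]] dims by simp
  also have "family_det (DIM('b) + DIM('e)) ?A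
      = family_det DIM('b) ?A * family_det DIM('e) (\<lambda>i j. ?A (DIM('b) + i) (DIM('b) + j))"
    by (rule family_det_block) (auto simp: P0 Q0 dims)
  also have "family_det DIM('b) ?A = map_det P"
    unfolding map_det_def vectors_det_def by (rule family_det_cong) (auto simp: Q0 dims)
  also have "family_det DIM('e) (\<lambda>i j. ?A (DIM('b) + i) (DIM('b) + j)) = map_det Q"
    unfolding map_det_def vectors_det_def by (rule family_det_cong) (auto simp: P0 dims)
  finally show ?thesis by (simp add: abs_mult)
qed

lemma map_det_nonzero:
  fixes L :: "'c::euclidean_space \<Rightarrow> 'b::euclidean_space"
  assumes "linear L" "inj L" and dim: "DIM('c) = DIM('b)"
  shows "map_det L \<noteq> 0"
proof -
  obtain K where K: "linear K" "K \<circ> L = id"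
    using linear_injective_left_inverse[OF assms(1,2)] by auto
  have "map_det (\<lambda>x. K (L x)) = map_det K * map_det L"
    by (rule map_det_compose) (use K dim in auto)
  moreover have "(\<lambda>x. K (L x)) = (\<lambda>x. x)" using K(2) by (auto simp: fun_eq_iff)
  ultimately show ?thesis using map_det_id[where 'b = 'c] by auto
qed

lemma family_det_kernel:
  assumes "\<And>i. i < n \<Longrightarrow> (\<Sum>j<n. A i j * v j) = 0" "j < n" "v j \<noteq> 0"
  shows "family_det n A = 0"
proof -
  have "Matrix.vec n v \<noteq> 0\<^sub>v n"
    using assms(2,3) by (metis index_vec index_zero_vec(1))
  moreover have "Matrix.mat n n (\<lambda>(i, j). A i j) *\<^sub>v Matrix.vec n v = 0\<^sub>v n"
    using assms(1) by (auto intro!: eq_vecI simp: scalar_prod_def lessThan_atLeast0)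
  ultimately show ?thesis
    unfolding family_det_def
    by (subst det_0_iff_vec_prod_zero[of _ n]) (auto intro!: exI[of _ "Matrix.vec n v"])
qed

lemma form_expand:
  fixes h :: "'a::euclidean_space \<Rightarrow> 'a \<Rightarrow> real"
  assumes "bilinear h"
  shows "h u v = (\<Sum>k<DIM('a). inner u (basis_enum k) * (\<Sum>l<DIM('a). h (basis_enum k) (basis_enum l) * inner v (basis_enum l)))"
proof -
  note l = assms[unfolded bilinear_def]
  have "h u v = h (\<Sum>k<DIM('a). inner u (basis_enum k) *\<^sub>R basis_enum k)
      (\<Sum>l<DIM('a). inner v (basis_enum l) *\<^sub>R basis_enum l)"
    by (simp add: enum_expand[OF basis_enum_bij])
  then show ?thesis
    using l by (simp add: bilinear_sum[OF assms] linear_sum linear_cmul sum_distrib_left sum.cartesian_product[symmetric]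
        bilinear_lmul[OF assms] bilinear_rmul[OF assms] mult_ac)
qed

text \<open>In matrix terms the left side is the determinant of X^T H X, so a change of frame enters
  squared.\<close>

lemma family_det_form:
  fixes h :: "'a::euclidean_space \<Rightarrow> 'a \<Rightarrow> real"
  assumes "bilinear h"
  shows "family_det DIM('a) (\<lambda>i j. h (X i) (X j))
    = (vectors_det X)\<^sup>2 * family_det DIM('a) (\<lambda>i j. h (basis_enum i) (basis_enum j))"
proof -
  have "family_det DIM('a) (\<lambda>i j. h (X i) (X j))
    = family_det DIM('a) (\<lambda>i k. inner (X i) (basis_enum k)) *
      (family_det DIM('a) (\<lambda>i j. h (basis_enum i) (basis_enum j)) * vectors_det X)"
    unfolding vectors_det_def family_det_mult
    by (rule family_det_cong) (rule form_expand[OF assms])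
  also have "family_det DIM('a) (\<lambda>i k. inner (X i) (basis_enum k)) = vectors_det X"
    unfolding vectors_det_def by (rule family_det_transpose)
  finally show ?thesis by (simp add: power2_eq_square)
qed

definition form_det :: "('a::euclidean_space \<Rightarrow> 'a \<Rightarrow> real) \<Rightarrow> real" where
  "form_det h = family_det DIM('a) (\<lambda>i j. h (basis_enum i) (basis_enum j))"

lemma form_det_pullback:
  fixes h :: "'a::euclidean_space \<Rightarrow> 'a \<Rightarrow> real" and L :: "'c::euclidean_space \<Rightarrow> 'a"
  assumes "bilinear h" "DIM('c) = DIM('a)"
  shows "form_det (\<lambda>u v. h (L u) (L v)) = (map_det L)\<^sup>2 * form_det h"
  unfolding form_det_def assms(2) using family_det_form[OF assms(1), of "\<lambda>j. L (basis_enum j)"]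
  by (simp add: map_det_def)

text \<open>A change of basis enters squared, so no sign ambiguity remains; this is why
  \<open>form_det_product\<close> is an equality without absolute values, in contrast to
  \<open>map_det_product\<close>.\<close>

lemma form_det_enum:
  fixes h :: "'a::euclidean_space \<Rightarrow> 'a \<Rightarrow> real"
  assumes h: "bilinear h" and E: "bij_betw E {..<DIM('a)} (Basis :: 'a set)"
  shows "family_det DIM('a) (\<lambda>i j. h (E i) (E j)) = form_det h"
  using family_det_form[OF h, of E] abs_vectors_det_enum[OF E]
  by (simp add: form_det_def power2_eq_1_iff abs_if split: if_splits)

lemma form_det_nondegenerate:
  fixes h :: "'a::euclidean_space \<Rightarrow> 'a \<Rightarrow> real"
  assumes h: "bilinear h" and "form_det h \<noteq> 0" "u \<noteq> 0"
  shows "\<exists>v. h u v \<noteq> 0"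
proof (rule ccontr)
  assume "\<not> ?thesis"
  then have 0: "h u v = 0" for v by auto
  obtain b where b: "b \<in> Basis" "inner u b \<noteq> 0"
    using \<open>u \<noteq> 0\<close> euclidean_all_zero_iff[of u] by auto
  then obtain j where j: "j < DIM('a)" "b = basis_enum j"
    using basis_enum_bij[where 'b = 'a] by (auto simp: bij_betw_def)
  have "(\<Sum>j<DIM('a). h (basis_enum j) (basis_enum i) * inner u (basis_enum j)) = h u (basis_enum i)" for i
  proof -
    have "h u (basis_enum i) = h (\<Sum>k<DIM('a). inner u (basis_enum k) *\<^sub>R basis_enum k) (basis_enum i)"
      by (simp add: enum_expand[OF basis_enum_bij])
    then show ?thesis
      using h by (simp add: bilinear_def linear_sum[of "\<lambda>x. h x _"] bilinear_lmul[OF h] mult.commute)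
  qed
  \<comment> \<open>\<open>u\<close> stands in the first argument of \<open>h\<close>, so its
    coordinates are in the kernel of the transposed Gram matrix.\<close>
  then have "family_det DIM('a) (\<lambda>i j. h (basis_enum j) (basis_enum i)) = 0"
    using 0 j b by (intro family_det_kernel[where v = "\<lambda>j. inner u (basis_enum j)" and j = j]) auto
  then show False
    using assms(2) family_det_transpose[of "DIM('a)" "\<lambda>i j. h (basis_enum i) (basis_enum j)"]
    by (simp add: form_det_def)
qed

lemma form_det_scale: "form_det (\<lambda>u v :: 'a::euclidean_space. c * h u v) = c ^ DIM('a) * form_det h"
  unfolding form_det_def by (rule family_det_scale)

lemma form_det_product:
  fixes h :: "'a::euclidean_space \<Rightarrow> 'a \<Rightarrow> real" and k :: "'c::euclidean_space \<Rightarrow> 'c \<Rightarrow> real"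
  assumes h: "bilinear h" and k: "bilinear k"
  shows "form_det (\<lambda>u v. h (fst u) (fst v) + k (snd u) (snd v)) = form_det h * form_det k"
proof -
  let ?E = "\<lambda>j. if j < DIM('a) then (basis_enum j :: 'a, 0) else (0, basis_enum (j - DIM('a)) :: 'c)"
  let ?l = "\<lambda>u v. h (fst u) (fst v) + k (snd u) (snd v)"
  have l: "bilinear ?l"
    using h k unfolding bilinear_def linear_iff by (simp add: algebra_simps)
  note z = bilinear_lzero[OF h] bilinear_rzero[OF h] bilinear_lzero[OF k] bilinear_rzero[OF k]
  have "form_det ?l = family_det (DIM('a) + DIM('c)) (\<lambda>i j. ?l (?E i) (?E j))"
    using form_det_enum[OF l product_enum[OF basis_enum_bij basis_enum_bij]] by simp
  also have "\<dots> = family_det DIM('a) (\<lambda>i j. ?l (?E i) (?E j))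
      * family_det DIM('c) (\<lambda>i j. ?l (?E (DIM('a) + i)) (?E (DIM('a) + j)))"
    by (rule family_det_block) (auto simp: z)
  also have "family_det DIM('a) (\<lambda>i j. ?l (?E i) (?E j)) = form_det h"
    unfolding form_det_def by (rule family_det_cong) (auto simp: z)
  also have "family_det DIM('c) (\<lambda>i j. ?l (?E (DIM('a) + i)) (?E (DIM('a) + j))) = form_det k"
    unfolding form_det_def by (rule family_det_cong) (auto simp: z)
  finally show ?thesis .
qed

lemma form_det_real: "form_det (\<lambda>u v. c * u * v) = (c :: real)"
proof -
  have "form_det (\<lambda>u v. c * (u * v :: real)) = c * family_det 1 (\<lambda>i j. basis_enum i * basis_enum j)"
    unfolding form_det_scale by (simp add: form_det_def)
  also have "family_det 1 (\<lambda>i j. basis_enum i * basis_enum j :: real) = 1"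
    by (rule trans[OF family_det_cong family_det_one]) (use enum_orthonormal[OF basis_enum_bij[where 'b = real], of 0 0] in simp)
  finally show ?thesis by (simp add: mult.assoc)
qed

text \<open>Made for evaluating \<open>Theta\<close>, with \<Phi> the map \<open>frame g x\<close>.
  The vectors are the images of the concatenated basis of the product under a block map (L, d)
  followed by \<Phi>, so three determinants multiply.\<close>

lemma vectors_det_frame:
  fixes \<Phi> :: "'a::euclidean_space \<times> real \<Rightarrow> 'b::euclidean_space"
  assumes \<Phi>: "linear \<Phi>" and dim: "DIM('b) = DIM('a) + 1"
  shows "\<bar>vectors_det (\<lambda>j. if j < DIM('a) then \<Phi> (Y j, 0) else \<Phi> (0, c))\<bar>
    = \<bar>map_det \<Phi>\<bar> * \<bar>c\<bar> * \<bar>vectors_det Y\<bar>"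
proof -
  let ?E = "\<lambda>j. if j < DIM('a) then (basis_enum j :: 'a, 0) else (0, basis_enum (j - DIM('a)) :: real)"
  define L where "L = (\<lambda>x :: 'a. \<Sum>k<DIM('a). inner x (basis_enum k) *\<^sub>R Y k)"
  \<comment> \<open>The last vector of \<open>?E\<close> is \<open>(0, basis_enum 0)\<close>;
    scaling by \<open>d\<close> sends it to \<open>(0, c)\<close>.\<close>
  define d where "d = c / (basis_enum 0 :: real)"
  have b0: "(basis_enum 0 :: real) * basis_enum 0 = 1"
    using enum_orthonormal[OF basis_enum_bij[where 'b = real], of 0 0] by simp
  have L: "linear L" unfolding L_def
    by (auto simp: linear_iff inner_add_left scaleR_add_left sum.distrib scaleR_sum_right)
  have d: "linear (\<lambda>t :: real. d *\<^sub>R t)" by (auto simp: linear_iff algebra_simps)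
  have LY: "L (basis_enum j) = Y j" if "j < DIM('a)" for j
  proof -
    have "L (basis_enum j) = (\<Sum>k<DIM('a). if k = j then Y k else 0)"
      unfolding L_def by (rule sum.cong) (auto simp: enum_orthonormal[OF basis_enum_bij that])
    then show ?thesis using that by simp
  qed
  have LL: "linear (\<lambda>(x, y :: real). (L x, d *\<^sub>R y))"
    using L by (auto simp: linear_iff algebra_simps)
  have "vectors_det (\<lambda>j. if j < DIM('a) then \<Phi> (Y j, 0) else \<Phi> (0, c))
      = vectors_det (\<lambda>j. \<Phi> ((\<lambda>(x, y :: real). (L x, d *\<^sub>R y)) (?E j)))"
    unfolding vectors_det_def
    by (rule family_det_cong)
       (use b0 in \<open>auto simp: LY dim d_def linear_0[OF L] less_Suc_eq\<close>)
  also have "\<dots> = map_det \<Phi> * (map_det (\<lambda>(x, y :: real). (L x, d *\<^sub>R y)) * vectors_det ?E)"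
    using vectors_det_linear[OF \<Phi>, of "\<lambda>j. (\<lambda>(x, y :: real). (L x, d *\<^sub>R y)) (?E j)"]
      vectors_det_linear[OF LL refl, of ?E] by (simp only: dim DIM_prod DIM_real)
  finally have "\<bar>vectors_det (\<lambda>j. if j < DIM('a) then \<Phi> (Y j, 0) else \<Phi> (0, c))\<bar>
      = \<bar>map_det \<Phi>\<bar> * (\<bar>map_det (\<lambda>(x, y :: real). (L x, d *\<^sub>R y))\<bar> * \<bar>vectors_det ?E\<bar>)"
    by (simp add: abs_mult)
  also have "\<bar>vectors_det ?E\<bar> = 1"
    by (rule abs_vectors_det_enum[OF product_enum[OF basis_enum_bij basis_enum_bij]])
  also have "\<bar>map_det (\<lambda>(x, y :: real). (L x, d *\<^sub>R y))\<bar> = \<bar>map_det L\<bar> * \<bar>d\<bar>"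
    using map_det_product[OF L d] map_det_scale[of d "\<lambda>t :: real. t"] map_det_id[where 'b = real]
    by (simp add: abs_mult)
  also have "map_det L = vectors_det Y"
    unfolding map_det_def vectors_det_def by (rule family_det_cong) (simp add: LY)
  also have "\<bar>d\<bar> = \<bar>c\<bar>"
  proof -
    have "\<bar>basis_enum 0 :: real\<bar> = 1"
      using b0 by (metis abs_mult_self_eq abs_one real_sqrt_abs2 real_sqrt_one)
    then show ?thesis by (simp add: d_def)
  qed
  finally show ?thesis by simp
qed

text \<open>Leibniz formula, product rule in every summand, then an exchange of the two
  sums.\<close>

lemma vectors_det_has_derivative:
  fixes v :: "nat \<Rightarrow> 'a::real_normed_vector \<Rightarrow> 'b::euclidean_space"
  assumes "\<And>j. j < DIM('b) \<Longrightarrow> (v j has_derivative v' j) (at x)"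
  shows "((\<lambda>y. vectors_det (\<lambda>j. v j y)) has_derivative
    (\<lambda>u. \<Sum>i<DIM('b). vectors_det ((\<lambda>j. v j x)(i := v' i u)))) (at x)"
proof -
  let ?N = "DIM('b)"
  let ?P = "{p. p permutes {0..<?N}}"
  have vd: "vectors_det w = (\<Sum>p\<in>?P. signof p * (\<Prod>j<?N. inner (w j) (basis_enum (p j))))" for w :: "nat \<Rightarrow> 'b"
  proof -
    have lt: "p j < ?N" if "p permutes {0..<?N}" "j < ?N" for p j
      using permutes_in_image[OF that(1), of j] that(2) by simp
    show ?thesis
      unfolding vectors_det_def family_det_def
      by (subst det_col[where n = ?N]) (auto intro!: sum.cong prod.cong simp: lt)
  qed
  have prod: "((\<lambda>y. \<Prod>j<?N. inner (v j y) (basis_enum (p j))) has_derivative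
      (\<lambda>u. \<Sum>i<?N. \<Prod>j<?N. inner (((\<lambda>j. v j x)(i := v' i u)) j) (basis_enum (p j)))) (at x)" for p
  proof -
    have "((\<lambda>y. \<Prod>j<?N. inner (v j y) (basis_enum (p j))) has_derivative
      (\<lambda>u. \<Sum>i<?N. inner (v' i u) (basis_enum (p i)) * (\<Prod>j\<in>{..<?N} - {i}. inner (v j x) (basis_enum (p j))))) (at x)"
      by (rule has_derivative_prod) (auto intro!: derivative_eq_intros assms)
    moreover have "(\<Prod>j<?N. inner (((\<lambda>j. v j x)(i := v' i u)) j) (basis_enum (p j)))
        = inner (v' i u) (basis_enum (p i)) * (\<Prod>j\<in>{..<?N} - {i}. inner (v j x) (basis_enum (p j)))" if "i < ?N" for i u
      using that by (subst prod.remove[of _ i]) (auto intro!: prod.cong)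
    then have "(\<lambda>u. \<Sum>i<?N. \<Prod>j<?N. inner (((\<lambda>j. v j x)(i := v' i u)) j) (basis_enum (p j)))
        = (\<lambda>u. \<Sum>i<?N. inner (v' i u) (basis_enum (p i)) * (\<Prod>j\<in>{..<?N} - {i}. inner (v j x) (basis_enum (p j))))"
      by (intro ext sum.cong) auto
    ultimately show ?thesis by simp
  qed
  have "((\<lambda>y. vectors_det (\<lambda>j. v j y)) has_derivative
    (\<lambda>u. \<Sum>p\<in>?P. signof p * (\<Sum>i<?N. \<Prod>j<?N. inner (((\<lambda>j. v j x)(i := v' i u)) j) (basis_enum (p j))))) (at x)"
    unfolding vd by (intro has_derivative_sum has_derivative_mult_right prod)
  moreover have "(\<lambda>u. \<Sum>p\<in>?P. signof p * (\<Sum>i<?N. \<Prod>j<?N. inner (((\<lambda>j. v j x)(i := v' i u)) j) (basis_enum (p j))))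
     = (\<lambda>u. \<Sum>i<?N. vectors_det ((\<lambda>j. v j x)(i := v' i u)))"
    unfolding vd sum_distrib_left by (subst sum.swap) simp
  ultimately show ?thesis by simp
qed

lemma vectors_det_dependent:
  fixes v :: "nat \<Rightarrow> 'b::euclidean_space"
  assumes "(\<Sum>j<DIM('b). c j *\<^sub>R v j) = 0" "i < DIM('b)" "c i \<noteq> 0"
  shows "vectors_det v = 0"
  unfolding vectors_det_def
proof (rule family_det_kernel[where v = c, OF _ assms(2,3)])
  fix k
  have "(\<Sum>j<DIM('b). inner (v j) (basis_enum k) * c j) = inner (\<Sum>j<DIM('b). c j *\<^sub>R v j) (basis_enum k)"
    by (simp add: inner_sum_left mult.commute)
  then show "(\<Sum>j<DIM('b). inner (v j) (basis_enum k) * c j) = 0" by (simp add: assms(1))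
qed

text \<open>Linearity in one slot is read off from the derivative formula: as a function of that
  slot the determinant is its own derivative at 0, and derivatives are linear.\<close>

lemma vectors_det_add:
  fixes v :: "nat \<Rightarrow> 'b::euclidean_space"
  assumes "i < DIM('b)"
  shows "vectors_det (v(i := a + b)) = vectors_det (v(i := a)) + vectors_det (v(i := b))"
proof -
  let ?F = "\<lambda>y :: 'b. vectors_det (v(i := y))"
  have "linear ?F"
  proof -
    have der: "((\<lambda>y. vectors_det (\<lambda>j. (v(i := y)) j)) has_derivative
      (\<lambda>u. \<Sum>l<DIM('b). vectors_det ((\<lambda>j. (v(i := 0)) j)(l := (if l = i then u else 0))))) (at 0)"
    proof (rule vectors_det_has_derivative)
      show "((\<lambda>y. (v(i := y)) j) has_derivative (\<lambda>u. if j = i then u else 0)) (at 0)" for j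
        by (cases "j = i") auto
    qed
    \<comment> \<open>With 0 in slot \<open>i\<close>, varying slot \<open>i\<close> reproduces
      \<open>?F\<close>, while every other slot contributes a determinant with a zero
      column.\<close>
    have eq: "vectors_det ((\<lambda>j. (v(i := 0)) j)(l := (if l = i then u else 0)))
        = (if l = i then ?F u else 0)" if "l < DIM('b)" for l u
    proof (cases "l = i")
      case False
      have "vectors_det ((v(i := 0))(l := 0)) = 0"
      proof (rule vectors_det_dependent[where i = l and c = "\<lambda>j. if j = l then 1 else 0"])
        show "(\<Sum>j<DIM('b). (if j = l then 1 else 0) *\<^sub>R ((v(i := 0))(l := 0)) j) = 0"
          by (rule sum.neutral) simp
      qed (use that in auto)
      then show ?thesis using False by (simp add: fun_upd_def)
    qed (auto simp: fun_upd_def intro!: arg_cong[where f = vectors_det])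
    have "((\<lambda>y. vectors_det (\<lambda>j. (v(i := y)) j)) has_derivative
      (\<lambda>u. \<Sum>l<DIM('b). if l = i then ?F u else 0)) (at 0)"
      by (rule has_derivative_eq_rhs[OF der], intro ext sum.cong refl eq) simp
    then have "(?F has_derivative ?F) (at 0)" using assms by (simp add: fun_upd_def)
    then show ?thesis by (rule has_derivative_linear)
  qed
  then show ?thesis by (rule linear_add)
qed

lemma map_det_zero:
  fixes L :: "'c::euclidean_space \<Rightarrow> 'b::euclidean_space"
  assumes L: "linear L" and dim: "DIM('c) = DIM('b)" and u: "L u = 0" "u \<noteq> 0"
  shows "map_det L = 0"
proof -
  obtain b where b: "b \<in> Basis" "inner u b \<noteq> 0"
    using \<open>u \<noteq> 0\<close> euclidean_all_zero_iff[of u] by auto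
  then obtain j where j: "j < DIM('c)" "b = basis_enum j"
    using basis_enum_bij[where 'b = 'c] by (auto simp: bij_betw_def)
  have "(\<Sum>k<DIM('c). inner u (basis_enum k) *\<^sub>R L (basis_enum k)) = L (\<Sum>k<DIM('c). inner u (basis_enum k) *\<^sub>R basis_enum k)"
    by (simp add: linear_sum[OF L] linear_cmul[OF L])
  also have "\<dots> = 0" by (simp add: enum_expand[OF basis_enum_bij] u)
  finally show ?thesis
    unfolding map_det_def using j b dim
    by (intro vectors_det_dependent[where c = "\<lambda>k. inner u (basis_enum k)" and i = j]) auto
qed

section \<open>Calculus of smooth maps\<close>

abbreviation dd :: "'a::euclidean_space \<Rightarrow> ('a \<Rightarrow> 'b::real_normed_vector) \<Rightarrow> 'a \<Rightarrow> 'b" where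
  "dd v F \<equiv> flat_D (\<lambda>_. v) F"

lemma dd_eq: "(F has_derivative F') (at x) \<Longrightarrow> dd v F x = F' v"
  by (simp add: flat_D_def frechet_derivative_at[symmetric])

text \<open>\<open>frechet_derivative\<close> is a choice from the predicate
  \<open>has_derivative\<close>, and this predicate is the same for both maps; so the equality also
  covers points where neither is differentiable.\<close>

lemma frechet_derivative_cong:
  assumes "open V" "x \<in> V" "\<And>y. y \<in> V \<Longrightarrow> F y = G y"
  shows "frechet_derivative F (at x) = frechet_derivative G (at x)"
    and "F differentiable (at x) \<longleftrightarrow> G differentiable (at x)"
proof -
  have *: "(F has_derivative F') (at x) \<longleftrightarrow> (G has_derivative F') (at x)" for F'
    using has_derivative_transform_within_open[of F F' x UNIV V G]
      has_derivative_transform_within_open[of G F' x UNIV V F] assms by auto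
  then show "frechet_derivative F (at x) = frechet_derivative G (at x)"
    by (simp add: frechet_derivative_def)
  show "F differentiable (at x) \<longleftrightarrow> G differentiable (at x)"
    by (simp add: differentiable_def *)
qed

lemma C_k_on_cong:
  assumes "open V" "\<And>y. y \<in> V \<Longrightarrow> F y = G y" "C_k_on k V F"
  shows "C_k_on k V G"
  using assms(2,3)
proof (induction k arbitrary: F G)
  case 0
  then show ?case by (simp cong: continuous_on_cong)
next
  case (Suc k)
  have "dd v F y = dd v G y" if "y \<in> V" for v y
    using frechet_derivative_cong(1)[OF assms(1) that, of F G] Suc.prems(1) by (simp add: flat_D_def)
  then have "C_k_on k V (dd v G)" for v
    using Suc.IH[of "dd v F" "dd v G"] Suc.prems(2) by simp
  moreover have "G differentiable (at x)" if "x \<in> V" for x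
    using frechet_derivative_cong(2)[OF assms(1) that, of F G] Suc.prems that by simp
  ultimately show ?case by simp
qed

lemma smooth_on_cong:
  assumes "smooth_on V F" "open V" "\<And>y. y \<in> V \<Longrightarrow> F y = G y"
  shows "smooth_on V G"
  using C_k_on_cong assms unfolding smooth_on_def by blast

lemma C_k_on_subset: "C_k_on k V F \<Longrightarrow> W \<subseteq> V \<Longrightarrow> C_k_on k W F"
  by (induction k arbitrary: F) (auto intro: continuous_on_subset)

lemma smooth_on_subset: "smooth_on V F \<Longrightarrow> W \<subseteq> V \<Longrightarrow> smooth_on W F"
  unfolding smooth_on_def using C_k_on_subset by blast

lemma C_k_on_Suc_mono: "C_k_on (Suc k) V F \<Longrightarrow> C_k_on k V F"
proof (induction k arbitrary: F)
  case 0
  then show ?case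
    by (auto intro!: continuous_at_imp_continuous_on differentiable_imp_continuous_within)
next
  case (Suc k)
  then show ?case by (metis C_k_on.simps(2))
qed

lemma C_k_on_has_derivative:
  assumes "C_k_on (Suc k) V F" "x \<in> V"
  shows "(F has_derivative (\<lambda>v. dd v F x)) (at x)"
  using assms by (simp add: flat_D_def frechet_derivative_works)

text \<open>The common induction step of the closure lemmas: write down a formula for the derivative
  and treat that formula at order \<open>k\<close>. It replaces \<open>flat_D\<close>, with which it
  need agree only on \<open>V\<close>.\<close>

lemma C_k_on_SucI:
  assumes "open V" "\<And>x. x \<in> V \<Longrightarrow> (F has_derivative (\<lambda>v. F' v x)) (at x)"
    and "\<And>v. C_k_on k V (F' v)"
  shows "C_k_on (Suc k) V F"
proof -
  have "C_k_on k V (dd v F)" for v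
    by (rule C_k_on_cong[OF assms(1) _ assms(3)[of v]]) (simp add: dd_eq[OF assms(2)])
  then show ?thesis using assms(2) by (auto simp: differentiable_def)
qed

lemma C_k_on_const: "open V \<Longrightarrow> C_k_on k V (\<lambda>x. c)"
proof (induction k arbitrary: c)
  case (Suc k)
  show ?case
    by (rule C_k_on_SucI[OF Suc.prems, where F' = "\<lambda>v x. 0"]) (auto intro: Suc)
qed simp

lemma C_k_on_add:
  "open V \<Longrightarrow> C_k_on k V F \<Longrightarrow> C_k_on k V G \<Longrightarrow> C_k_on k V (\<lambda>x. F x + G x)"
proof (induction k arbitrary: F G)
  case (Suc k)
  show ?case
    by (rule C_k_on_SucI[OF Suc.prems(1), where F' = "\<lambda>v x. dd v F x + dd v G x"])
       (use Suc C_k_on_has_derivative[OF Suc.prems(2)] C_k_on_has_derivative[OF Suc.prems(3)]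
        in \<open>auto intro!: derivative_eq_intros\<close>)
qed (simp add: continuous_on_add)

lemma C_k_on_linear:
  assumes "bounded_linear L" "open V"
  shows "C_k_on k V F \<Longrightarrow> C_k_on k V (\<lambda>x. L (F x))"
proof (induction k arbitrary: F)
  case 0
  then show ?case using bounded_linear.continuous_on[OF assms(1)] by simp
next
  case (Suc k)
  show ?case
    by (rule C_k_on_SucI[OF assms(2), where F' = "\<lambda>v x. L (dd v F x)"])
       (use Suc bounded_linear.has_derivative[OF assms(1) C_k_on_has_derivative[OF Suc.prems]] in auto)
qed

lemma C_k_on_bilinear:
  assumes "bounded_bilinear p" "open V"
  shows "C_k_on k V F \<Longrightarrow> C_k_on k V G \<Longrightarrow> C_k_on k V (\<lambda>x. p (F x) (G x))"
proof (induction k arbitrary: F G)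
  case 0
  then show ?case using bounded_bilinear.continuous_on[OF assms(1)] by simp
next
  case (Suc k)
  show ?case
    by (rule C_k_on_SucI[OF assms(2), where F' = "\<lambda>v x. p (F x) (dd v G x) + p (dd v F x) (G x)"])
       (use bounded_bilinear.FDERIV[OF assms(1) C_k_on_has_derivative[OF Suc.prems(1)] C_k_on_has_derivative[OF Suc.prems(2)]]
          Suc C_k_on_Suc_mono[OF Suc.prems(1)] C_k_on_Suc_mono[OF Suc.prems(2)]
        in \<open>auto intro!: C_k_on_add[OF assms(2)]\<close>)
qed

lemma C_k_on_sum:
  assumes "open V" "\<And>i. i \<in> I \<Longrightarrow> C_k_on k V (F i)"
  shows "C_k_on k V (\<lambda>x. \<Sum>i\<in>I. F i x)"
  using assms(2)
  by (induction I rule: infinite_finite_induct) (auto intro!: C_k_on_const C_k_on_add assms(1))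

lemma C_k_on_id: "open V \<Longrightarrow> C_k_on k V (\<lambda>x. x)"
proof (cases k)
  case (Suc l)
  assume "open V"
  then show ?thesis unfolding Suc
    by (intro C_k_on_SucI[where F' = "\<lambda>v x. v"] C_k_on_const) auto
qed simp

lemma apply_linear_expand:
  assumes "linear L"
  shows "L (w :: 'c::euclidean_space) = (\<Sum>b\<in>Basis. inner w b *\<^sub>R L b)"
proof -
  have "L w = L (\<Sum>b\<in>Basis. inner w b *\<^sub>R b)" by (simp add: euclidean_representation)
  then show ?thesis by (simp add: linear_sum[OF assms] linear_cmul[OF assms])
qed

text \<open>A family of linear maps is known only through its values on fixed vectors. Expanding
  \<open>W x\<close> in the standard basis leaves a finite sum of products of coefficient functions
  with such values.\<close>

lemma C_k_on_apply:
  fixes L :: "'a::euclidean_space \<Rightarrow> 'c::euclidean_space \<Rightarrow> 'b::real_normed_vector"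
  assumes V: "open V" and lin: "\<And>x. x \<in> V \<Longrightarrow> linear (L x)"
    and L: "\<And>w. C_k_on k V (\<lambda>x. L x w)" and W: "C_k_on k V W"
  shows "C_k_on k V (\<lambda>x. L x (W x))"
proof (rule C_k_on_cong[OF V])
  show "C_k_on k V (\<lambda>x. \<Sum>b\<in>Basis. inner (W x) b *\<^sub>R L x b)"
    by (intro C_k_on_sum[OF V] C_k_on_bilinear[OF bounded_bilinear_scaleR V]
        C_k_on_linear[OF bounded_linear_inner_left V] W L)
qed (simp add: apply_linear_expand[OF lin, symmetric])

lemma C_k_on_compose:
  fixes G :: "'c::euclidean_space \<Rightarrow> 'a::euclidean_space" and F :: "'a \<Rightarrow> 'b::real_normed_vector"
  assumes U: "open U" and V: "open V" and sub: "G ` U \<subseteq> V"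
  shows "C_k_on k U G \<Longrightarrow> C_k_on k V F \<Longrightarrow> C_k_on k U (\<lambda>x. F (G x))"
proof (induction k arbitrary: F)
  case 0
  then show ?case using continuous_on_compose2 sub by auto
next
  case (Suc k)
  have F: "(F has_derivative (\<lambda>v. dd v F (G x))) (at (G x))" if "x \<in> U" for x
    by (rule C_k_on_has_derivative[OF Suc.prems(2)]) (use that sub in auto)
  show ?case
  \<comment> \<open>By the chain rule the derivative is the linear family
    \<open>dd w F (G x)\<close> applied to a vector that moves with \<open>x\<close>, the situation
    of \<open>C_k_on_apply\<close>.\<close>
  proof (rule C_k_on_SucI[OF U, where F' = "\<lambda>v x. dd (dd v G x) F (G x)"])
    show "((\<lambda>x. F (G x)) has_derivative (\<lambda>v. dd (dd v G x) F (G x))) (at x)" if "x \<in> U" for x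
      by (rule has_derivative_compose[OF C_k_on_has_derivative[OF Suc.prems(1) that] F[OF that]])
    show "C_k_on k U (\<lambda>x. dd (dd v G x) F (G x))" for v
      by (rule C_k_on_apply[OF U, where L = "\<lambda>x w. dd w F (G x)"])
         (use F Suc C_k_on_Suc_mono[OF Suc.prems(1)] in \<open>auto dest: has_derivative_linear\<close>)
  qed
qed

lemma C_k_on_exp:
  "open V \<Longrightarrow> C_k_on k V F \<Longrightarrow> C_k_on k V (\<lambda>x. exp (F x :: real))"
proof (induction k arbitrary: F)
  case (Suc k)
  show ?case
    by (rule C_k_on_SucI[OF Suc.prems(1), where F' = "\<lambda>v x. exp (F x) * dd v F x"])
       (use Suc C_k_on_Suc_mono[OF Suc.prems(2)] C_k_on_has_derivative[OF Suc.prems(2)]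
        in \<open>auto intro!: derivative_eq_intros C_k_on_bilinear[OF bounded_bilinear_mult]\<close>)
qed (auto intro: continuous_intros)

section \<open>Smooth dependence of inverse linear maps on a parameter\<close>

abbreviation linv :: "('c \<Rightarrow> 'b) \<Rightarrow> 'b \<Rightarrow> 'c" where
  "linv \<equiv> inv_into UNIV"

lemma linear_bij_inv:
  assumes "linear L" "bij L"
  shows "linear (linv L)"
  by (rule linearI; rule inv_f_eq[OF bij_is_inj[OF assms(2)]])
     (simp_all add: linear_add[OF assms(1)] linear_cmul[OF assms(1)] surj_f_inv_f[OF bij_is_surj[OF assms(2)]])

text \<open>In finite dimension, pointwise convergence of linear maps is uniform on bounded sets, so
  half of the lower bound of \<open>L x\<close> survives near \<open>x\<close>.\<close>

lemma bounded_below_nearby: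
  fixes L :: "'a::real_normed_vector \<Rightarrow> 'c::euclidean_space \<Rightarrow> 'b::euclidean_space"
  assumes "eventually (\<lambda>y. linear (L y)) (at x)" "linear (L x)" "inj (L x)"
    and cont: "\<And>w. ((\<lambda>y. L y w) \<longlongrightarrow> L x w) (at x)"
  obtains B where "B > 0" "eventually (\<lambda>y. \<forall>w. B * norm w \<le> norm (L y w)) (at x)"
proof -
  obtain B where B: "B > 0" "\<And>w. B * norm w \<le> norm (L x w)"
    using linear_inj_bounded_below_pos[OF assms(2,3)] by blast
  \<comment> \<open>An error below \<open>e\<close> on each basis vector adds up to at most
    \<open>B / 2 * norm w\<close>.\<close>
  define e where "e = B / (2 * DIM('c))"
  have e: "e > 0" using B by (simp add: e_def)
  have "eventually (\<lambda>y. \<forall>b\<in>Basis. dist (L y b) (L x b) < e) (at x)"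
    by (rule eventually_ball_finite) (use cont e in \<open>auto simp: tendsto_iff\<close>)
  with assms(1) have "eventually (\<lambda>y. \<forall>w. (B/2) * norm w \<le> norm (L y w)) (at x)"
  proof eventually_elim
    case (elim y)
    show ?case
    proof
      fix w
      have "norm (L x w - L y w) = norm (\<Sum>b\<in>Basis. inner w b *\<^sub>R (L x b - L y b))"
        by (subst apply_linear_expand[OF elim(1)], subst apply_linear_expand[OF assms(2)])
           (simp add: sum_subtractf scaleR_diff_right)
      also have "\<dots> \<le> (\<Sum>b\<in>(Basis :: 'c set). norm w * e)"
      proof (rule sum_norm_le)
        fix b :: 'c assume b: "b \<in> Basis"
        have "norm (L x b - L y b) \<le> e"
          using elim(2) b by (simp add: dist_norm norm_minus_commute less_imp_le)
        then show "norm (inner w b *\<^sub>R (L x b - L y b)) \<le> norm w * e"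
          using Basis_le_norm[OF b, of w] by (auto intro!: mult_mono)
      qed
      also have "\<dots> = B / 2 * norm w" by (simp add: e_def)
      finally have "norm (L x w - L y w) \<le> B / 2 * norm w" .
      then show "B / 2 * norm w \<le> norm (L y w)"
        using B(2)[of w] norm_triangle_ineq2[of "L x w" "L y w"] by (simp add: algebra_simps)
    qed
  qed
  then show ?thesis using that[of "B / 2"] B(1) by simp
qed

text \<open>\<open>L y\<close> carries the error \<open>linv (L y) u - w\<close> to
  \<open>L x w - L y w\<close>, which tends to 0, and \<open>L y\<close> is bounded below uniformly
  near \<open>x\<close>.\<close>

lemma inverse_family_tendsto:
  fixes L :: "'a::real_normed_vector \<Rightarrow> 'c::euclidean_space \<Rightarrow> 'b::euclidean_space"
  assumes ev: "eventually (\<lambda>y. linear (L y) \<and> bij (L y)) (at x)" and x: "linear (L x)" "bij (L x)"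
    and cont: "\<And>w. ((\<lambda>y. L y w) \<longlongrightarrow> L x w) (at x)"
  shows "((\<lambda>y. linv (L y) u) \<longlongrightarrow> linv (L x) u) (at x)"
proof -
  obtain B where B: "B > 0" and low: "eventually (\<lambda>y. \<forall>w. B * norm w \<le> norm (L y w)) (at x)"
    using bounded_below_nearby[OF eventually_mono[OF ev] x(1) bij_is_inj[OF x(2)] cont] by blast
  define w where "w = linv (L x) u"
  have Lw: "L x w = u" using x(2) by (simp add: w_def bij_is_surj surj_f_inv_f)
  have "((\<lambda>y. linv (L y) u - w) \<longlongrightarrow> 0) (at x)"
  proof (rule Lim_null_comparison)
    show "eventually (\<lambda>y. norm (linv (L y) u - w) \<le> norm (L y w - L x w) / B) (at x)"
      using ev low
    proof eventually_elim
      case (elim y)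
      have "L y (linv (L y) u - w) = L x w - L y w"
        using elim(1) Lw by (simp add: linear_diff bij_is_surj surj_f_inv_f)
      then have "B * norm (linv (L y) u - w) \<le> norm (L y w - L x w)"
        using elim(2) by (metis norm_minus_commute)
      then show ?case using B by (simp add: field_simps)
    qed
    have "((\<lambda>y. norm (L y w - L x w) / B) \<longlongrightarrow> norm (L x w - L x w) / B) (at x)"
      by (intro tendsto_intros cont) (use B in auto)
    then show "((\<lambda>y. norm (L y w - L x w) / B) \<longlongrightarrow> 0) (at x)" by simp
  qed
  then show ?thesis unfolding w_def by (simp add: Lim_null[symmetric])
qed

text \<open>A product rule in which \<open>c\<close> is merely continuous at \<open>x\<close>: the
  derivative of \<open>c\<close> would be multiplied by \<open>s x = 0\<close>. It is meant for
  inverse families, whose continuity is known before their differentiability.\<close>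

lemma has_derivative_scaleR_zero:
  fixes s :: "'a::real_normed_vector \<Rightarrow> real" and c :: "'a \<Rightarrow> 'b::real_normed_vector"
  assumes s: "(s has_derivative s') (at x)" and "s x = 0" and c: "(c \<longlongrightarrow> c x) (at x)"
  shows "((\<lambda>y. s y *\<^sub>R c y) has_derivative (\<lambda>h. s' h *\<^sub>R c x)) (at x)"
proof -
  have bl: "bounded_linear s'" using s by (rule has_derivative_bounded_linear)
  obtain K where K: "K \<ge> 0" "\<And>h. norm (s' h) \<le> norm h * K"
    using bounded_linear.nonneg_bounded[OF bl] by blast
  have r: "((\<lambda>y. (s y - s x - s' (y - x)) /\<^sub>R norm (y - x)) \<longlongrightarrow> 0) (at x)"
    using s by (simp only: has_derivative_at_within)
  have 1: "((\<lambda>y. ((s y - s x - s' (y - x)) /\<^sub>R norm (y - x)) *\<^sub>R c y) \<longlongrightarrow> 0 *\<^sub>R c x) (at x)"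
    by (intro tendsto_intros r c)
  have 2: "((\<lambda>y. (s' (y - x) /\<^sub>R norm (y - x)) *\<^sub>R (c y - c x)) \<longlongrightarrow> 0) (at x)"
  proof (rule Lim_null_comparison)
    show "eventually (\<lambda>y. norm ((s' (y - x) /\<^sub>R norm (y - x)) *\<^sub>R (c y - c x)) \<le> K * norm (c y - c x)) (at x)"
    proof (rule always_eventually, rule allI)
      fix y
      have "norm (s' (y - x) /\<^sub>R norm (y - x)) \<le> K \<or> y = x"
        using K(2)[of "y - x"] by (auto simp: field_simps)
      then show "norm ((s' (y - x) /\<^sub>R norm (y - x)) *\<^sub>R (c y - c x)) \<le> K * norm (c y - c x)"
        using K(1) by (auto intro!: mult_right_mono)
    qed
    have "((\<lambda>y. K * norm (c y - c x)) \<longlongrightarrow> K * norm (c x - c x)) (at x)"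
      by (intro tendsto_intros c)
    then show "((\<lambda>y. K * norm (c y - c x)) \<longlongrightarrow> 0) (at x)" by simp
  qed
  have "((\<lambda>y. (s y *\<^sub>R c y - s x *\<^sub>R c x - s' (y - x) *\<^sub>R c x) /\<^sub>R norm (y - x)) \<longlongrightarrow> 0) (at x)"
    using tendsto_add[OF 1 2] by (simp add: \<open>s x = 0\<close> algebra_simps)
  then show ?thesis
    unfolding has_derivative_at_within using bounded_linear_scaleR_const[OF bl] by simp
qed

text \<open>With \<open>w = linv (L x) u\<close> one has
  \<open>linv (L y) u = w - linv (L y) (L y w - u)\<close>. The vector \<open>L y w - u\<close>
  vanishes at \<open>y = x\<close>, so expanding it in the basis makes
  \<open>has_derivative_scaleR_zero\<close> applicable.\<close>

lemma inverse_family_has_derivative: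
  fixes L :: "'a::real_normed_vector \<Rightarrow> 'c::euclidean_space \<Rightarrow> 'b::euclidean_space"
  assumes ev: "eventually (\<lambda>y. linear (L y) \<and> bij (L y)) (at x)" and x: "linear (L x)" "bij (L x)"
    and cont: "\<And>w. ((\<lambda>y. L y w) \<longlongrightarrow> L x w) (at x)"
    and der: "((\<lambda>y. L y (linv (L x) u)) has_derivative m') (at x)"
  shows "((\<lambda>y. linv (L y) u) has_derivative (\<lambda>h. - linv (L x) (m' h))) (at x)"
proof -
  define w where "w = linv (L x) u"
  define m where "m = (\<lambda>y. L y w - u)"
  have Lw: "L x w = u" using x(2) by (simp add: w_def bij_is_surj surj_f_inv_f)
  have lininv: "linear (linv (L x))" using x by (rule linear_bij_inv)
  have m: "(m has_derivative m') (at x)" "m x = 0"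
    unfolding m_def using der Lw by (auto intro!: derivative_eq_intros simp: w_def)
  have "((\<lambda>y. \<Sum>b\<in>Basis. inner (m y) b *\<^sub>R linv (L y) b) has_derivative
      (\<lambda>h. \<Sum>b\<in>Basis. inner (m' h) b *\<^sub>R linv (L x) b)) (at x)"
    by (intro has_derivative_sum has_derivative_scaleR_zero has_derivative_inner_left m(1)
        inverse_family_tendsto[OF ev x cont]) (simp add: m(2))
  from has_derivative_diff[OF has_derivative_const[of w] this]
  have "((\<lambda>y. w - (\<Sum>b\<in>Basis. inner (m y) b *\<^sub>R linv (L y) b)) has_derivative
      (\<lambda>h. - (\<Sum>b\<in>Basis. inner (m' h) b *\<^sub>R linv (L x) b))) (at x)"
    by simp
  then have 1: "((\<lambda>y. w - (\<Sum>b\<in>Basis. inner (m y) b *\<^sub>R linv (L y) b)) has_derivative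
      (\<lambda>h. - linv (L x) (m' h))) (at x)"
    by (simp add: apply_linear_expand[OF lininv, symmetric])
  have eq: "w - (\<Sum>b\<in>Basis. inner (m y) b *\<^sub>R linv (L y) b) = linv (L y) u" if "linear (L y)" "bij (L y)" for y
  proof -
    have l: "linear (linv (L y))" using that by (rule linear_bij_inv)
    have "linv (L y) (m y) = w - linv (L y) u"
      unfolding m_def by (simp add: linear_diff[OF l] inv_f_f[OF bij_is_inj[OF that(2)]])
    then show ?thesis by (simp add: apply_linear_expand[OF l, symmetric])
  qed
  show ?thesis
    by (rule has_derivative_transform_eventually[OF 1]) (use ev eq x in \<open>auto elim!: eventually_mono\<close>)
qed

lemma dd_linear_family:
  fixes L :: "'a::euclidean_space \<Rightarrow> 'c::euclidean_space \<Rightarrow> 'b::real_normed_vector"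
  assumes V: "open V" "x \<in> V" and L: "\<And>y. y \<in> V \<Longrightarrow> linear (L y)"
    and d: "\<And>w. (\<lambda>y. L y w) differentiable (at x)"
  shows "linear (\<lambda>w. dd v (\<lambda>y. L y w) x)"
proof (rule linearI)
  have der: "((\<lambda>y. L y w) has_derivative (\<lambda>v. dd v (\<lambda>y. L y w) x)) (at x)" for w
    using d by (simp add: flat_D_def frechet_derivative_works)
  fix w w' c
  have "dd v (\<lambda>y. L y (w + w')) x = dd v (\<lambda>y. L y w + L y w') x"
    unfolding flat_D_def
    by (subst frechet_derivative_cong(1)[OF V, of _ "\<lambda>y. L y w + L y w'"]) (use L in \<open>auto simp: linear_add\<close>)
  also have "\<dots> = dd v (\<lambda>y. L y w) x + dd v (\<lambda>y. L y w') x"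
    by (rule dd_eq) (intro has_derivative_add der)
  finally show "dd v (\<lambda>y. L y (w + w')) x = dd v (\<lambda>y. L y w) x + dd v (\<lambda>y. L y w') x" .
  have "dd v (\<lambda>y. L y (c *\<^sub>R w)) x = dd v (\<lambda>y. c *\<^sub>R L y w) x"
    unfolding flat_D_def
    by (subst frechet_derivative_cong(1)[OF V, of _ "\<lambda>y. c *\<^sub>R L y w"]) (use L in \<open>auto simp: linear_cmul\<close>)
  also have "\<dots> = c *\<^sub>R dd v (\<lambda>y. L y w) x"
    by (rule dd_eq) (intro has_derivative_scaleR_right der)
  finally show "dd v (\<lambda>y. L y (c *\<^sub>R w)) x = c *\<^sub>R dd v (\<lambda>y. L y w) x" .
qed

text \<open>The derivative is minus inverse, derivative of \<open>L\<close>, inverse; it contains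
  the inverse itself undifferentiated, so order \<open>k\<close> of the inverse yields order
  \<open>k + 1\<close>.\<close>

lemma C_k_on_inverse:
  fixes L :: "'a::euclidean_space \<Rightarrow> 'c::euclidean_space \<Rightarrow> 'b::euclidean_space"
  assumes V: "open V" and L: "\<And>x. x \<in> V \<Longrightarrow> linear (L x) \<and> bij (L x)"
  shows "(\<And>w. C_k_on k V (\<lambda>x. L x w)) \<Longrightarrow> C_k_on k V (\<lambda>x. linv (L x) u)"
proof (induction k arbitrary: u)
  have ev: "eventually (\<lambda>y. linear (L y) \<and> bij (L y)) (at x)" if "x \<in> V" for x
    using L that by (intro eventually_at_in_open'[OF V that, THEN eventually_mono]) auto
  {
    case 0
    have "((\<lambda>y. linv (L y) u) \<longlongrightarrow> linv (L x) u) (at x)" if "x \<in> V" for x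
    proof (rule inverse_family_tendsto)
      show "((\<lambda>y. L y w) \<longlongrightarrow> L x w) (at x)" for w
        using 0[of w] that V by (simp add: continuous_on_eq_continuous_at continuous_at)
    qed (use L ev that in auto)
    then show ?case using V by (simp add: continuous_on_eq_continuous_at continuous_at)
  next
    case (Suc k)
    let ?F = "\<lambda>v x. - linv (L x) (dd v (\<lambda>y. L y (linv (L x) u)) x)"
    have k: "C_k_on k V (\<lambda>x. L x w)" for w using C_k_on_Suc_mono Suc.prems by blast
    have der: "((\<lambda>y. L y w) has_derivative (\<lambda>v. dd v (\<lambda>y. L y w) x)) (at x)" if "x \<in> V" for w x
      using C_k_on_has_derivative[OF Suc.prems that] .
    have lin: "linear (\<lambda>w. dd v (\<lambda>y. L y w) x)" if x: "x \<in> V" for v x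
      using dd_linear_family[OF V x] L der[OF x] by (blast intro: differentiableI)
    have IH: "C_k_on k V (\<lambda>x. linv (L x) u)" for u by (rule Suc.IH[OF k])
    show ?case
    proof (rule C_k_on_SucI[OF V, where F' = ?F])
      fix x assume x: "x \<in> V"
      have "((\<lambda>y. L y w) \<longlongrightarrow> L x w) (at x)" for w
        using has_derivative_continuous[OF der[OF x]] by (simp add: continuous_at)
      then show "((\<lambda>x. linv (L x) u) has_derivative (\<lambda>v. ?F v x)) (at x)"
        using inverse_family_has_derivative[OF ev[OF x] _ _ _ der[OF x]] L[OF x] by blast
    next
      fix v
      have 1: "C_k_on k V (\<lambda>x. dd v (\<lambda>y. L y (linv (L x) u)) x)"
        by (rule C_k_on_apply[OF V, where L = "\<lambda>x w. dd v (\<lambda>y. L y w) x"])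
           (use lin Suc.prems IH in auto)
      have "C_k_on k V (\<lambda>x. linv (L x) (dd v (\<lambda>y. L y (linv (L x) u)) x))"
        by (rule C_k_on_apply[OF V _ IH 1]) (use L linear_bij_inv in blast)
      then show "C_k_on k V (?F v)"
        by (rule C_k_on_linear[OF bounded_linear_minus[OF bounded_linear_ident] V])
    qed
  }
qed

section \<open>Smooth maps\<close>

lemma smooth_on_C_k: "smooth_on V F \<Longrightarrow> C_k_on k V F"
  by (simp add: smooth_on_def)

lemma smooth_on_dd: "smooth_on V F \<Longrightarrow> smooth_on V (dd v F)"
  unfolding smooth_on_def by (metis C_k_on.simps(2))

lemma smooth_on_has_derivative:
  "smooth_on V F \<Longrightarrow> x \<in> V \<Longrightarrow> (F has_derivative (\<lambda>v. dd v F x)) (at x)"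
  by (rule C_k_on_has_derivative[OF smooth_on_C_k])

lemma smooth_on_has_derivative':
  "smooth_on V F \<Longrightarrow> x \<in> V \<Longrightarrow> (F has_derivative frechet_derivative F (at x)) (at x)"
  using smooth_on_has_derivative[of V F x] by (simp add: flat_D_def)

lemma smooth_on_linear_derivative:
  "smooth_on V F \<Longrightarrow> x \<in> V \<Longrightarrow> linear (frechet_derivative F (at x))"
  by (rule has_derivative_linear[OF smooth_on_has_derivative'])

lemma smooth_on_continuous: "smooth_on V F \<Longrightarrow> continuous_on V F"
  using smooth_on_C_k[of V F 0] by simp

lemma smooth_onI:
  assumes "open V" "\<And>x. x \<in> V \<Longrightarrow> (F has_derivative (\<lambda>v. F' v x)) (at x)" "\<And>v. smooth_on V (F' v)"
  shows "smooth_on V F"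
  unfolding smooth_on_def
proof
  fix k show "C_k_on k V F"
    by (rule C_k_on_Suc_mono, rule C_k_on_SucI[OF assms(1,2)]) (use assms(3) smooth_on_C_k in auto)
qed

lemma smooth_on_const: "open V \<Longrightarrow> smooth_on V (\<lambda>x. c)"
  and smooth_on_id: "open V \<Longrightarrow> smooth_on V (\<lambda>x. x)"
  and smooth_on_add: "open V \<Longrightarrow> smooth_on V F \<Longrightarrow> smooth_on V G \<Longrightarrow> smooth_on V (\<lambda>x. F x + G x)"
  and smooth_on_linear: "bounded_linear L \<Longrightarrow> open V \<Longrightarrow> smooth_on V F \<Longrightarrow> smooth_on V (\<lambda>x. L (F x))"
  and smooth_on_bilinear: "bounded_bilinear p \<Longrightarrow> open V \<Longrightarrow> smooth_on V F \<Longrightarrow> smooth_on V F2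
    \<Longrightarrow> smooth_on V (\<lambda>x. p (F x) (F2 x))"
  and smooth_on_exp: "open V \<Longrightarrow> smooth_on V r \<Longrightarrow> smooth_on V (\<lambda>x. exp (r x :: real))"
  by (simp_all add: smooth_on_def C_k_on_const C_k_on_id C_k_on_add C_k_on_linear C_k_on_bilinear C_k_on_exp)

lemma smooth_on_compose:
  "open U \<Longrightarrow> open V \<Longrightarrow> G ` U \<subseteq> V \<Longrightarrow> smooth_on U G \<Longrightarrow> smooth_on V F \<Longrightarrow> smooth_on U (\<lambda>x. F (G x))"
  by (simp add: smooth_on_def C_k_on_compose)

lemma smooth_on_apply:
  fixes L :: "'a::euclidean_space \<Rightarrow> 'c::euclidean_space \<Rightarrow> 'b::real_normed_vector"
  shows "open V \<Longrightarrow> (\<And>x. x \<in> V \<Longrightarrow> linear (L x)) \<Longrightarrow> (\<And>w. smooth_on V (\<lambda>x. L x w)) \<Longrightarrow> smooth_on V W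
    \<Longrightarrow> smooth_on V (\<lambda>x. L x (W x))"
  by (simp add: smooth_on_def C_k_on_apply)

lemma smooth_on_inverse:
  fixes L :: "'a::euclidean_space \<Rightarrow> 'c::euclidean_space \<Rightarrow> 'b::euclidean_space"
  shows "open V \<Longrightarrow> (\<And>x. x \<in> V \<Longrightarrow> linear (L x) \<and> bij (L x)) \<Longrightarrow> (\<And>w. smooth_on V (\<lambda>x. L x w))
    \<Longrightarrow> smooth_on V (\<lambda>x. linv (L x) u)"
  by (simp add: smooth_on_def C_k_on_inverse)

lemma smooth_on_diff:
  assumes "open V" "smooth_on V F" "smooth_on V G" shows "smooth_on V (\<lambda>x. F x - G x)"
  using smooth_on_add[OF assms(1,2) smooth_on_linear[OF bounded_linear_minus[OF bounded_linear_ident] assms(1,3)]]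
  by simp

lemma smooth_on_Pair:
  assumes "open V" "smooth_on V F" "smooth_on V G" shows "smooth_on V (\<lambda>x. (F x, G x))"
proof -
  have "smooth_on V (\<lambda>x. (F x, 0) + (0, G x))"
    by (intro smooth_on_add assms(1) smooth_on_linear[where L = "\<lambda>y. (y, 0)"] smooth_on_linear[where L = "\<lambda>y. (0, y)"] assms
        bounded_linear_Pair bounded_linear_ident bounded_linear_zero)
  then show ?thesis by simp
qed

lemma smooth_on_derivative_apply:
  assumes "open V" "smooth_on V g" "smooth_on V Y"
  shows "smooth_on V (\<lambda>x. frechet_derivative g (at x) (Y x))"
  by (rule smooth_on_apply[OF assms(1)])
     (use smooth_on_linear_derivative[OF assms(2)] smooth_on_dd[OF assms(2)] assms(3) in \<open>auto simp: flat_D_def[abs_def]\<close>)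

section \<open>Symmetry of second derivatives\<close>

lemma line_derivative:
  assumes "(\<phi> has_derivative D) (at (p + s *\<^sub>R u))"
  shows "((\<lambda>s. \<phi> (p + s *\<^sub>R u)) has_real_derivative D u) (at s)"
proof -
  have "((\<lambda>s. p + s *\<^sub>R u) has_derivative (\<lambda>h. h *\<^sub>R u)) (at s)"
    by (auto intro!: derivative_eq_intros)
  from has_derivative_compose[OF this assms] show ?thesis
    using linear_cmul[OF has_derivative_linear[OF assms], of _ u]
    by (simp add: has_field_derivative_def mult_commute_abs)
qed

text \<open>The mean value theorem twice: in direction \<open>u\<close> for the difference of two
  translates, then in direction \<open>v\<close>.\<close>

lemma second_difference:
  fixes \<phi> :: "'a::euclidean_space \<Rightarrow> real"
  assumes \<phi>: "smooth_on V \<phi>" and h: "h > 0"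
    and in_V: "\<And>s t. 0 \<le> s \<Longrightarrow> s \<le> h \<Longrightarrow> 0 \<le> t \<Longrightarrow> t \<le> h \<Longrightarrow> x + s *\<^sub>R u + t *\<^sub>R v \<in> V"
  obtains s t where "0 < s" "s < h" "0 < t" "t < h"
    "\<phi> (x + h *\<^sub>R u + h *\<^sub>R v) - \<phi> (x + h *\<^sub>R u) - \<phi> (x + h *\<^sub>R v) + \<phi> x
      = h * h * dd v (dd u \<phi>) (x + s *\<^sub>R u + t *\<^sub>R v)"
proof -
  let ?A = "\<lambda>s. \<phi> ((x + h *\<^sub>R v) + s *\<^sub>R u) - \<phi> (x + s *\<^sub>R u)"
  have A: "(?A has_real_derivative dd u \<phi> (x + s *\<^sub>R u + h *\<^sub>R v) - dd u \<phi> (x + s *\<^sub>R u)) (at s)"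
    if "0 \<le> s" "s \<le> h" for s
    by (intro DERIV_diff line_derivative)
       (use smooth_on_has_derivative[OF \<phi>] in_V[of s h] in_V[of s 0] that h in \<open>auto simp: ac_simps\<close>)
  obtain s where s: "0 < s" "s < h" "?A h - ?A 0 = (h - 0) * (dd u \<phi> (x + s *\<^sub>R u + h *\<^sub>R v) - dd u \<phi> (x + s *\<^sub>R u))"
    using MVT2[OF h A] by auto
  let ?B = "\<lambda>t. dd u \<phi> ((x + s *\<^sub>R u) + t *\<^sub>R v)"
  have B: "(?B has_real_derivative dd v (dd u \<phi>) (x + s *\<^sub>R u + t *\<^sub>R v)) (at t)" if "0 \<le> t" "t \<le> h" for t
    by (rule line_derivative, rule smooth_on_has_derivative[OF smooth_on_dd[OF \<phi>]]) (use in_V s that in auto)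
  obtain t where t: "0 < t" "t < h" "?B h - ?B 0 = (h - 0) * dd v (dd u \<phi>) (x + s *\<^sub>R u + t *\<^sub>R v)"
    using MVT2[OF h B] by auto
  show ?thesis
    by (rule that[OF s(1,2) t(1,2)]) (use s(3) t(3) in \<open>simp add: algebra_simps\<close>)
qed

text \<open>The second difference over a parallelogram does not change when its sides are exchanged.
  Hence the two mixed derivatives agree at two points arbitrarily close to \<open>x\<close>, and
  their continuity excludes a gap at \<open>x\<close>.\<close>

lemma second_derivative_symmetric_real:
  fixes \<phi> :: "'a::euclidean_space \<Rightarrow> real"
  assumes V: "open V" "x \<in> V" and \<phi>: "smooth_on V \<phi>"
  shows "dd u (dd v \<phi>) x = dd v (dd u \<phi>) x"
proof (rule ccontr)
  let ?p = "dd u (dd v \<phi>)" and ?q = "dd v (dd u \<phi>)"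
  assume "?p x \<noteq> ?q x"
  define e where "e = \<bar>?p x - ?q x\<bar> / 2"
  have e: "e > 0" using \<open>?p x \<noteq> ?q x\<close> by (simp add: e_def)
  have p: "isCont ?p x" and q: "isCont ?q x"
    using smooth_on_continuous[OF smooth_on_dd[OF smooth_on_dd[OF \<phi>]]] V
    by (auto simp: continuous_on_eq_continuous_at)
  obtain d1 where d1: "d1 > 0" "ball x d1 \<subseteq> V" using V openE by blast
  obtain d2 where d2: "d2 > 0" "\<And>y. dist y x < d2 \<Longrightarrow> dist (?p y) (?p x) < e"
    using p e unfolding continuous_at_eps_delta by blast
  obtain d3 where d3: "d3 > 0" "\<And>y. dist y x < d3 \<Longrightarrow> dist (?q y) (?q x) < e"
    using q e unfolding continuous_at_eps_delta by blast
  define d where "d = min d1 (min d2 d3)"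
  \<comment> \<open>Small enough to keep the whole parallelogram within distance \<open>d\<close> of
    \<open>x\<close>; the summand 1 covers the case that both sides vanish.\<close>
  define h where "h = d / (norm u + norm v + 1)"
  have d: "d > 0" using d1 d2 d3 by (simp add: d_def)
  have h: "h > 0" using d by (simp add: h_def add_nonneg_pos)
  have near: "dist (x + s *\<^sub>R u + t *\<^sub>R v) x < d" if "0 \<le> s" "s \<le> h" "0 \<le> t" "t \<le> h" for s t
  proof -
    have "dist (x + s *\<^sub>R u + t *\<^sub>R v) x \<le> s * norm u + t * norm v"
      using norm_triangle_ineq[of "s *\<^sub>R u" "t *\<^sub>R v"] that by (simp add: dist_norm add.assoc)
    also have "\<dots> \<le> h * norm u + h * norm v" using that by (intro add_mono mult_right_mono) auto
    also have "\<dots> < h * (norm u + norm v + 1)" using h by (simp add: algebra_simps)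
    also have "\<dots> = d" unfolding h_def using norm_ge_zero[of u] norm_ge_zero[of v] by (simp add: add_nonneg_eq_0_iff)
    finally show ?thesis .
  qed
  have in_V: "x + s *\<^sub>R u + t *\<^sub>R v \<in> V" if "0 \<le> s" "s \<le> h" "0 \<le> t" "t \<le> h" for s t
    using near[OF that] d1 by (auto simp: d_def dist_commute)
  obtain s t where st: "0 < s" "s < h" "0 < t" "t < h"
    and 1: "\<phi> (x + h *\<^sub>R u + h *\<^sub>R v) - \<phi> (x + h *\<^sub>R u) - \<phi> (x + h *\<^sub>R v) + \<phi> x
      = h * h * ?q (x + s *\<^sub>R u + t *\<^sub>R v)"
    using second_difference[OF \<phi> h in_V] by blast
  have in_V': "x + s *\<^sub>R v + t *\<^sub>R u \<in> V" if "0 \<le> s" "s \<le> h" "0 \<le> t" "t \<le> h" for s t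
    using in_V[of t s] that by (simp add: ac_simps)
  obtain s' t' where st': "0 < s'" "s' < h" "0 < t'" "t' < h"
    and 2: "\<phi> (x + h *\<^sub>R v + h *\<^sub>R u) - \<phi> (x + h *\<^sub>R v) - \<phi> (x + h *\<^sub>R u) + \<phi> x
      = h * h * ?p (x + s' *\<^sub>R v + t' *\<^sub>R u)"
    using second_difference[OF \<phi> h in_V'] by blast
  have "h * h * ?q (x + s *\<^sub>R u + t *\<^sub>R v) = h * h * ?p (x + s' *\<^sub>R v + t' *\<^sub>R u)"
  proof -
    have eq: "x + h *\<^sub>R v + h *\<^sub>R u = x + h *\<^sub>R u + h *\<^sub>R v" by simp
    show ?thesis using 1 2[unfolded eq] by linarith
  qed
  then have eq: "?q (x + s *\<^sub>R u + t *\<^sub>R v) = ?p (x + s' *\<^sub>R v + t' *\<^sub>R u)"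
    using h by simp
  have "dist (?p (x + s' *\<^sub>R v + t' *\<^sub>R u)) (?q x) < e"
    unfolding eq[symmetric] using d3(2) near[of s t] st by (simp add: d_def)
  moreover have "dist (?p (x + s' *\<^sub>R v + t' *\<^sub>R u)) (?p x) < e"
    using d2(2) near[of t' s'] st' by (simp add: d_def ac_simps)
  moreover have "dist (?p x) (?q x) \<le> dist (?p (x + s' *\<^sub>R v + t' *\<^sub>R u)) (?p x)
      + dist (?p (x + s' *\<^sub>R v + t' *\<^sub>R u)) (?q x)" by (rule dist_triangle3)
  moreover have "2 * e = dist (?p x) (?q x)" by (simp add: e_def dist_real_def)
  ultimately show False by linarith
qed

lemma dd_linear_image:
  assumes "bounded_linear L" "smooth_on V g" "x \<in> V"
  shows "dd v (\<lambda>y. L (g y)) x = L (dd v g x)"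
  by (rule dd_eq[OF bounded_linear.has_derivative[OF assms(1) smooth_on_has_derivative[OF assms(2,3)]]])

lemma dd_cong:
  "open V \<Longrightarrow> x \<in> V \<Longrightarrow> (\<And>y. y \<in> V \<Longrightarrow> F y = G y) \<Longrightarrow> dd v F x = dd v G x"
  unfolding flat_D_def by (subst frechet_derivative_cong(1)) auto

lemma second_derivative_symmetric:
  fixes g :: "'a::euclidean_space \<Rightarrow> 'b::euclidean_space"
  assumes V: "open V" "x \<in> V" and g: "smooth_on V g"
  shows "dd u (dd v g) x = dd v (dd u g) x"
proof (rule euclidean_eqI)
  fix b :: 'b assume "b \<in> Basis"
  let ?\<phi> = "\<lambda>y. inner (g y) b"
  have \<phi>: "smooth_on V ?\<phi>" by (rule smooth_on_linear[OF bounded_linear_inner_left V(1) g])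
  have "dd u (dd v ?\<phi>) x = inner (dd u (dd v g) x) b" for u v
  proof -
    have "dd u (dd v ?\<phi>) x = dd u (\<lambda>y. inner (dd v g y) b) x"
      by (rule dd_cong[OF V]) (rule dd_linear_image[OF bounded_linear_inner_left g])
    then show ?thesis by (simp add: dd_linear_image[OF bounded_linear_inner_left smooth_on_dd[OF g] V(2)])
  qed
  then show "inner (dd u (dd v g) x) b = inner (dd v (dd u g) x) b"
    using second_derivative_symmetric_real[OF V \<phi>] by metis
qed

lemma second_derivative_linear:
  assumes V: "open V" "x \<in> V" and g: "smooth_on V g"
  shows "linear (\<lambda>v. dd u (dd v g) x)"
proof (rule dd_linear_family[OF V, of "\<lambda>x v. dd v g x"])
  show "linear (\<lambda>v. dd v g y)" if "y \<in> V" for y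
    by (rule has_derivative_linear[OF smooth_on_has_derivative[OF g that]])
  show "(\<lambda>y. dd w g y) differentiable (at x)" for w
    using smooth_on_has_derivative[OF smooth_on_dd[OF g] V(2)] by (rule differentiableI)
qed

lemma second_derivative_linear_left:
  assumes "x \<in> V" and g: "smooth_on V g"
  shows "linear (\<lambda>u. dd u (dd v g) x)"
  by (rule has_derivative_linear[OF smooth_on_has_derivative[OF smooth_on_dd[OF g] assms(1)]])

text \<open>Both the base point and the vector move. With the identity as \<Psi> this gives the flat
  derivative of a tangent field, with a change of coordinates as \<Psi> the second derivative of a
  reparametrised hypersurface.\<close>

lemma derivative_along_has_derivative:
  fixes g :: "'a::euclidean_space \<Rightarrow> 'b::real_normed_vector" and \<Psi> :: "'c::real_normed_vector \<Rightarrow> 'a"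
  assumes V: "open V" "\<Psi> x \<in> V" and g: "smooth_on V g"
    and \<Psi>: "(\<Psi> has_derivative \<Psi>') (at x)" and Y: "(Y has_derivative Y') (at x)"
  shows "((\<lambda>y. frechet_derivative g (at (\<Psi> y)) (Y y)) has_derivative
    (\<lambda>u. dd (\<Psi>' u) (dd (Y x) g) (\<Psi> x) + frechet_derivative g (at (\<Psi> x)) (Y' u))) (at x)"
proof -
  have lin: "linear (frechet_derivative g (at z))" if "z \<in> V" for z
    by (rule smooth_on_linear_derivative[OF g that])
  have ex: "frechet_derivative g (at z) w = (\<Sum>b\<in>Basis. inner w b *\<^sub>R dd b g z)" if "z \<in> V" for z w
    by (subst apply_linear_expand[OF lin[OF that]]) (simp add: flat_D_def)
  have "((\<lambda>y. \<Sum>b\<in>Basis. inner (Y y) b *\<^sub>R dd b g (\<Psi> y)) has_derivative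
      (\<lambda>u. \<Sum>b\<in>Basis. inner (Y x) b *\<^sub>R dd (\<Psi>' u) (dd b g) (\<Psi> x) + inner (Y' u) b *\<^sub>R dd b g (\<Psi> x))) (at x)"
    by (intro has_derivative_sum has_derivative_scaleR has_derivative_inner_left Y
        has_derivative_compose[OF \<Psi> smooth_on_has_derivative[OF smooth_on_dd[OF g] V(2)]])
  moreover have "(\<Sum>b\<in>Basis. inner (Y x) b *\<^sub>R dd (\<Psi>' u) (dd b g) (\<Psi> x) + inner (Y' u) b *\<^sub>R dd b g (\<Psi> x))
      = dd (\<Psi>' u) (dd (Y x) g) (\<Psi> x) + frechet_derivative g (at (\<Psi> x)) (Y' u)" for u
    by (simp add: sum.distrib ex[OF V(2)] apply_linear_expand[OF second_derivative_linear[OF V g], of _ "Y x"])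
  ultimately have "((\<lambda>y. \<Sum>b\<in>Basis. inner (Y y) b *\<^sub>R dd b g (\<Psi> y)) has_derivative
    (\<lambda>u. dd (\<Psi>' u) (dd (Y x) g) (\<Psi> x) + frechet_derivative g (at (\<Psi> x)) (Y' u))) (at x)"
    by simp
  moreover have "eventually (\<lambda>y. \<Psi> y \<in> V) (at x)"
    using has_derivative_continuous[OF \<Psi>] V by (auto simp: continuous_at topological_tendstoD)
  then have "eventually (\<lambda>y. (\<Sum>b\<in>Basis. inner (Y y) b *\<^sub>R dd b g (\<Psi> y))
      = frechet_derivative g (at (\<Psi> y)) (Y y)) (at x)"
    by eventually_elim (simp add: ex)
  ultimately show ?thesis
    by (rule has_derivative_transform_eventually) (use ex V in auto)
qed

text \<open>The potential is the integral of the form along the segment from \<open>p\<close> to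
  \<open>x\<close>. Differentiation under the integral sign followed by closedness makes the
  integrand an exact derivative in \<open>t\<close>.\<close>

lemma poincare_lemma:
  fixes \<eta> :: "'a::euclidean_space \<Rightarrow> 'a \<Rightarrow> real"
  assumes lin: "\<And>x. x \<in> ball p r \<Longrightarrow> linear (\<eta> x)"
    and smooth: "\<And>v. smooth_on (ball p r) (\<lambda>x. \<eta> x v)"
    and closed: "\<And>x u v. x \<in> ball p r \<Longrightarrow> dd u (\<lambda>y. \<eta> y v) x = dd v (\<lambda>y. \<eta> y u) x"
  obtains z where "\<And>x. x \<in> ball p r \<Longrightarrow> (z has_derivative \<eta> x) (at x)"
proof -
  let ?B = "ball p r"
  let ?\<gamma> = "\<lambda>x t. p + t *\<^sub>R (x - p)"
  \<comment> \<open>The derivative of the integrand \<open>?f\<close> with respect to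
    \<open>x\<close> in direction \<open>v\<close>, left as a sum over the basis so that joint
    continuity in \<open>(x, t)\<close> is visible. \<open>G\<close> and \<open>fx\<close> turn it
    into a bounded operator, as the Leibniz rule for parameter integrals requires.\<close>
  define c where "c = (\<lambda>x t v. t * (\<Sum>b\<in>Basis. inner (x - p) b * dd v (\<lambda>y. \<eta> y b) (?\<gamma> x t)) + \<eta> (?\<gamma> x t) v)"
  define G where "G = (\<lambda>x t. \<Sum>b\<in>Basis. c x t b *\<^sub>R b)"
  define fx where "fx = (\<lambda>x t. blinfun_inner_right (G x t))"
  let ?f = "\<lambda>x t. \<eta> (?\<gamma> x t) (x - p)"
  define z where "z = (\<lambda>x. integral (cbox 0 1) (?f x))"
  have \<gamma>: "?\<gamma> x t \<in> ?B" if "x \<in> ?B" "t \<in> cbox 0 1" for x and t :: real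
  proof -
    have "dist p (?\<gamma> x t) = t * dist p x"
      using that by (simp add: dist_norm norm_minus_commute)
    also have "\<dots> \<le> 1 * dist p x" using that by (intro mult_right_mono) auto
    finally show ?thesis using that by auto
  qed
  have der: "((\<lambda>y. \<eta> y w) has_derivative (\<lambda>v. dd v (\<lambda>y. \<eta> y w) x)) (at x)" if "x \<in> ?B" for x w
    by (rule smooth_on_has_derivative[OF smooth that])
  have linD: "linear (\<lambda>w. dd v (\<lambda>y. \<eta> y w) x)" if "x \<in> ?B" for x v
    using dd_linear_family[OF open_ball that] lin der[OF that] by (blast intro: differentiableI)
  have c_eq: "c x t v = t * dd v (\<lambda>y. \<eta> y (x - p)) (?\<gamma> x t) + \<eta> (?\<gamma> x t) v"
    if "x \<in> ?B" "t \<in> cbox 0 1" for x t v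
    unfolding c_def by (simp add: apply_linear_expand[OF linD[OF \<gamma>[OF that]], of v "x - p"])
  have c_lin: "linear (c x t)" if "x \<in> ?B" "t \<in> cbox 0 1" for x t
  proof -
    note D = has_derivative_linear[OF der[OF \<gamma>[OF that], of "x - p"]] and E = lin[OF \<gamma>[OF that]]
    show ?thesis
      by (rule linearI)
         (simp_all add: c_eq[OF that] linear_add[OF D] linear_add[OF E] linear_cmul[OF D] linear_cmul[OF E]
           distrib_left mult_ac)
  qed
  have fx_eq: "blinfun_apply (fx x t) v = c x t v" if "x \<in> ?B" "t \<in> cbox 0 1" for x t v
    unfolding fx_def G_def
    by (simp add: inner_sum_left apply_linear_expand[OF c_lin[OF that], of v])
       (simp add: inner_commute mult.commute)
  have f_der: "((\<lambda>x. ?f x t) has_derivative blinfun_apply (fx x t)) (at x within ?B)"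
    if x: "x \<in> ?B" "t \<in> cbox 0 1" for x t
  proof -
    have g1: "((\<lambda>x. ?\<gamma> x t) has_derivative (\<lambda>v. t *\<^sub>R v)) (at x)"
      by (auto intro!: derivative_eq_intros)
    have ev: "eventually (\<lambda>y. y \<in> ?B) (at x)" using x by (intro eventually_at_in_open') auto
    have "((\<lambda>y. \<Sum>b\<in>Basis. inner (y - p) b *\<^sub>R \<eta> (?\<gamma> y t) b) has_derivative
       (\<lambda>v. \<Sum>b\<in>Basis. inner (x - p) b *\<^sub>R dd (t *\<^sub>R v) (\<lambda>y. \<eta> y b) (?\<gamma> x t) + inner v b *\<^sub>R \<eta> (?\<gamma> x t) b)) (at x)"
      by (intro has_derivative_sum has_derivative_scaleR has_derivative_compose[OF g1 der[OF \<gamma>[OF x]]]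
          has_derivative_inner_left) (auto intro!: derivative_eq_intros)
    moreover have "(\<Sum>b\<in>Basis. inner (x - p) b *\<^sub>R dd (t *\<^sub>R v) (\<lambda>y. \<eta> y b) (?\<gamma> x t) + inner v b *\<^sub>R \<eta> (?\<gamma> x t) b)
        = c x t v" for v
      unfolding c_def
      by (simp add: sum.distrib apply_linear_expand[OF lin[OF \<gamma>[OF x]], of v] sum_distrib_left mult_ac
          linear_cmul[OF has_derivative_linear[OF der[OF \<gamma>[OF x]]]])
    ultimately have "((\<lambda>y. \<Sum>b\<in>Basis. inner (y - p) b *\<^sub>R \<eta> (?\<gamma> y t) b) has_derivative blinfun_apply (fx x t)) (at x)"
      by (simp add: fx_eq[OF x, abs_def] eta_contract_eq)
    moreover have eq: "(\<Sum>b\<in>Basis. inner (y - p) b *\<^sub>R \<eta> (?\<gamma> y t) b) = ?f y t" if "y \<in> ?B" for y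
      by (rule apply_linear_expand[OF lin[OF \<gamma>[OF that x(2)]], symmetric])
    then have "eventually (\<lambda>y. (\<Sum>b\<in>Basis. inner (y - p) b *\<^sub>R \<eta> (?\<gamma> y t) b) = ?f y t) (at x)"
      using ev by (auto elim!: eventually_mono)
    ultimately have "((\<lambda>x. ?f x t) has_derivative blinfun_apply (fx x t)) (at x)"
      by (rule has_derivative_transform_eventually) (use eq x in auto)
    then show ?thesis by (rule has_derivative_at_withinI)
  qed
  have contE: "continuous_on (?B \<times> cbox 0 1) (\<lambda>(x, t). h (?\<gamma> x t))" if "continuous_on ?B h" for h :: "'a \<Rightarrow> real"
    unfolding split_beta
    by (rule continuous_on_compose2[OF that]) (use \<gamma> in \<open>auto intro!: continuous_intros\<close>)
  have c_cont: "continuous_on (?B \<times> cbox 0 1) (\<lambda>(x, t). c x t v)" for v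
    unfolding c_def split_beta
    by (intro continuous_intros contE[unfolded split_beta] smooth_on_continuous smooth_on_dd smooth)
  have fx_cont: "continuous_on (?B \<times> cbox 0 1) (\<lambda>(x, t). fx x t)"
    unfolding fx_def G_def split_beta
    by (intro bounded_linear.continuous_on[OF bounded_linear_blinfun_inner_right] continuous_intros
        c_cont[unfolded split_beta])
  have slice: "continuous_on (cbox 0 1) (\<lambda>t. h (x, t))"
    if "continuous_on (?B \<times> cbox 0 1) h" "x \<in> ?B" for x and h :: "'a \<times> real \<Rightarrow> 'z::topological_space"
    by (rule continuous_on_compose2[OF that(1)]) (use that(2) in \<open>auto intro!: continuous_intros\<close>)
  have f_int: "?f x integrable_on cbox 0 1" if "x \<in> ?B" for x
    by (intro integrable_continuous slice[OF contE[OF smooth_on_continuous[OF smooth]] that, unfolded prod.case])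
  have "(z has_derivative \<eta> x) (at x)" if x: "x \<in> ?B" for x
  proof -
    have "(z has_derivative integral (cbox 0 1) (fx x)) (at x within ?B)"
      unfolding z_def by (rule leibniz_rule[OF f_der f_int fx_cont x convex_ball])
    then have 1: "(z has_derivative integral (cbox 0 1) (fx x)) (at x)"
      by (simp only: at_within_open[OF x open_ball])
    have "blinfun_apply (integral (cbox 0 1) (fx x)) v = \<eta> x v" for v
    proof -
      have "(fx x) integrable_on cbox 0 1"
        by (rule integrable_continuous) (use slice[OF fx_cont x] in \<open>simp only: prod.case\<close>)
      from has_integral_linear[OF integrable_integral[OF this] blinfun.bounded_linear_left[of v]]
      have "((\<lambda>t. blinfun_apply (fx x t) v) has_integral blinfun_apply (integral (cbox 0 1) (fx x)) v) (cbox 0 1)"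
        by (simp add: o_def)
      \<comment> \<open>Closedness exchanges \<open>v\<close> with the direction
        \<open>x - p\<close> of the segment, so the integrand is the derivative of
        \<open>t * \<eta> (?\<gamma> x t) v\<close>; the factor \<open>t\<close> removes the lower
        limit.\<close>
      moreover have "((\<lambda>t. blinfun_apply (fx x t) v) has_integral (1 * \<eta> (?\<gamma> x 1) v - 0 * \<eta> (?\<gamma> x 0) v)) {0..1}"
      proof (rule fundamental_theorem_of_calculus)
        fix t :: real assume t: "t \<in> {0..1}"
        then have t': "t \<in> cbox 0 1" by simp
        have "((\<lambda>t. \<eta> (p + t *\<^sub>R (x - p)) v) has_real_derivative dd (x - p) (\<lambda>y. \<eta> y v) (?\<gamma> x t)) (at t)"
          by (rule line_derivative[OF der[OF \<gamma>[OF x t']]])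
        then have "((\<lambda>t. t * \<eta> (?\<gamma> x t) v) has_real_derivative blinfun_apply (fx x t) v) (at t)"
          by (auto intro!: derivative_eq_intros simp: fx_eq[OF x t'] c_eq[OF x t'] closed[OF \<gamma>[OF x t'], where u = v and v = "x - p"])
        then show "((\<lambda>t. t * \<eta> (?\<gamma> x t) v) has_vector_derivative blinfun_apply (fx x t) v) (at t within {0..1})"
          using has_real_derivative_iff_has_vector_derivative has_vector_derivative_at_within by blast
      qed simp
      ultimately show ?thesis by (auto dest: has_integral_unique)
    qed
    then have "blinfun_apply (integral (cbox 0 1) (fx x)) = \<eta> x" by (rule ext)
    then show ?thesis using 1 by (simp only:)
  qed
  then show ?thesis by (rule that)
qed

text \<open>The inverse function theorem supplies a differentiable inverse. Its derivative at
  \<open>y\<close> is the inverse of the derivative of \<Phi> at \<open>\<Psi> y\<close>, so each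
  order of smoothness of \<Psi> gives the next.\<close>

lemma smooth_inverse_function:
  fixes \<Phi> :: "'a::euclidean_space \<Rightarrow> 'a"
  assumes V: "open V" "p \<in> V" and \<Phi>: "smooth_on V \<Phi>" and inj: "inj (frechet_derivative \<Phi> (at p))"
  obtains U W \<Psi> where "open U" "U \<subseteq> V" "p \<in> U" "open W" "homeomorphism U W \<Phi> \<Psi>" "smooth_on W \<Psi>"
    "\<And>x. x \<in> U \<Longrightarrow> bij (frechet_derivative \<Phi> (at x))"
    "\<And>y. y \<in> W \<Longrightarrow> bij (frechet_derivative \<Psi> (at y))"
proof -
  define f' where "f' = (\<lambda>x. Blinfun (frechet_derivative \<Phi> (at x)))"
  have f': "blinfun_apply (f' x) = frechet_derivative \<Phi> (at x)" if "x \<in> V" for x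
    unfolding f'_def
    by (rule bounded_linear_Blinfun_apply[OF has_derivative_bounded_linear[OF smooth_on_has_derivative'[OF \<Phi> that]]])
  have der: "(\<Phi> has_derivative blinfun_apply (f' x)) (at x)" if "x \<in> V" for x
    unfolding f'[OF that] by (rule smooth_on_has_derivative'[OF \<Phi> that])
  have cont: "continuous_on V f'"
  proof (rule continuous_on_blinfun_componentwise)
    fix i :: 'a
    show "continuous_on V (\<lambda>x. blinfun_apply (f' x) i)"
      using smooth_on_continuous[OF smooth_on_dd[OF \<Phi>, of i]]
      by (rule iffD1[OF continuous_on_cong, rotated -1]) (auto simp: f' flat_D_def)
  qed
  obtain K where K: "linear K" "K \<circ> frechet_derivative \<Phi> (at p) = id"
    using linear_injective_left_inverse[OF smooth_on_linear_derivative[OF \<Phi> V(2)] inj] by auto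
  have Kb: "bounded_linear K" using K(1) linear_conv_bounded_linear by blast
  have "Blinfun K o\<^sub>L f' p = id_blinfun"
    by (rule blinfun_eqI) (use K(2) in \<open>auto simp: bounded_linear_Blinfun_apply[OF Kb] f'[OF V(2)] fun_eq_iff\<close>)
  from inverse_function_theorem[OF V(1) der cont V(2) this]
  obtain U W \<Psi> \<Psi>' where UW: "open U" "U \<subseteq> V" "p \<in> U" "open W" "\<Phi> p \<in> W" "homeomorphism U W \<Phi> \<Psi>"
    and \<Psi>: "\<And>y. y \<in> W \<Longrightarrow> (\<Psi> has_derivative \<Psi>' y) (at y)"
    and \<Psi>': "\<And>y. y \<in> W \<Longrightarrow> \<Psi>' y = linv (blinfun_apply (f' (\<Psi> y)))"
    and bij: "\<And>y. y \<in> W \<Longrightarrow> bij (blinfun_apply (f' (\<Psi> y)))"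
    by metis
  have mem: "\<Psi> y \<in> U" if "y \<in> W" for y using UW(6) that by (auto simp: homeomorphism_def)
  have bij': "bij (frechet_derivative \<Phi> (at x))" if "x \<in> U" for x
  proof -
    have "\<Phi> x \<in> W" "\<Psi> (\<Phi> x) = x" using UW(6) that by (auto simp: homeomorphism_def)
    then show ?thesis using bij[of "\<Phi> x"] f' that UW(2) by auto
  qed
  have \<Psi>2: "(\<Psi> has_derivative linv (frechet_derivative \<Phi> (at (\<Psi> y)))) (at y)" if "y \<in> W" for y
    using \<Psi>[OF that] \<Psi>'[OF that] f' mem[OF that] UW(2) by auto
  have inv_smooth: "C_k_on k U (\<lambda>x. linv (frechet_derivative \<Phi> (at x)) v)" for k v
    by (rule C_k_on_inverse[OF UW(1)])
       (use bij' smooth_on_linear_derivative[OF \<Phi>] UW(2) C_k_on_subset[OF smooth_on_C_k[OF smooth_on_dd[OF \<Phi>]]]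
         in \<open>auto simp: flat_D_def[abs_def]\<close>)
  have "C_k_on k W \<Psi>" for k
  proof (induction k)
    case 0
    show ?case using UW(6) by (simp add: homeomorphism_def)
  next
    case (Suc k)
    show ?case
      by (rule C_k_on_SucI[OF UW(4), where F' = "\<lambda>v y. linv (frechet_derivative \<Phi> (at (\<Psi> y))) v"])
         (use \<Psi>2 C_k_on_compose[OF UW(4,1) _ Suc inv_smooth] mem in auto)
  qed
  then have smooth: "smooth_on W \<Psi>" by (simp add: smooth_on_def)
  have "bij (frechet_derivative \<Psi> (at y))" if "y \<in> W" for y
    unfolding frechet_derivative_at[OF \<Psi>2[OF that], symmetric]
    by (rule bij_imp_bij_inv[OF bij'[OF mem[OF that]]])
  with UW smooth bij' show ?thesis by (intro that[of U W \<Psi>]) auto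
qed

section \<open>The centroaffine normalisation\<close>

text \<open>\<open>hess\<close> is the affine fundamental form relative to the transversal field \<open>g\<close>; the fundamental form
  of the Blaschke field \<open>- lam g\<close> is \<open>- hess / lam\<close>.\<close>

definition frame :: "('a::euclidean_space \<Rightarrow> 'b::euclidean_space) \<Rightarrow> 'a \<Rightarrow> 'a \<times> real \<Rightarrow> 'b" where
  "frame g x = (\<lambda>(w, c). frechet_derivative g (at x) w + c *\<^sub>R g x)"

definition hess :: "('a::euclidean_space \<Rightarrow> 'b::euclidean_space) \<Rightarrow> 'a \<Rightarrow> 'a \<Rightarrow> 'a \<Rightarrow> real" where
  "hess g x u v = snd (linv (frame g x) (dd u (dd v g) x))"

text \<open>Bijectivity of \<open>frame g x\<close> expresses at once that \<open>g\<close> is an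
  immersion and that its position vector is transversal. The constant \<open>r\<close> corresponds
  to |lam|^(N+2) with \<open>N = DIM('a)\<close>.\<close>

definition centroaffine :: "'a::euclidean_space set \<Rightarrow> ('a \<Rightarrow> 'b::euclidean_space) \<Rightarrow> real \<Rightarrow> bool" where
  "centroaffine V g r \<longleftrightarrow> smooth_on V g \<and> r > 0 \<and>
     (\<forall>x\<in>V. bij (frame g x) \<and> \<bar>form_det (hess g x)\<bar> = r * (map_det (frame g x))\<^sup>2)"

lemma frame_linear: "smooth_on V g \<Longrightarrow> x \<in> V \<Longrightarrow> linear (frame g x)"
  using smooth_on_linear_derivative[of V g x]
  by (auto simp: frame_def linear_iff algebra_simps)

text \<open>Domain and target have equal dimension, so only the kernel matters: a kernel vector with
  \<open>c \<noteq> 0\<close> would make \<open>g x\<close> tangent, one with \<open>c = 0\<close>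
  contradicts injectivity of the derivative.\<close>

lemma frame_bij_iff:
  fixes g :: "'a::euclidean_space \<Rightarrow> 'b::euclidean_space"
  assumes dim: "DIM('b) = DIM('a) + 1" and g: "smooth_on V g" "x \<in> V"
  shows "bij (frame g x) \<longleftrightarrow> inj (frechet_derivative g (at x)) \<and> g x \<notin> tangent_image g x"
proof -
  let ?d = "frechet_derivative g (at x)"
  note lin = smooth_on_linear_derivative[OF g] and flin = frame_linear[OF g]
  have "bij (frame g x) \<longleftrightarrow> inj (frame g x)"
    using linear_injective_imp_surjective[OF flin] dim by (auto simp: bij_def)
  also have "\<dots> \<longleftrightarrow> (\<forall>w c. ?d w + c *\<^sub>R g x = 0 \<longrightarrow> w = 0 \<and> c = 0)"
    unfolding linear_injective_0[OF flin] by (auto simp: frame_def zero_prod_def)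
  also have "\<dots> \<longleftrightarrow> inj ?d \<and> g x \<notin> tangent_image g x"
  proof (intro iffI conjI allI impI; (elim conjE)?)
    assume H: "\<forall>w c. ?d w + c *\<^sub>R g x = 0 \<longrightarrow> w = 0 \<and> c = 0"
    show "inj ?d" unfolding linear_injective_0[OF lin] using H[rule_format, of _ 0] by auto
    show "g x \<notin> tangent_image g x"
    proof
      assume "g x \<in> tangent_image g x"
      then obtain w where "g x = ?d w" by (auto simp: tangent_image_def)
      then show False using H[rule_format, of w "-1"] by auto
    qed
  next
    fix w c assume H: "inj ?d" "g x \<notin> tangent_image g x" and 0: "?d w + c *\<^sub>R g x = 0"
    have "c = 0"
    proof (rule ccontr)
      assume "c \<noteq> 0"
      have "c *\<^sub>R g x = ?d (- w)"
        using 0 by (simp add: linear_neg[OF lin] eq_neg_iff_add_eq_0 add.commute)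
      moreover have "g x = (1 / c) *\<^sub>R (c *\<^sub>R g x)" using \<open>c \<noteq> 0\<close> by simp
      ultimately have "g x = ?d ((1 / c) *\<^sub>R (- w))"
        by (simp only: linear_cmul[OF lin])
      then show False using H(2) by (auto simp: tangent_image_def)
    qed
    then show "w = 0" "c = 0" using 0 H(1) unfolding linear_injective_0[OF lin] by auto
  qed
  finally show ?thesis .
qed

lemma frame_inverse_tangent:
  assumes "bij (frame g x)"
  shows "linv (frame g x) (frechet_derivative g (at x) w) = (w, 0)"
  using inv_f_f[OF bij_is_inj[OF assms], of "(w, 0)"] by (simp add: frame_def)

text \<open>A bijective frame makes the decomposition unique, so the definite descriptions become
  the two components of its inverse; \<open>C x = k *\<^sub>R g x\<close> causes the division by
  \<open>k\<close>.\<close>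

lemma parts_eq:
  assumes "bij (frame g x)" "k \<noteq> 0" "C x = k *\<^sub>R g x"
  shows "tangential_part g C x v = fst (linv (frame g x) v)"
    and "transversal_part g C x v = snd (linv (frame g x) v) / k"
proof -
  have *: "v = frechet_derivative g (at x) w + c *\<^sub>R C x \<longleftrightarrow> linv (frame g x) v = (w, c * k)" for w c
  proof -
    have "v = frechet_derivative g (at x) w + c *\<^sub>R C x \<longleftrightarrow> v = frame g x (w, c * k)"
      by (simp add: frame_def assms(3))
    also have "\<dots> \<longleftrightarrow> linv (frame g x) v = (w, c * k)"
      using assms(1) by (metis bij_inv_eq_iff)
    finally show ?thesis .
  qed
  show "tangential_part g C x v = fst (linv (frame g x) v)"
    unfolding tangential_part_def *
  proof (rule the_equality)
    show "\<exists>c. linv (frame g x) v = (fst (linv (frame g x) v), c * k)"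
      using assms(2) by (intro exI[of _ "snd (linv (frame g x) v) / k"]) (simp add: prod_eq_iff)
  qed auto
  show "transversal_part g C x v = snd (linv (frame g x) v) / k"
    unfolding transversal_part_def *
  proof (rule the_equality)
    show "\<exists>w. linv (frame g x) v = (w, snd (linv (frame g x) v) / k * k)"
      using assms(2) by (intro exI[of _ "fst (linv (frame g x) v)"]) (simp add: prod_eq_iff)
  qed (use assms(2) in auto)
qed

lemma hess_bilinear:
  assumes V: "open V" "x \<in> V" and g: "smooth_on V g" and b: "bij (frame g x)"
  shows "bilinear (hess g x)"
proof -
  note l = linear_bij_inv[OF frame_linear[OF g V(2)] b]
  note [simp] = linear_add[OF l] linear_cmul[OF l]
    linear_add[OF second_derivative_linear[OF V g]] linear_cmul[OF second_derivative_linear[OF V g]]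
    linear_add[OF second_derivative_linear_left[OF V(2) g]] linear_cmul[OF second_derivative_linear_left[OF V(2) g]]
  show ?thesis
    unfolding bilinear_def hess_def by (auto intro!: linearI)
qed

lemma flat_D_has_derivative:
  assumes V: "open V" "x \<in> V" and g: "smooth_on V g" and Y: "Y differentiable (at x)"
  shows "(flat_D Y g has_derivative (\<lambda>u. dd u (dd (Y x) g) x + frechet_derivative g (at x) (dd u Y x))) (at x)"
proof -
  have "(Y has_derivative (\<lambda>u. dd u Y x)) (at x)"
    using Y by (simp add: flat_D_def frechet_derivative_works)
  from derivative_along_has_derivative[where \<Psi> = "\<lambda>y. y", OF V g has_derivative_ident this]
  show ?thesis by (simp add: flat_D_def[abs_def])
qed

text \<open>The last summand is tangent, so the transversal component depends on \<open>X x\<close>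
  and \<open>Y x\<close> only: the fundamental form is tensorial.\<close>

lemma flat_D_flat_D:
  assumes V: "open V" "x \<in> V" and g: "smooth_on V g" and Y: "Y differentiable (at x)"
  shows "flat_D X (flat_D Y g) x = dd (X x) (dd (Y x) g) x + frechet_derivative g (at x) (flat_D X Y x)"
  using dd_eq[OF flat_D_has_derivative[OF assms], of "X x"] by (simp add: flat_D_def)

lemma smooth_on_flat_D: "open V \<Longrightarrow> smooth_on V X \<Longrightarrow> smooth_on V F \<Longrightarrow> smooth_on V (flat_D X F)"
  using smooth_on_derivative_apply[of V F X] by (simp add: flat_D_def[abs_def])

lemma smooth_on_differentiable: "smooth_on V F \<Longrightarrow> x \<in> V \<Longrightarrow> F differentiable (at x)"
  using smooth_on_has_derivative' differentiableI by blast

lemma smooth_on_frame_inverse: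
  assumes V: "open V" and g: "smooth_on V g" and b: "\<And>x. x \<in> V \<Longrightarrow> bij (frame g x)" and W: "smooth_on V W"
  shows "smooth_on V (\<lambda>x. linv (frame g x) (W x))"
proof (rule smooth_on_apply[OF V _ _ W])
  show "linear (linv (frame g x))" if "x \<in> V" for x
    by (rule linear_bij_inv[OF frame_linear[OF g that] b[OF that]])
  have f: "smooth_on V (\<lambda>x. frame g x wc)" for wc
  proof -
    obtain w c where [simp]: "wc = (w, c)" by force
    show ?thesis
      unfolding frame_def
      using smooth_on_add[OF V smooth_on_dd[OF g, of w] smooth_on_linear[OF bounded_linear_scaleR_right V g, of c]]
      by (simp add: flat_D_def[abs_def])
  qed
  show "smooth_on V (\<lambda>x. linv (frame g x) u)" for u
    by (rule smooth_on_inverse[OF V _ f]) (use frame_linear[OF g] b in auto)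
qed

section \<open>Affine invariants of the transversal field \<open>C = k g\<close>\<close>

context
  fixes V :: "'a::euclidean_space set" and g C :: "'a \<Rightarrow> 'b::euclidean_space" and k :: real
  assumes dim: "DIM('b) = DIM('a) + 1" and V: "open V" and g: "smooth_on V g"
    and b: "\<And>x. x \<in> V \<Longrightarrow> bij (frame g x)" and k: "k \<noteq> 0" and C: "\<And>x. x \<in> V \<Longrightarrow> C x = k *\<^sub>R g x"
begin

lemma second_form_eq_hess:
  assumes x: "x \<in> V" and Y: "Y differentiable (at x)"
  shows "second_form g C X Y x = hess g x (X x) (Y x) / k"
  unfolding second_form_def parts_eq(2)[of g x k C, OF b[OF x] k C[OF x]] flat_D_flat_D[OF V x g Y] hess_def
  by (simp add: linear_add[OF linear_bij_inv[OF frame_linear[OF g x] b[OF x]]] frame_inverse_tangent[OF b[OF x]])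

lemma abs_Theta_eq:
  assumes x: "x \<in> V"
  shows "\<bar>Theta g C X x\<bar> = \<bar>map_det (frame g x)\<bar> * \<bar>k\<bar> * \<bar>vectors_det (\<lambda>j. X j x)\<bar>"
  unfolding vectors_det_frame[OF frame_linear[OF g x] dim, symmetric] Theta_def
  by (simp add: frame_def flat_D_def C[OF x] linear_0[OF smooth_on_linear_derivative[OF g x]] cong: if_cong)

lemma metric_determinant_eq:
  assumes x: "x \<in> V" and X: "\<And>i. i < DIM('a) \<Longrightarrow> X i differentiable (at x)"
  shows "family_det DIM('a) (\<lambda>i j. second_form g C (X i) (X j) x)
    = (1 / k) ^ DIM('a) * ((vectors_det (\<lambda>j. X j x))\<^sup>2 * form_det (hess g x))"
proof -
  have "family_det DIM('a) (\<lambda>i j. second_form g C (X i) (X j) x)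
      = family_det DIM('a) (\<lambda>i j. (1 / k) * hess g x (X i x) (X j x))"
    by (rule family_det_cong) (simp add: second_form_eq_hess[OF x X])
  then show ?thesis
    unfolding family_det_scale form_det_def
    by (rule trans) (rule arg_cong[OF family_det_form[OF hess_bilinear[OF V x g b[OF x]]]])
qed

text \<open>The exponent counts factors of \<open>k\<close>: dividing \<open>hess\<close> by
  \<open>k\<close> costs \<open>DIM('a)\<close> of them in the determinant, and the square of
  \<open>Theta\<close> contains two more. The sign in \<open>metric_volume\<close> then restores
  \<open>Theta\<close>, also on dependent vectors, where both vanish.\<close>

lemma metric_volume_eq_Theta:
  assumes x: "x \<in> V" and X: "\<And>i. i < DIM('a) \<Longrightarrow> X i differentiable (at x)"
    and r: "\<bar>form_det (hess g x)\<bar> = \<bar>k\<bar> ^ (DIM('a) + 2) * (map_det (frame g x))\<^sup>2"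
  shows "metric_volume g C X x = Theta g C X x"
proof -
  have "\<bar>family_det DIM('a) (\<lambda>i j. second_form g C (X i) (X j) x)\<bar> = \<bar>Theta g C X x\<bar>\<^sup>2"
    unfolding metric_determinant_eq[where X = X, OF x X, simplified] abs_Theta_eq[OF x] abs_mult r
    using k by (simp add: power_mult_distrib power_add power_abs[symmetric] power_divide field_simps power2_eq_square)
  then have "sqrt \<bar>family_det DIM('a) (\<lambda>i j. second_form g C (X i) (X j) x)\<bar> = \<bar>Theta g C X x\<bar>"
    by simp
  then show ?thesis unfolding metric_volume_def by (simp only: sgn_mult_abs)
qed

text \<open>Testing the volume condition on the constant standard frame is enough: there
  \<open>Theta\<close> is nonzero, so the sign cancels and squaring gives the determinants.\<close>

lemma metric_volume_basis:
  assumes x: "x \<in> V" and "metric_volume g C (\<lambda>i _. basis_enum i) x = Theta g C (\<lambda>i _. basis_enum i) x"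
  shows "\<bar>form_det (hess g x)\<bar> = \<bar>k\<bar> ^ (DIM('a) + 2) * (map_det (frame g x))\<^sup>2"
proof -
  let ?T = "Theta g C (\<lambda>i _. basis_enum i) x"
  let ?h = "family_det DIM('a) (\<lambda>i j. second_form g C (\<lambda>_. basis_enum i) (\<lambda>_. basis_enum j) x)"
  have T: "\<bar>?T\<bar> = \<bar>map_det (frame g x)\<bar> * \<bar>k\<bar>"
    unfolding abs_Theta_eq[OF x] by (simp add: abs_vectors_det_enum[OF basis_enum_bij])
  have "?T \<noteq> 0"
    using T k map_det_nonzero[OF frame_linear[OF g x] bij_is_inj[OF b[OF x]]] dim by auto
  have "\<bar>sgn ?T\<bar> * sqrt \<bar>?h\<bar> = \<bar>?T\<bar>"
    using arg_cong[OF assms(2)[unfolded metric_volume_def], of abs] by (simp add: abs_mult)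
  then have "sqrt \<bar>?h\<bar> = \<bar>?T\<bar>" using \<open>?T \<noteq> 0\<close> by (simp add: abs_sgn_eq)
  moreover have "\<bar>?h\<bar> = (sqrt \<bar>?h\<bar>)\<^sup>2" by simp
  ultimately have "\<bar>?h\<bar> = \<bar>?T\<bar>\<^sup>2" by (simp only:)
  then have "\<bar>?h\<bar> = (map_det (frame g x))\<^sup>2 * k\<^sup>2"
    unfolding T by (simp only: power_mult_distrib power2_abs)
  moreover have "\<bar>?h\<bar> = \<bar>form_det (hess g x)\<bar> / \<bar>k\<bar> ^ DIM('a)"
  proof -
    have "(vectors_det (basis_enum :: nat \<Rightarrow> 'a))\<^sup>2 = 1"
      using abs_vectors_det_enum[OF basis_enum_bij[where 'b = 'a]] by (simp add: abs_square_eq_1)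
    then show ?thesis
      using metric_determinant_eq[OF x, of "\<lambda>i _. basis_enum i"]
      by (simp add: abs_mult power_divide power_abs)
  qed
  ultimately show ?thesis using k by (simp add: field_simps power_add power2_eq_square)
qed

text \<open>Parallelism inserts a covariant derivative into a slot of the volume form, and
  \<open>metric_volume_eq_Theta\<close> asks for differentiable arguments.\<close>

lemma smooth_on_induced_connection:
  assumes "smooth_on V X" "smooth_on V Y"
  shows "smooth_on V (induced_connection g C X Y)"
proof (rule smooth_on_cong[OF _ V])
  show "smooth_on V (\<lambda>x. fst (linv (frame g x) (flat_D X (flat_D Y g) x)))"
    by (intro smooth_on_linear[OF bounded_linear_fst V] smooth_on_frame_inverse[OF V g b]
        smooth_on_flat_D V assms g)
  show "fst (linv (frame g y) (flat_D X (flat_D Y g) y)) = induced_connection g C X Y y" if "y \<in> V" for y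
    unfolding induced_connection_def parts_eq(1)[of g y k C, OF b[OF that] k C[OF that]] ..
qed

text \<open>In general the covariant derivative of \<open>Theta\<close> along \<open>X\<close> is
  tau(X) times \<open>Theta\<close>, and tau vanishes for \<open>C = k g\<close>. Concretely, the
  determinant is differentiated column by column: the last column yields a tangent vector, and in
  the others the \<open>C\<close>-component repeats the last column.\<close>

lemma Theta_parallel:
  assumes x: "x \<in> V" and X: "smooth_on V X" and Y: "\<And>i. i < DIM('a) \<Longrightarrow> smooth_on V (Y i)"
  shows "flat_D X (Theta g C Y) x = (\<Sum>i<DIM('a). Theta g C (Y(i := induced_connection g C X (Y i))) x)"
proof -
  let ?N = "DIM('a)" and ?d = "frechet_derivative g (at x)"
  define v where "v = (\<lambda>j. if j < ?N then flat_D (Y j) g else C)"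
  define v' where "v' = (\<lambda>j u. if j < ?N then dd u (dd (Y j x) g) x + ?d (dd u (Y j) x) else k *\<^sub>R ?d u)"
  have "(v j has_derivative v' j) (at x)" for j
  proof (cases "j < ?N")
    case True
    then show ?thesis
      using flat_D_has_derivative[OF V x g smooth_on_differentiable[OF Y x]] by (simp add: v_def v'_def)
  next
    case False
    have "((\<lambda>y. k *\<^sub>R g y) has_derivative (\<lambda>u. k *\<^sub>R ?d u)) (at x)"
      by (intro has_derivative_scaleR_right smooth_on_has_derivative'[OF g x])
    then have "(C has_derivative (\<lambda>u. k *\<^sub>R ?d u)) (at x)"
      by (rule has_derivative_transform_within_open[OF _ V x]) (simp add: C)
    then show ?thesis using False by (simp add: v_def v'_def)
  qed
  then have "((\<lambda>y. vectors_det (\<lambda>j. v j y)) has_derivative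
    (\<lambda>u. \<Sum>i<DIM('b). vectors_det ((\<lambda>j. v j x)(i := v' i u)))) (at x)"
    by (intro vectors_det_has_derivative)
  moreover have "(\<lambda>y. vectors_det (\<lambda>j. v j y)) = Theta g C Y"
    by (auto simp: Theta_def v_def fun_eq_iff intro!: arg_cong[where f = vectors_det])
  ultimately have "dd (X x) (Theta g C Y) x = (\<Sum>i<DIM('b). vectors_det ((\<lambda>j. v j x)(i := v' i (X x))))"
    by (simp add: dd_eq)
  also have "\<dots> = (\<Sum>i<?N. vectors_det ((\<lambda>j. v j x)(i := v' i (X x))))
      + vectors_det ((\<lambda>j. v j x)(?N := v' ?N (X x)))"
    by (simp add: dim)
  also have "vectors_det ((\<lambda>j. v j x)(?N := v' ?N (X x))) = 0"
  proof -
    \<comment> \<open>Every column is tangent here. \<open>?Q\<close> annihilates the transversal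
      coordinate, so the columns are images under the singular map \<open>frame g x\<close> after
      \<open>?Q\<close>.\<close>
    let ?a = "\<lambda>j. if j < ?N then (Y j x, 0) else (k *\<^sub>R X x, 0 :: real)"
    let ?Q = "\<lambda>(w :: 'a, t :: real). (w, 0 :: real)"
    have Q: "linear ?Q" by (auto simp: linear_iff)
    have "vectors_det ((\<lambda>j. v j x)(?N := v' ?N (X x))) = vectors_det (\<lambda>j. frame g x (?Q (?a j)))"
      unfolding vectors_det_def
      by (rule family_det_cong)
         (auto simp: dim less_Suc_eq v_def v'_def frame_def flat_D_def linear_cmul[OF smooth_on_linear_derivative[OF g x]])
    also have "\<dots> = map_det (frame g x) * (map_det ?Q * vectors_det ?a)"
      using vectors_det_linear[OF frame_linear[OF g x], of "\<lambda>j. ?Q (?a j)"] vectors_det_linear[OF Q refl, of ?a]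
      by (simp only: dim DIM_prod DIM_real)
    also have "map_det ?Q = 0"
      by (rule map_det_zero[OF Q refl, of "(0, 1)"]) (auto simp: zero_prod_def)
    finally show ?thesis by (simp only: mult_zero_left mult_zero_right)
  qed
  also have "(\<Sum>i<?N. vectors_det ((\<lambda>j. v j x)(i := v' i (X x))))
      = (\<Sum>i<?N. Theta g C (Y(i := induced_connection g C X (Y i))) x)"
  proof (rule sum.cong[OF refl])
    fix i assume "i \<in> {..<?N}"
    then have i: "i < ?N" by simp
    define w where "w = induced_connection g C X (Y i) x"
    define s where "s = snd (linv (frame g x) (v' i (X x))) / k"
    have vi: "v' i (X x) = flat_D X (flat_D (Y i) g) x"
      using i flat_D_flat_D[OF V x g smooth_on_differentiable[OF Y[OF i] x]] by (simp add: v'_def flat_D_def)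
    have "w = fst (linv (frame g x) (v' i (X x)))"
      unfolding w_def induced_connection_def parts_eq(1)[of g x k C, OF b[OF x] k C[OF x]] vi ..
    then have "linv (frame g x) (v' i (X x)) = (w, s * k)" using k by (simp add: s_def prod_eq_iff)
    then have "v' i (X x) = frame g x (w, s * k)" using b[OF x] by (metis bij_inv_eq_iff)
    then have "v' i (X x) = ?d w + s *\<^sub>R C x" by (simp add: frame_def C[OF x])
    then have "vectors_det ((\<lambda>j. v j x)(i := v' i (X x)))
        = vectors_det ((\<lambda>j. v j x)(i := ?d w)) + vectors_det ((\<lambda>j. v j x)(i := s *\<^sub>R C x))"
      using i dim by (simp add: vectors_det_add)
    also have "vectors_det ((\<lambda>j. v j x)(i := s *\<^sub>R C x)) = 0"
    \<comment> \<open>Column \<open>i\<close> is \<open>s\<close> times the last column, which holds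
      \<open>C x\<close>; the coefficients encode this relation.\<close>
    proof (rule vectors_det_dependent[where c = "\<lambda>j. if j = i then 1 else if j = ?N then - s else 0" and i = i])
      let ?F = "\<lambda>j. (if j = i then 1 else if j = ?N then - s else 0) *\<^sub>R ((\<lambda>j. v j x)(i := s *\<^sub>R C x)) j"
      have "(\<Sum>j<DIM('b). ?F j) = (\<Sum>j<?N. ?F j) + ?F ?N"
        by (simp only: dim Suc_eq_plus1[symmetric] sum.lessThan_Suc)
      also have "(\<Sum>j<?N. ?F j) = (\<Sum>j<?N. if j = i then s *\<^sub>R C x else 0)"
        by (rule sum.cong) auto
      also have "\<dots> = s *\<^sub>R C x" using i by simp
      also have "?F ?N = - s *\<^sub>R C x" using i by (simp add: v_def)
      finally show "(\<Sum>j<DIM('b). ?F j) = 0" by simp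
    qed (use i dim in auto)
    also have "vectors_det ((\<lambda>j. v j x)(i := ?d w)) = Theta g C (Y(i := induced_connection g C X (Y i))) x"
      unfolding Theta_def
      using i by (intro arg_cong[where f = vectors_det]) (auto simp: v_def w_def flat_D_def fun_eq_iff)
    finally show "vectors_det ((\<lambda>j. v j x)(i := v' i (X x))) = Theta g C (Y(i := induced_connection g C X (Y i))) x"
      by (simp only: add_0_right)
  qed
  finally show ?thesis by (simp add: flat_D_def)
qed

lemma shape_operator_eq:
  assumes x: "x \<in> V"
  shows "shape_operator g C X x = - k *\<^sub>R X x"
proof -
  have "((\<lambda>y. k *\<^sub>R g y) has_derivative (\<lambda>u. k *\<^sub>R frechet_derivative g (at x) u)) (at x)"
    by (intro has_derivative_scaleR_right smooth_on_has_derivative'[OF g x])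
  then have "(C has_derivative (\<lambda>u. k *\<^sub>R frechet_derivative g (at x) u)) (at x)"
    by (rule has_derivative_transform_within_open[OF _ V x]) (simp add: C)
  then have "flat_D X C x = frechet_derivative g (at x) (k *\<^sub>R X x)"
    using dd_eq[of C _ x "X x"] linear_cmul[OF smooth_on_linear_derivative[OF g x]]
    by (simp add: flat_D_def)
  then show ?thesis
    unfolding shape_operator_def parts_eq(1)[of g x k C, OF b[OF x] k C[OF x]]
    by (simp add: frame_inverse_tangent[OF b[OF x]])
qed

end

section \<open>Equivalence of the Blaschke conditions with the determinant condition\<close>

lemma centroaffine_imp_blaschke:
  fixes g C :: "'a::euclidean_space \<Rightarrow> 'b::euclidean_space"
  assumes dim: "DIM('b) = DIM('a) + 1" and V: "open V" and lam: "lam \<noteq> 0"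
    and g: "centroaffine V g (\<bar>lam\<bar> ^ (DIM('a) + 2))" and C: "\<And>x. x \<in> V \<Longrightarrow> C x = - lam *\<^sub>R g x"
  shows "immersion_on V g" "blaschke_on V g C" "nondegenerate_on V g C"
    "\<And>X x. x \<in> V \<Longrightarrow> shape_operator g C X x = lam *\<^sub>R X x"
proof -
  have sm: "smooth_on V g" and b: "\<And>x. x \<in> V \<Longrightarrow> bij (frame g x)"
    and det: "\<And>x. x \<in> V \<Longrightarrow> \<bar>form_det (hess g x)\<bar> = \<bar>- lam\<bar> ^ (DIM('a) + 2) * (map_det (frame g x))\<^sup>2"
    using g by (auto simp: centroaffine_def)
  have k: "- lam \<noteq> 0" using lam by simp
  note ctx = dim V sm b k C
  show "immersion_on V g"
    unfolding immersion_on_def using sm b frame_bij_iff[OF dim sm] by auto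
  have "C x \<notin> tangent_image g x" if x: "x \<in> V" for x
  proof
    assume "C x \<in> tangent_image g x"
    then obtain w where "C x = frechet_derivative g (at x) w" by (auto simp: tangent_image_def)
    moreover have "g x = (- 1 / lam) *\<^sub>R C x" using lam by (simp add: C[OF x])
    ultimately have "g x = frechet_derivative g (at x) ((- 1 / lam) *\<^sub>R w)"
      by (simp only: linear_cmul[OF smooth_on_linear_derivative[OF sm x]])
    then show False
      using b[OF x] unfolding frame_bij_iff[OF dim sm x] by (auto simp: tangent_image_def)
  qed
  moreover have "smooth_on V C"
    by (rule smooth_on_cong[OF smooth_on_linear[OF bounded_linear_scaleR_right V sm, of "- lam"] V])
       (simp add: C)
  moreover have vol: "metric_volume g C X x = Theta g C X x"
    if "x \<in> V" "\<And>i. i < DIM('a) \<Longrightarrow> X i differentiable (at x)" for X x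
    by (rule metric_volume_eq_Theta[OF ctx that det[OF that(1)]]) auto
  \<comment> \<open>The metric volume agrees with \<open>Theta\<close> on all of \<open>V\<close>,
    not only at \<open>x\<close>, so their derivatives agree as well and
    \<open>Theta_parallel\<close> transfers.\<close>
  moreover have "parallel_on V g C (metric_volume g C)"
    unfolding parallel_on_def
  proof (intro allI impI ballI, elim conjE)
    fix X :: "'a \<Rightarrow> 'a" and Y :: "nat \<Rightarrow> 'a \<Rightarrow> 'a" and x
    assume X: "smooth_on V X" and Y: "\<forall>i<DIM('a). smooth_on V (Y i)" and x: "x \<in> V"
    have "flat_D X (metric_volume g C Y) x = dd (X x) (metric_volume g C Y) x" by (simp add: flat_D_def)
    also have "\<dots> = dd (X x) (Theta g C Y) x"
      by (rule dd_cong[OF V x], rule vol) (auto intro: smooth_on_differentiable Y[rule_format])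
    also have "\<dots> = flat_D X (Theta g C Y) x" by (simp add: flat_D_def)
    also have "\<dots> = (\<Sum>i<DIM('a). Theta g C (Y(i := induced_connection g C X (Y i))) x)"
      using Theta_parallel[OF ctx x X, of Y] Y by simp
    also have "\<dots> = (\<Sum>i<DIM('a). metric_volume g C (Y(i := induced_connection g C X (Y i))) x)"
    proof (rule sum.cong[OF refl], rule vol[symmetric, OF x])
      fix i j assume ij: "i \<in> {..<DIM('a)}" "j < DIM('a)"
      then have "smooth_on V (Y i)" "smooth_on V (Y j)" using Y by auto
      then show "(Y(i := induced_connection g C X (Y i))) j differentiable at x"
        by (cases "j = i") (auto intro: smooth_on_differentiable[OF _ x] smooth_on_induced_connection[OF ctx X])
    qed
    finally show "flat_D X (metric_volume g C Y) x = (\<Sum>i<DIM('a). metric_volume g C (Y(i := induced_connection g C X (Y i))) x)" .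
  qed
  ultimately show "blaschke_on V g C"
    unfolding blaschke_on_def transversal_on_def by (auto intro!: vol simp: smooth_on_differentiable)
  show "nondegenerate_on V g C"
    unfolding nondegenerate_on_def
  proof (intro ballI allI impI)
    fix x and u :: 'a assume x: "x \<in> V" and u: "u \<noteq> 0"
    have "form_det (hess g x) \<noteq> 0"
      using det[OF x] lam map_det_nonzero[OF frame_linear[OF sm x] bij_is_inj[OF b[OF x]]] dim by auto
    then obtain v where v: "hess g x u v \<noteq> 0"
      using form_det_nondegenerate[OF hess_bilinear[OF V x sm b[OF x]] _ u] by blast
    then show "\<exists>v. second_form g C (\<lambda>_. u) (\<lambda>_. v) x \<noteq> 0"
      using second_form_eq_hess[OF ctx x, of "\<lambda>_. v" "\<lambda>_. u"] lam by (intro exI[of _ v]) simp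
  qed
  show "shape_operator g C X x = lam *\<^sub>R X x" if "x \<in> V" for X x
    using shape_operator_eq[OF ctx that, of X] by simp
qed

lemma blaschke_imp_centroaffine:
  fixes g C :: "'a::euclidean_space \<Rightarrow> 'b::euclidean_space"
  assumes dim: "DIM('b) = DIM('a) + 1" and V: "open V" and lam: "lam \<noteq> 0"
    and imm: "immersion_on V g" and bl: "blaschke_on V g C" and C: "\<And>x. x \<in> V \<Longrightarrow> C x = - lam *\<^sub>R g x"
  shows "centroaffine V g (\<bar>lam\<bar> ^ (DIM('a) + 2))"
proof -
  have sm: "smooth_on V g" using imm by (simp add: immersion_on_def)
  have b: "bij (frame g x)" if x: "x \<in> V" for x
    unfolding frame_bij_iff[OF dim sm x]
  proof
    show "inj (frechet_derivative g (at x))" using imm x by (simp add: immersion_on_def)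
    show "g x \<notin> tangent_image g x"
    proof
      assume "g x \<in> tangent_image g x"
      then obtain w where "g x = frechet_derivative g (at x) w" by (auto simp: tangent_image_def)
      then have "C x = frechet_derivative g (at x) (- lam *\<^sub>R w)"
        using linear_cmul[OF smooth_on_linear_derivative[OF sm x], of "- lam" w] C[OF x] by simp
      then show False
        using bl x by (auto simp: blaschke_on_def transversal_on_def tangent_image_def)
    qed
  qed
  have k: "- lam \<noteq> 0" using lam by simp
  have vol: "\<forall>X. (\<forall>i<DIM('a). smooth_on V (X i)) \<longrightarrow> (\<forall>x\<in>V. metric_volume g C X x = Theta g C X x)"
    using bl by (simp add: blaschke_on_def)
  have "\<bar>form_det (hess g x)\<bar> = \<bar>- lam\<bar> ^ (DIM('a) + 2) * (map_det (frame g x))\<^sup>2" if x: "x \<in> V" for x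
    by (rule metric_volume_basis[OF dim V sm b k C x]) (auto intro!: vol[rule_format] smooth_on_const V x)
  then show ?thesis
    using sm b lam by (auto simp: centroaffine_def)
qed

lemma centroaffine_cong:
  assumes "centroaffine V F r" "open V" "\<And>y. y \<in> V \<Longrightarrow> F y = G y"
  shows "centroaffine V G r"
proof -
  have fr: "frame G x = frame F x" if "x \<in> V" for x
    using frechet_derivative_cong(1)[OF assms(2) that assms(3)] assms(3)[OF that] by (simp add: frame_def)
  have "dd u (dd v G) x = dd u (dd v F) x" if "x \<in> V" for u v x
    by (rule dd_cong[OF assms(2) that], rule dd_cong[OF assms(2)]) (simp_all add: assms(3))
  then have "hess G x = hess F x" if "x \<in> V" for x
    using that by (simp add: hess_def[abs_def] fr)
  then show ?thesis
    using assms smooth_on_cong[of V F G] by (simp add: centroaffine_def fr)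
qed

lemma affine_hypersphere_chart:
  fixes M :: "'m topology" and A :: "('m, 'a::euclidean_space) chart set"
    and f C :: "'m \<Rightarrow> 'b::euclidean_space"
  assumes dim: "DIM('b) = DIM('a) + 1" and f: "affine_hypersphere M A f C lam" "centred_at_origin M f C lam"
    and c: "c \<in> A"
  shows "open (chart_image c)" "centroaffine (chart_image c) (in_chart c f) (\<bar>lam\<bar> ^ (DIM('a) + 2))"
    "\<And>x. x \<in> chart_image c \<Longrightarrow> in_chart c C x = - lam *\<^sub>R in_chart c f x"
proof -
  have ch: "is_chart M c" using f c by (auto simp: affine_hypersphere_def smooth_manifold_def)
  then show op: "open (chart_image c)" by (simp add: is_chart_def)
  show C: "in_chart c C x = - lam *\<^sub>R in_chart c f x" if "x \<in> chart_image c" for x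
  proof -
    have "inv_into (fst c) (snd c) x \<in> fst c"
      using that by (auto simp: chart_image_def intro: inv_into_into)
    moreover have "fst c \<subseteq> topspace M" using ch openin_subset by (auto simp: is_chart_def)
    ultimately show ?thesis using f(2) by (auto simp: centred_at_origin_def in_chart_def)
  qed
  show "centroaffine (chart_image c) (in_chart c f) (\<bar>lam\<bar> ^ (DIM('a) + 2))"
    by (rule blaschke_imp_centroaffine[OF dim op _ _ _ C])
       (use f c in \<open>auto simp: affine_hypersphere_def centred_at_origin_def\<close>)
qed

section \<open>Open subsets of Euclidean space as manifolds\<close>

lemma connected_space_top_of_set: "connected_space (top_of_set U) \<longleftrightarrow> connected U"
  by (metis connectedin_def connectedin_iff_connected subset_UNIV topspace_euclidean)

lemma chart_image_std: "chart_image (U, id) = U"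
  by (simp add: chart_image_def)

lemma in_chart_std: "x \<in> U \<Longrightarrow> in_chart (U, id) F x = F x"
  using inv_into_f_f[of id U x] by (simp add: in_chart_def)

lemma smooth_manifold_std:
  fixes U :: "'a::euclidean_space set"
  assumes "open U"
  shows "smooth_manifold (top_of_set U) (std_atlas U)"
proof -
  obtain \<B> :: "'a set set" where B: "countable \<B>" "topological_basis \<B>"
    using ex_countable_basis by auto
  have "\<exists>V\<in>\<B>. x \<in> V \<and> V \<subseteq> S" if "open S" "x \<in> S" for S x
    using topological_basisE[OF B(2) that] by metis
  with B(1) topological_basis_open[OF B(2)] have "second_countable (euclidean :: 'a topology)"
    unfolding second_countable_def by (intro exI[of _ \<B>]) simp
  then have "second_countable (top_of_set U)" by (rule second_countable_subtopology)
  moreover have "Hausdorff_space (top_of_set U)"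
    by (intro Hausdorff_space_subtopology Hausdorff_space_euclidean)
  moreover have "is_chart (top_of_set U) (U, id)"
    using assms homeomorphic_map_id[of "top_of_set U" "top_of_set U"]
    by (simp add: is_chart_def chart_image_std subtopology_subtopology)
  moreover have "smooth_on U (in_chart (U, id) id)"
    by (rule smooth_on_cong[OF smooth_on_id[OF assms] assms]) (simp add: in_chart_std)
  ultimately show ?thesis
    by (simp add: smooth_manifold_def std_atlas_def compatible_charts_def overlap_def)
qed

lemma orientable_std:
  fixes U :: "'a::euclidean_space set"
  assumes U: "open U"
  shows "orientable (top_of_set U) (std_atlas U)"
proof -
  have "frechet_derivative (in_chart (U, id) id) (at x) = (\<lambda>v. v)" if "x \<in> U" for x
  proof -
    have "frechet_derivative (in_chart (U, id) id) (at x) = frechet_derivative (\<lambda>v. v) (at x)"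
      by (rule frechet_derivative_cong(1)[OF U that]) (simp add: in_chart_std)
    then show ?thesis using frechet_derivative_at[OF has_derivative_ident] by metis
  qed
  then show ?thesis
    using smooth_manifold_std[OF U] unfolding orientable_def
    by (intro exI[of _ "std_atlas U"])
       (auto simp: smooth_manifold_def admissible_chart_def std_atlas_def overlap_def linear_det_id)
qed

lemma affine_hypersphere_std:
  fixes f :: "'a::euclidean_space \<Rightarrow> 'b::euclidean_space"
  assumes dim: "DIM('b) = DIM('a) + 1" and U: "open U" "connected U" and r: "centroaffine U f r"
  obtains lam where "lam \<noteq> 0" "affine_hypersphere (top_of_set U) (std_atlas U) f (\<lambda>x. - lam *\<^sub>R f x) lam"
proof -
  \<comment> \<open>Solves |lam|^(N+2) = r with \<open>N = DIM('a)\<close>. The condition sees only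
    the absolute value, and the positive root is taken.\<close>
  define lam where "lam = root (DIM('a) + 2) r"
  have "r > 0" using r by (simp add: centroaffine_def)
  then have "lam > 0" by (simp add: lam_def)
  moreover have "lam ^ (DIM('a) + 2) = r"
    unfolding lam_def using \<open>r > 0\<close> by (intro real_root_pow_pos2) auto
  ultimately have lam: "lam > 0" "\<bar>lam\<bar> ^ (DIM('a) + 2) = r" by simp_all
  let ?f = "in_chart (U, id) f" and ?C = "in_chart (U, id) (\<lambda>x. - lam *\<^sub>R f x)"
  have f: "centroaffine U ?f (\<bar>lam\<bar> ^ (DIM('a) + 2))"
    unfolding lam by (rule centroaffine_cong[OF r U(1)]) (simp add: in_chart_std)
  have "?C x = - lam *\<^sub>R ?f x" for x by (simp add: in_chart_def)
  note * = centroaffine_imp_blaschke[OF dim U(1) _ f, of ?C, OF _ this]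
  have "affine_hypersphere (top_of_set U) (std_atlas U) f (\<lambda>x. - lam *\<^sub>R f x) lam"
    unfolding affine_hypersphere_def
    using smooth_manifold_std[OF U(1)] orientable_std[OF U(1)] U(2) * lam(1)
    by (auto simp: std_atlas_def chart_image_std connected_space_top_of_set)
  then show ?thesis by (rule that[rotated]) (use lam in simp)
qed

text \<open>Charts, Blaschke field and multiplier disappear: what remains is connectedness and one
  pointwise condition, both easy to transport between the join and its factors.\<close>

lemma proper_centred_hypersphere_on_iff:
  fixes f :: "'a::euclidean_space \<Rightarrow> 'b::euclidean_space"
  assumes dim: "DIM('b) = DIM('a) + 1" and U: "open U"
  shows "proper_centred_hypersphere_on U f \<longleftrightarrow> connected U \<and> (\<exists>r. centroaffine U f r)"
proof
  assume "proper_centred_hypersphere_on U f"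
  then obtain C lam where f: "affine_hypersphere (top_of_set U) (std_atlas U) f C lam"
    "centred_at_origin (top_of_set U) f C lam" by (auto simp: proper_centred_hypersphere_on_def)
  have "centroaffine U (in_chart (U, id) f) (\<bar>lam\<bar> ^ (DIM('a) + 2))"
    using affine_hypersphere_chart(2)[OF dim f, of "(U, id)"] by (simp add: std_atlas_def chart_image_std)
  then have "centroaffine U f (\<bar>lam\<bar> ^ (DIM('a) + 2))"
    by (rule centroaffine_cong[OF _ U]) (simp add: in_chart_std)
  moreover have "connected U" using f(1) by (simp add: affine_hypersphere_def connected_space_top_of_set)
  ultimately show "connected U \<and> (\<exists>r. centroaffine U f r)" by auto
next
  assume "connected U \<and> (\<exists>r. centroaffine U f r)"
  then obtain r where "connected U" "centroaffine U f r" by auto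
  from affine_hypersphere_std[OF dim U this] show "proper_centred_hypersphere_on U f"
    unfolding proper_centred_hypersphere_on_def centred_at_origin_def by metis
qed

section \<open>The para-complex join\<close>

text \<open>Coordinates adapted to \<open>para_J\<close>: the first argument is mapped into the
  eigenspace of 1, the second into that of -1. Its square is twice the identity.\<close>

definition rot :: "'b::real_vector \<times> 'b \<Rightarrow> 'b \<times> 'b" where
  "rot = (\<lambda>(p, q). (p + q, p - q))"

lemma joined_eq_rot: "joined f1 f2 (x, y, z) = rot (exp (- z) *\<^sub>R f1 x, exp z *\<^sub>R f2 y)"
proof -
  have *: "exp (- z) = cosh z - sinh z" "exp z = cosh z + sinh z"
    by (simp_all add: cosh_minus_sinh sinh_plus_cosh cosh_plus_sinh)
  show ?thesis
    unfolding joined_def rot_def para_J_def * by (simp add: algebra_simps)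
qed

lemma rot_linear: "linear rot" by (auto simp: rot_def linear_iff algebra_simps)

lemma rot_rot: "rot (rot p) = 2 *\<^sub>R p"
  by (cases p) (simp add: rot_def scaleR_2)

lemma bij_rot: "bij (rot :: 'b::real_vector \<times> 'b \<Rightarrow> _)"
proof (rule o_bij)
  show "(\<lambda>p. (1 / 2) *\<^sub>R rot p) \<circ> rot = id" by (auto simp: rot_rot)
  show "rot \<circ> (\<lambda>p. (1 / 2) *\<^sub>R rot p) = id" by (auto simp: linear_cmul[OF rot_linear] rot_rot)
qed

lemma para_J_rot: "para_J (rot (p, q)) = rot (p, - q)"
  by (simp add: para_J_def rot_def)

text \<open>A tangent vector \<open>(u, v, t)\<close> plus \<open>s\<close> times the position
  contributes the coefficient \<open>s - t\<close> to \<open>f1\<close> and \<open>s + t\<close> to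
  \<open>f2\<close>, because \<open>z\<close> enters through exp(-z) and exp(z). This reshuffling
  factors the frame of the join through those of \<open>f1\<close> and \<open>f2\<close>.\<close>

definition split_frame :: "('u::real_vector \<times> 'u \<times> real) \<times> real \<Rightarrow> ('u \<times> real) \<times> ('u \<times> real)" where
  "split_frame = (\<lambda>((u, v, t), s). ((u, s - t), (v, s + t)))"

lemma split_frame_linear: "linear split_frame"
  by (auto simp: split_frame_def linear_iff algebra_simps)

lemma bij_split_frame: "bij (split_frame :: ('u::real_vector \<times> 'u \<times> real) \<times> real \<Rightarrow> _)"
proof (rule o_bij)
  let ?i = "\<lambda>((u :: 'u, c), (v :: 'u, d)). ((u, v, (d - c) / 2), (c + d) / 2)"
  show "?i \<circ> split_frame = id" by (auto simp: split_frame_def fun_eq_iff)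
  show "split_frame \<circ> ?i = id" by (auto simp: split_frame_def fun_eq_iff field_simps)
qed

text \<open>Stated for arbitrary \<open>k1\<close>, \<open>k2\<close> because a directional
  derivative of the join has the same exponential shape; the second derivative is then a further
  instance.\<close>

lemma rot_exp_has_derivative:
  fixes k1 k2 :: "'u::euclidean_space \<Rightarrow> 'b::euclidean_space"
  assumes "(k1 has_derivative k1') (at x)" "(k2 has_derivative k2') (at y)"
  shows "((\<lambda>(x, y, z). rot (exp (- z) *\<^sub>R k1 x, exp z *\<^sub>R k2 y)) has_derivative
    (\<lambda>(u, v, t). rot (exp (- z) *\<^sub>R (k1' u - t *\<^sub>R k1 x), exp z *\<^sub>R (k2' v + t *\<^sub>R k2 y)))) (at (x, y, z))"
proof -
  have x: "((\<lambda>p. k1 (fst p)) has_derivative (\<lambda>h. k1' (fst h))) (at (x, y, z))"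
    by (rule has_derivative_compose[where f = fst, OF has_derivative_fst[OF has_derivative_ident]]) (simp add: assms)
  have y: "((\<lambda>p. k2 (fst (snd p))) has_derivative (\<lambda>h. k2' (fst (snd h)))) (at (x, y, z))"
    by (rule has_derivative_compose[where f = "\<lambda>p. fst (snd p)",
          OF has_derivative_fst[OF has_derivative_snd[OF has_derivative_ident]]]) (simp add: assms)
  have "((\<lambda>p. (exp (- snd (snd p)) *\<^sub>R k1 (fst p), exp (snd (snd p)) *\<^sub>R k2 (fst (snd p)))) has_derivative
    (\<lambda>h. (exp (- z) *\<^sub>R (k1' (fst h) - snd (snd h) *\<^sub>R k1 x),
     exp z *\<^sub>R (k2' (fst (snd h)) + snd (snd h) *\<^sub>R k2 y)))) (at (x, y, z))"
    by (rule derivative_eq_intros x y refl)+ (auto simp: fun_eq_iff algebra_simps)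
  from bounded_linear.has_derivative[OF iffD1[OF linear_conv_bounded_linear rot_linear] this]
  show ?thesis by (simp only: case_prod_unfold)
qed

context
  fixes U1 U2 :: "'u::euclidean_space set" and f1 f2 :: "'u \<Rightarrow> 'b::euclidean_space"
  assumes U1: "open U1" and U2: "open U2" and f1: "smooth_on U1 f1" and f2: "smooth_on U2 f2"
begin

lemma joined_has_derivative:
  assumes "x \<in> U1" "y \<in> U2"
  shows "(joined f1 f2 has_derivative (\<lambda>(u, v, t). rot
    (exp (- z) *\<^sub>R (frechet_derivative f1 (at x) u - t *\<^sub>R f1 x),
     exp z *\<^sub>R (frechet_derivative f2 (at y) v + t *\<^sub>R f2 y)))) (at (x, y, z))"
proof -
  have "joined f1 f2 = (\<lambda>(x, y, z). rot (exp (- z) *\<^sub>R f1 x, exp z *\<^sub>R f2 y))"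
    by (auto simp: fun_eq_iff joined_eq_rot)
  then show ?thesis
    using rot_exp_has_derivative[OF smooth_on_has_derivative'[OF f1 assms(1)] smooth_on_has_derivative'[OF f2 assms(2)]]
    by (simp only:)
qed

lemma joined_frechet:
  assumes "x \<in> U1" "y \<in> U2"
  shows "frechet_derivative (joined f1 f2) (at (x, y, z)) (u, v, t) = rot
    (exp (- z) *\<^sub>R (frechet_derivative f1 (at x) u - t *\<^sub>R f1 x),
     exp z *\<^sub>R (frechet_derivative f2 (at y) v + t *\<^sub>R f2 y))"
  by (subst frechet_derivative_at[OF joined_has_derivative[OF assms], symmetric]) simp

lemma joined_frame:
  assumes "x \<in> U1" "y \<in> U2"
  shows "frame (joined f1 f2) (x, y, z) ((u, v, t), s) = rot
    (exp (- z) *\<^sub>R frame f1 x (u, s - t), exp z *\<^sub>R frame f2 y (v, s + t))"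
  by (simp add: frame_def joined_frechet[OF assms] joined_eq_rot)
     (simp add: rot_def algebra_simps)

lemma joined_frame_eq:
  assumes "x \<in> U1" "y \<in> U2"
  shows "frame (joined f1 f2) (x, y, z) = (\<lambda>w. rot ((\<lambda>(p, q). (exp (- z) *\<^sub>R frame f1 x p, exp z *\<^sub>R frame f2 y q)) (split_frame w)))"
  using joined_frame[OF assms] by (auto simp: split_frame_def fun_eq_iff)

lemma smooth_on_joined: "smooth_on (U1 \<times> U2 \<times> UNIV) (joined f1 f2)"
proof -
  let ?U = "U1 \<times> U2 \<times> (UNIV :: real set)"
  have U: "open ?U" using U1 U2 by (intro open_Times) auto
  have "smooth_on ?U (\<lambda>p. f1 (fst p))"
    by (rule smooth_on_compose[OF U U1 _ _ f1])
       (auto intro!: smooth_on_linear[OF bounded_linear_fst U] smooth_on_id U)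
  moreover have "smooth_on ?U (\<lambda>p. f2 (fst (snd p)))"
    by (rule smooth_on_compose[OF U U2 _ _ f2])
       (auto intro!: smooth_on_linear[OF bounded_linear_fst U] smooth_on_linear[OF bounded_linear_snd U] smooth_on_id U)
  moreover have z: "smooth_on ?U (\<lambda>p. snd (snd p))"
    by (intro smooth_on_linear[OF bounded_linear_snd U] smooth_on_id U)
  moreover have "smooth_on ?U (\<lambda>p. - snd (snd p))"
    by (rule smooth_on_linear[OF bounded_linear_minus[OF bounded_linear_ident] U z])
  ultimately have "smooth_on ?U (\<lambda>p. rot (exp (- snd (snd p)) *\<^sub>R f1 (fst p), exp (snd (snd p)) *\<^sub>R f2 (fst (snd p))))"
    by (intro smooth_on_linear[OF _ U, of rot] smooth_on_Pair smooth_on_bilinear[OF bounded_bilinear_scaleR]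
        smooth_on_exp U) (use rot_linear linear_conv_bounded_linear in auto)
  then show ?thesis
    by (rule smooth_on_cong[OF _ U]) (auto simp: joined_eq_rot)
qed

lemma joined_second_derivative:
  assumes x: "x \<in> U1" "y \<in> U2"
  shows "dd (u, v, t) (dd (u', v', t') (joined f1 f2)) (x, y, z) = rot
    (exp (- z) *\<^sub>R (dd u (dd u' f1) x - t' *\<^sub>R dd u f1 x - t *\<^sub>R (dd u' f1 x - t' *\<^sub>R f1 x)),
     exp z *\<^sub>R (dd v (dd v' f2) y + t' *\<^sub>R dd v f2 y + t *\<^sub>R (dd v' f2 y + t' *\<^sub>R f2 y)))"
proof -
  let ?U = "U1 \<times> U2 \<times> (UNIV :: real set)"
  define k1 where "k1 = (\<lambda>x. dd u' f1 x - t' *\<^sub>R f1 x)"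
  define k2 where "k2 = (\<lambda>y. dd v' f2 y + t' *\<^sub>R f2 y)"
  have U: "open ?U" using U1 U2 by (intro open_Times) auto
  have k1: "(k1 has_derivative (\<lambda>u. dd u (dd u' f1) x - t' *\<^sub>R dd u f1 x)) (at x)"
    unfolding k1_def
    by (intro has_derivative_diff has_derivative_scaleR_right smooth_on_has_derivative[OF smooth_on_dd[OF f1]]
        smooth_on_has_derivative[OF f1] x)
  have k2: "(k2 has_derivative (\<lambda>v. dd v (dd v' f2) y + t' *\<^sub>R dd v f2 y)) (at y)"
    unfolding k2_def
    by (intro has_derivative_add has_derivative_scaleR_right smooth_on_has_derivative[OF smooth_on_dd[OF f2]]
        smooth_on_has_derivative[OF f2] x)
  let ?k = "\<lambda>(x, y, z). rot (exp (- z) *\<^sub>R k1 x, exp z *\<^sub>R k2 y)"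
  from dd_eq[OF rot_exp_has_derivative[OF k1 k2], of "(u, v, t)"]
  have "dd (u, v, t) ?k (x, y, z)
    = rot (exp (- z) *\<^sub>R (dd u (dd u' f1) x - t' *\<^sub>R dd u f1 x - t *\<^sub>R k1 x),
     exp z *\<^sub>R (dd v (dd v' f2) y + t' *\<^sub>R dd v f2 y + t *\<^sub>R k2 y))" by simp
  moreover have "dd (u, v, t) (dd (u', v', t') (joined f1 f2)) (x, y, z)
    = dd (u, v, t) ?k (x, y, z)"
  proof (rule dd_cong[OF U])
    fix p assume "p \<in> ?U"
    then show "dd (u', v', t') (joined f1 f2) p = ?k p"
      using joined_frechet by (auto simp: flat_D_def k1_def k2_def)
  qed (use x in auto)
  ultimately show ?thesis by (simp add: k1_def k2_def)
qed

text \<open>The second derivative has coefficient \<open>h1 + t * t'\<close> at \<open>f1\<close>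
  and \<open>h2 + t * t'\<close> at \<open>f2\<close>. Their mean is the transversal component;
  mixed terms such as \<open>t' *\<^sub>R u\<close> are tangent, so the form is block
  diagonal.\<close>

lemma joined_hess:
  assumes x: "x \<in> U1" "y \<in> U2"
    and b: "bij (frame f1 x)" "bij (frame f2 y)" "bij (frame (joined f1 f2) (x, y, z))"
  shows "hess (joined f1 f2) (x, y, z) (u, v, t) (u', v', t')
    = (1 / 2) * hess f1 x u u' + ((1 / 2) * hess f2 y v v' + 1 * t * t')"
proof -
  obtain w1 h1 where 1: "linv (frame f1 x) (dd u (dd u' f1) x) = (w1, h1)" by force
  obtain w2 h2 where 2: "linv (frame f2 y) (dd v (dd v' f2) y) = (w2, h2)" by force
  have D1: "dd u (dd u' f1) x = frame f1 x (w1, h1)" using 1 b(1) by (metis bij_inv_eq_iff)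
  have D2: "dd v (dd v' f2) y = frame f2 y (w2, h2)" using 2 b(2) by (metis bij_inv_eq_iff)
  note l1 = smooth_on_linear_derivative[OF f1 x(1)] and l2 = smooth_on_linear_derivative[OF f2 x(2)]
  \<comment> \<open>The coordinates on the right come from inverting \<open>split_frame\<close> on
    these two coefficients: half the difference in the direction of \<open>z\<close>, half the sum
    along the position.\<close>
  have "dd (u, v, t) (dd (u', v', t') (joined f1 f2)) (x, y, z)
    = frame (joined f1 f2) (x, y, z)
        ((w1 - t' *\<^sub>R u - t *\<^sub>R u', w2 + t' *\<^sub>R v + t *\<^sub>R v', (h2 - h1) / 2), (h1 + h2) / 2 + t * t')"
    unfolding joined_second_derivative[OF x] joined_frame[OF x] D1 D2
    by (simp add: frame_def flat_D_def linear_add[OF l1] linear_diff[OF l1] linear_cmul[OF l1]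
        linear_add[OF l2] linear_cmul[OF l2])
       (simp add: algebra_simps add_divide_distrib diff_divide_distrib)
  then have "linv (frame (joined f1 f2) (x, y, z)) (dd (u, v, t) (dd (u', v', t') (joined f1 f2)) (x, y, z))
    = ((w1 - t' *\<^sub>R u - t *\<^sub>R u', w2 + t' *\<^sub>R v + t *\<^sub>R v', (h2 - h1) / 2), (h1 + h2) / 2 + t * t')"
    using inv_f_f[OF bij_is_inj[OF b(3)]] by simp
  then show ?thesis using 1 2 by (simp add: hess_def add_divide_distrib)
qed

lemma joined_frame_bij_iff:
  assumes dim: "DIM('b) = DIM('u) + 1" and x: "x \<in> U1" "y \<in> U2"
  shows "bij (frame (joined f1 f2) (x, y, z)) \<longleftrightarrow> bij (frame f1 x) \<and> bij (frame f2 y)"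
proof
  assume b: "bij (frame f1 x) \<and> bij (frame f2 y)"
  have "bij (\<lambda>(p, q). (exp (- z) *\<^sub>R frame f1 x p, exp z *\<^sub>R frame f2 y q))"
  proof (rule o_bij)
    let ?i = "\<lambda>(p, q). (linv (frame f1 x) (exp z *\<^sub>R p), linv (frame f2 y) (exp (- z) *\<^sub>R q))"
    show "?i \<circ> (\<lambda>(p, q). (exp (- z) *\<^sub>R frame f1 x p, exp z *\<^sub>R frame f2 y q)) = id"
      using b by (auto simp: fun_eq_iff bij_is_inj exp_minus)
    show "(\<lambda>(p, q). (exp (- z) *\<^sub>R frame f1 x p, exp z *\<^sub>R frame f2 y q)) \<circ> ?i = id"
      using b by (auto simp: fun_eq_iff bij_is_surj surj_f_inv_f exp_minus)
  qed
  from bij_comp[OF bij_comp[OF bij_split_frame this] bij_rot]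
  show "bij (frame (joined f1 f2) (x, y, z))"
    unfolding joined_frame_eq[OF x] by (simp add: o_def)
next
  assume b: "bij (frame (joined f1 f2) (x, y, z))"
  have U: "open (U1 \<times> U2 \<times> (UNIV :: real set))" using U1 U2 by (intro open_Times) auto
  have l: "linear (frame (joined f1 f2) (x, y, z))"
    by (rule frame_linear[OF smooth_on_joined]) (use x in auto)
  note l1 = frame_linear[OF f1 x(1)] and l2 = frame_linear[OF f2 x(2)]
  have "w = 0" if "frame f1 x w = 0" for w
  proof -
    \<comment> \<open>A kernel vector of the frame of \<open>f1\<close>, completed by zero in the
      second factor and pulled back through \<open>split_frame\<close>, is a kernel vector of the
      joint frame.\<close>
    have "frame (joined f1 f2) (x, y, z) ((fst w, 0, - snd w / 2), snd w / 2) = 0"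
      unfolding joined_frame[OF x] using that linear_0[OF l2]
      by (simp add: rot_def zero_prod_def)
    then have "((fst w, 0, - snd w / 2), snd w / 2) = (0 :: ('u \<times> 'u \<times> real) \<times> real)"
      using linear_injective_0[OF l] b by (auto simp: bij_def)
    then show ?thesis by (auto simp: zero_prod_def prod_eq_iff)
  qed
  then have i1: "inj (frame f1 x)" using linear_injective_0[OF l1] by auto
  have "w = 0" if "frame f2 y w = 0" for w
  proof -
    have "frame (joined f1 f2) (x, y, z) ((0, fst w, snd w / 2), snd w / 2) = 0"
      unfolding joined_frame[OF x] using that linear_0[OF l1]
      by (simp add: rot_def zero_prod_def)
    then have "((0, fst w, snd w / 2), snd w / 2) = (0 :: ('u \<times> 'u \<times> real) \<times> real)"
      using linear_injective_0[OF l] b by (auto simp: bij_def)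
    then show ?thesis by (auto simp: zero_prod_def prod_eq_iff)
  qed
  then have i2: "inj (frame f2 y)" using linear_injective_0[OF l2] by auto
  show "bij (frame f1 x) \<and> bij (frame f2 y)"
    using i1 i2 linear_injective_imp_surjective[OF l1 i1] linear_injective_imp_surjective[OF l2 i2] dim
    by (auto simp: bij_def)
qed

lemma joined_form_det:
  assumes x: "x \<in> U1" "y \<in> U2"
    and b: "bij (frame f1 x)" "bij (frame f2 y)" "bij (frame (joined f1 f2) (x, y, z))"
  shows "form_det (hess (joined f1 f2) (x, y, z))
    = (1 / 2) ^ DIM('u) * (1 / 2) ^ DIM('u) * (form_det (hess f1 x) * form_det (hess f2 y))"
proof -
  have c: "bilinear (\<lambda>u v. (1 / 2) * hess f1 x u v)" "bilinear (\<lambda>u v. (1 / 2) * hess f2 y u v)"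
    using hess_bilinear[OF U1 x(1) f1 b(1)] hess_bilinear[OF U2 x(2) f2 b(2)]
    unfolding bilinear_def linear_iff by (simp_all add: algebra_simps)
  have t: "bilinear (\<lambda>u v. 1 * u * v :: real)" unfolding bilinear_def linear_iff by (simp add: algebra_simps)
  have ct: "bilinear (\<lambda>u v. (1 / 2) * hess f2 y (fst u) (fst v) + 1 * snd u * snd v)"
    using c(2) unfolding bilinear_def linear_iff by (simp add: algebra_simps)
  have "hess (joined f1 f2) (x, y, z) = (\<lambda>u v. (1 / 2) * hess f1 x (fst u) (fst v)
      + ((1 / 2) * hess f2 y (fst (snd u)) (fst (snd v)) + 1 * snd (snd u) * snd (snd v)))"
    using joined_hess[OF x b] by (auto simp: fun_eq_iff)
  then have "form_det (hess (joined f1 f2) (x, y, z))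
      = form_det (\<lambda>u v. (1 / 2) * hess f1 x u v)
        * form_det (\<lambda>u v. (1 / 2) * hess f2 y (fst u) (fst v) + 1 * snd u * snd v)"
    using form_det_product[OF c(1) ct] by simp
  also have "form_det (\<lambda>u v. (1 / 2) * hess f2 y (fst u) (fst v) + 1 * snd u * snd v)
      = form_det (\<lambda>u v. (1 / 2) * hess f2 y u v) * form_det (\<lambda>u v. 1 * u * v :: real)"
    by (rule form_det_product[OF c(2) t])
  finally show ?thesis unfolding form_det_scale form_det_real by (simp add: mult_ac)
qed

text \<open>The powers of exp(-z) and exp(z) cancel because both factors lie in spaces of the same
  dimension; so the condition on the join is independent of \<open>z\<close>.\<close>

lemma joined_map_det:
  assumes dim: "DIM('b) = DIM('u) + 1" and x: "x \<in> U1" "y \<in> U2"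
  shows "(map_det (frame (joined f1 f2) (x, y, z)))\<^sup>2
    = (map_det (rot :: 'b \<times> 'b \<Rightarrow> _))\<^sup>2 * (map_det (split_frame :: ('u \<times> 'u \<times> real) \<times> real \<Rightarrow> _))\<^sup>2
      * ((map_det (frame f1 x))\<^sup>2 * (map_det (frame f2 y))\<^sup>2)"
proof -
  let ?P = "\<lambda>(p, q). (exp (- z) *\<^sub>R frame f1 x p, exp z *\<^sub>R frame f2 y q)"
  note l1 = frame_linear[OF f1 x(1)] and l2 = frame_linear[OF f2 x(2)]
  have e1: "linear (\<lambda>p. exp (- z) *\<^sub>R frame f1 x p)" and e2: "linear (\<lambda>q. exp z *\<^sub>R frame f2 y q)"
    using l1 l2 by (auto simp: linear_iff algebra_simps)
  have P: "linear ?P" using e1 e2 by (auto simp: linear_iff)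
  have "map_det (frame (joined f1 f2) (x, y, z)) = map_det (rot :: 'b \<times> 'b \<Rightarrow> _) * (map_det ?P * map_det (split_frame :: ('u \<times> 'u \<times> real) \<times> real \<Rightarrow> _))"
    unfolding joined_frame_eq[OF x]
    using map_det_compose[OF rot_linear refl, of "\<lambda>w. ?P (split_frame w)"]
      map_det_compose[OF P, of split_frame] dim by simp
  moreover have "\<bar>map_det ?P\<bar> = \<bar>map_det (frame f1 x)\<bar> * \<bar>map_det (frame f2 y)\<bar>"
  proof -
    have "\<bar>map_det ?P\<bar> = \<bar>exp (- z) ^ DIM('b) * map_det (frame f1 x)\<bar> * \<bar>exp z ^ DIM('b) * map_det (frame f2 y)\<bar>"
      using map_det_product[OF e1 e2] dim by (simp add: map_det_scale)
    also have "\<dots> = (exp (- z) * exp z) ^ DIM('b) * (\<bar>map_det (frame f1 x)\<bar> * \<bar>map_det (frame f2 y)\<bar>)"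
      by (simp add: abs_mult power_mult_distrib)
    finally show ?thesis by (simp add: exp_minus)
  qed
  then have "(map_det ?P)\<^sup>2 = (map_det (frame f1 x))\<^sup>2 * (map_det (frame f2 y))\<^sup>2"
    by (metis power2_abs power_mult_distrib)
  ultimately show ?thesis by (simp add: power_mult_distrib)
qed

end

text \<open>The halves come from \<open>joined_hess\<close>, the denominator from the fixed linear
  maps in the frame of the join. The value depends on the types alone, which the two arguments
  carry.\<close>

definition join_const :: "'b::euclidean_space itself \<Rightarrow> 'u::euclidean_space itself \<Rightarrow> real" where
  "join_const _ _ = (1 / 2) ^ DIM('u) * (1 / 2) ^ DIM('u) /
     ((map_det (rot :: 'b \<times> 'b \<Rightarrow> _))\<^sup>2 * (map_det (split_frame :: ('u \<times> 'u \<times> real) \<times> real \<Rightarrow> _))\<^sup>2)"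

lemma map_det_rot_nonzero: "map_det (rot :: 'b::euclidean_space \<times> 'b \<Rightarrow> _) \<noteq> 0"
  by (rule map_det_nonzero[OF rot_linear bij_is_inj[OF bij_rot] refl])

lemma map_det_split_frame_nonzero:
  "map_det (split_frame :: ('u::euclidean_space \<times> 'u \<times> real) \<times> real \<Rightarrow> _) \<noteq> 0"
  by (rule map_det_nonzero[OF split_frame_linear bij_is_inj[OF bij_split_frame]]) simp

lemma join_const_pos: "join_const TYPE('b::euclidean_space) TYPE('u::euclidean_space) > 0"
  using map_det_rot_nonzero[where 'b = 'b] map_det_split_frame_nonzero[where 'u = 'u] by (simp add: join_const_def)

text \<open>Both sides contain the squared determinants of \<open>rot\<close> and
  \<open>split_frame\<close>; cancelling this positive factor leaves a relation in which
  \<open>x\<close> and \<open>y\<close> are separated and \<open>z\<close> is gone.\<close>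

lemma joined_det_ratio:
  fixes U1 U2 :: "'u::euclidean_space set" and f1 f2 :: "'u \<Rightarrow> 'b::euclidean_space"
  assumes op: "open U1" "open U2" "smooth_on U1 f1" "smooth_on U2 f2"
    and dim: "DIM('b) = DIM('u) + 1" and x: "x \<in> U1" "y \<in> U2"
    and b: "bij (frame f1 x)" "bij (frame f2 y)"
  shows "\<bar>form_det (hess (joined f1 f2) (x, y, z))\<bar> = r * (map_det (frame (joined f1 f2) (x, y, z)))\<^sup>2 \<longleftrightarrow>
    join_const TYPE('b) TYPE('u) * (\<bar>form_det (hess f1 x)\<bar> * \<bar>form_det (hess f2 y)\<bar>)
      = r * ((map_det (frame f1 x))\<^sup>2 * (map_det (frame f2 y))\<^sup>2)"
proof -
  have j: "bij (frame (joined f1 f2) (x, y, z))"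
    using joined_frame_bij_iff[OF op dim x] b by simp
  let ?K = "(map_det (rot :: 'b \<times> 'b \<Rightarrow> _))\<^sup>2 * (map_det (split_frame :: ('u \<times> 'u \<times> real) \<times> real \<Rightarrow> _))\<^sup>2"
  have K: "?K > 0"
    using map_det_rot_nonzero[where 'b = 'b] map_det_split_frame_nonzero[where 'u = 'u] by simp
  have "\<bar>form_det (hess (joined f1 f2) (x, y, z))\<bar>
      = ?K * (join_const TYPE('b) TYPE('u) * (\<bar>form_det (hess f1 x)\<bar> * \<bar>form_det (hess f2 y)\<bar>))"
    unfolding joined_form_det[OF op x b j] join_const_def
    using map_det_rot_nonzero[where 'b = 'b] map_det_split_frame_nonzero[where 'u = 'u] by (simp add: abs_mult)
  moreover have "r * (map_det (frame (joined f1 f2) (x, y, z)))\<^sup>2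
      = ?K * (r * ((map_det (frame f1 x))\<^sup>2 * (map_det (frame f2 y))\<^sup>2))"
    unfolding joined_map_det[OF op dim x] by (simp add: mult_ac)
  ultimately show ?thesis using K by (simp only: mult_cancel_left) auto
qed

lemma centroaffine_joined:
  fixes U1 U2 :: "'u::euclidean_space set" and f1 f2 :: "'u \<Rightarrow> 'b::euclidean_space"
  assumes op: "open U1" "open U2" and dim: "DIM('b) = DIM('u) + 1"
    and f1: "centroaffine U1 f1 r1" and f2: "centroaffine U2 f2 r2"
  shows "centroaffine (U1 \<times> U2 \<times> UNIV) (joined f1 f2) (join_const TYPE('b) TYPE('u) * (r1 * r2))"
proof -
  have s: "smooth_on U1 f1" "smooth_on U2 f2" using f1 f2 by (auto simp: centroaffine_def)
  have "bij (frame (joined f1 f2) p) \<and> \<bar>form_det (hess (joined f1 f2) p)\<bar>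
      = join_const TYPE('b) TYPE('u) * (r1 * r2) * (map_det (frame (joined f1 f2) p))\<^sup>2"
    if p: "p \<in> U1 \<times> U2 \<times> UNIV" for p
  proof -
    obtain x y z where xyz: "p = (x, y, z)" "x \<in> U1" "y \<in> U2" using p by auto
    have b: "bij (frame f1 x)" "bij (frame f2 y)"
      and d: "\<bar>form_det (hess f1 x)\<bar> = r1 * (map_det (frame f1 x))\<^sup>2"
        "\<bar>form_det (hess f2 y)\<bar> = r2 * (map_det (frame f2 y))\<^sup>2"
      using f1 f2 xyz by (auto simp: centroaffine_def)
    show ?thesis
      unfolding xyz(1) joined_det_ratio[OF op s dim xyz(2,3) b] d joined_frame_bij_iff[OF op s dim xyz(2,3)]
      using b by (simp add: mult_ac)
  qed
  then show ?thesis
    using smooth_on_joined[OF op s] f1 f2 join_const_pos[where 'b = 'b and 'u = 'u]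
    by (auto simp: centroaffine_def)
qed

text \<open>Separation of variables: with \<open>y0\<close> frozen, the product identity says that
  the determinant ratio of \<open>f1\<close> is constant in \<open>x\<close>, and likewise for
  \<open>f2\<close> with \<open>x0\<close> frozen. One value of \<open>z\<close> suffices.\<close>

lemma centroaffine_joinedD:
  fixes U1 U2 :: "'u::euclidean_space set" and f1 f2 :: "'u \<Rightarrow> 'b::euclidean_space"
  assumes op: "open U1" "open U2" and dim: "DIM('b) = DIM('u) + 1"
    and s: "smooth_on U1 f1" "smooth_on U2 f2" and ne: "U1 \<noteq> {}" "U2 \<noteq> {}" "I \<noteq> {}"
    and g: "centroaffine (U1 \<times> U2 \<times> I) (joined f1 f2) r"
  shows "\<exists>r1. centroaffine U1 f1 r1" "\<exists>r2. centroaffine U2 f2 r2"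
proof -
  obtain x0 y0 z0 where 0: "x0 \<in> U1" "y0 \<in> U2" "z0 \<in> I" using ne by auto
  let ?J = "join_const TYPE('b) TYPE('u)"
  let ?h1 = "\<lambda>x. \<bar>form_det (hess f1 x)\<bar>" and ?h2 = "\<lambda>y. \<bar>form_det (hess f2 y)\<bar>"
  let ?d1 = "\<lambda>x. (map_det (frame f1 x))\<^sup>2" and ?d2 = "\<lambda>y. (map_det (frame f2 y))\<^sup>2"
  have J: "?J > 0" by (rule join_const_pos)
  have r: "r > 0" using g by (simp add: centroaffine_def)
  have b: "bij (frame f1 x)" "bij (frame f2 y)" if "x \<in> U1" "y \<in> U2" for x y
    using g 0(3) that joined_frame_bij_iff[OF op s dim that] by (auto simp: centroaffine_def)
  have main: "?J * (?h1 x * ?h2 y) = r * (?d1 x * ?d2 y)" if xy: "x \<in> U1" "y \<in> U2" for x y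
    by (rule iffD1[OF joined_det_ratio[OF op s dim xy b[OF xy], of z0 r]])
       (use g 0(3) xy in \<open>auto simp: centroaffine_def\<close>)
  have d: "?d1 x > 0" "?d2 y > 0" if xy: "x \<in> U1" "y \<in> U2" for x y
    using map_det_nonzero[OF frame_linear[OF s(1) xy(1)] bij_is_inj[OF b(1)[OF xy]]]
      map_det_nonzero[OF frame_linear[OF s(2) xy(2)] bij_is_inj[OF b(2)[OF xy]]] dim by auto
  have h: "?h1 x > 0" "?h2 y > 0" if xy: "x \<in> U1" "y \<in> U2" for x y
    using main[OF xy] r d[OF xy] by (auto simp: zero_less_mult_iff)
  have "?h1 x = r * ?d2 y0 / (?J * ?h2 y0) * ?d1 x" if "x \<in> U1" for x
    using main[OF that 0(2)] J h(2)[OF that 0(2)] by (simp add: field_simps)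
  moreover have "r * ?d2 y0 / (?J * ?h2 y0) > 0"
    using r J d[OF 0(1,2)] h[OF 0(1,2)] by (intro divide_pos_pos mult_pos_pos)
  ultimately show "\<exists>r1. centroaffine U1 f1 r1"
    using b 0 s by (auto simp: centroaffine_def intro!: exI[of _ "r * ?d2 y0 / (?J * ?h2 y0)"])
  have "?h2 y = r * ?d1 x0 / (?J * ?h1 x0) * ?d2 y" if "y \<in> U2" for y
    using main[OF 0(1) that] J h(1)[OF 0(1) that] by (simp add: field_simps)
  moreover have "r * ?d1 x0 / (?J * ?h1 x0) > 0"
    using r J d[OF 0(1,2)] h[OF 0(1,2)] by (intro divide_pos_pos mult_pos_pos)
  ultimately show "\<exists>r2. centroaffine U2 f2 r2"
    using b 0 s by (auto simp: centroaffine_def intro!: exI[of _ "r * ?d1 x0 / (?J * ?h1 x0)"])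
qed

lemma rot_eq_iff: "rot p = rot q \<longleftrightarrow> p = q"
  by (rule inj_eq[OF bij_is_inj[OF bij_rot]])

text \<open>\<open>para_J\<close> keeps the first eigencomponent and negates the second. Comparing
  the position coefficients of two tangent vectors related by it gives both \<open>t = t'\<close>
  and \<open>t = - t'\<close>.\<close>

lemma distribution_D_joined:
  fixes U1 U2 :: "'u::euclidean_space set" and f1 f2 :: "'u \<Rightarrow> 'b::euclidean_space"
  assumes op: "open U1" "open U2" "smooth_on U1 f1" "smooth_on U2 f2"
    and x: "x \<in> U1" "y \<in> U2" and b: "bij (frame f1 x)" "bij (frame f2 y)"
  shows "distribution_D para_J (joined f1 f2) (x, y, z) = {v. snd (snd v) = 0}"
proof -
  let ?F = "frechet_derivative (joined f1 f2) (at (x, y, z))"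
  have J: "para_J (?F (u, v, t)) = rot (exp (- z) *\<^sub>R frame f1 x (u, - t), - (exp z *\<^sub>R frame f2 y (v, t)))" for u v t
    unfolding joined_frechet[OF op x] para_J_rot by (simp add: frame_def)
  have F: "?F (u, v, t) = rot (exp (- z) *\<^sub>R frame f1 x (u, - t), exp z *\<^sub>R frame f2 y (v, t))" for u v t
    unfolding joined_frechet[OF op x] by (simp add: frame_def)
  have neg: "- frame f2 y w = frame f2 y (- w)" for w
    by (rule linear_neg[OF frame_linear[OF op(4) x(2)], symmetric])
  have inj: "frame f1 x p = frame f1 x q \<longleftrightarrow> p = q" "frame f2 y p = frame f2 y q \<longleftrightarrow> p = q" for p q
    using b by (auto simp: bij_def inj_eq)
  have "?F (u, v, t) = para_J (?F (u', v', t')) \<longleftrightarrow> u = u' \<and> t = t' \<and> v = - v' \<and> t = - t'" for u v t u' v' t'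
    unfolding J unfolding F rot_eq_iff by (auto simp: neg inj scaleR_minus_right[symmetric] simp del: scaleR_minus_right)
  then have "(u, v, t) \<in> distribution_D para_J (joined f1 f2) (x, y, z) \<longleftrightarrow> t = 0" for u v t
    unfolding distribution_D_def tangent_image_def by (auto simp: image_iff) (metis minus_zero minus_minus)
  then show ?thesis by auto
qed

text \<open>The annihilating functional is the same at all points, so it can be moved inside
  derivatives and kills the derivatives of sections of \<open>E\<close>.\<close>

lemma involutive_on_hyperplane:
  fixes E :: "'a::euclidean_space \<Rightarrow> 'a set" and l :: "'a \<Rightarrow> real"
  assumes l: "linear l" and E: "\<And>x. x \<in> V \<Longrightarrow> E x = {v. l v = 0}"
  shows "involutive_on V E"
  unfolding involutive_on_def
proof (intro allI impI ballI, elim conjE)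
  fix W X Y x
  assume W: "open W" "W \<subseteq> V" and X: "smooth_on W X" and Y: "smooth_on W Y"
    and D: "\<forall>x\<in>W. X x \<in> E x \<and> Y x \<in> E x" and x: "x \<in> W"
  have bl: "bounded_linear l" using l linear_conv_bounded_linear by blast
  have 0: "l (dd v Z x) = 0" if Z: "smooth_on W Z" "\<And>y. y \<in> W \<Longrightarrow> l (Z y) = 0" for v Z
  proof -
    have "l (dd v Z x) = dd v (\<lambda>y. l (Z y)) x" by (rule dd_linear_image[OF bl Z(1) x, symmetric])
    also have "\<dots> = dd v (\<lambda>y. 0) x" by (rule dd_cong[OF W(1) x Z(2)])
    also have "\<dots> = 0" by (rule dd_eq) simp
    finally show ?thesis .
  qed
  have z: "l (X y) = 0" "l (Y y) = 0" if "y \<in> W" for y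
    using D E W that by auto
  have "l (flat_D X Y x - flat_D Y X x) = 0"
    using 0[OF Y z(2), of "X x"] 0[OF X z(1), of "Y x"]
    by (simp add: linear_diff[OF l] flat_D_def)
  then show "lie_bracket X Y x \<in> E x" using E W x by (auto simp: lie_bracket_def)
qed

lemma distribution_D_cong:
  "open V \<Longrightarrow> x \<in> V \<Longrightarrow> (\<And>y. y \<in> V \<Longrightarrow> F y = G y) \<Longrightarrow> distribution_D J F x = distribution_D J G x"
  by (simp add: distribution_D_def tangent_image_def frechet_derivative_cong(1)[of V x F G])

lemma joined_J_tangent_hypersphere:
  fixes U1 U2 :: "'u::euclidean_space set" and f1 f2 :: "'u \<Rightarrow> 'b::euclidean_space"
  assumes op: "open U1" "open U2" and dim: "DIM('b) = DIM('u) + 1"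
    and f: "proper_centred_hypersphere_on U1 f1" "proper_centred_hypersphere_on U2 f2"
  shows "\<exists>C lam. let U = U1 \<times> U2 \<times> UNIV in
           affine_hypersphere (top_of_set U) (std_atlas U) (joined f1 f2) C lam \<and> lam \<noteq> 0 \<and>
           J_tangent para_J (std_atlas U) (joined f1 f2) C \<and>
           involutive_D para_J (std_atlas U) (joined f1 f2)"
proof -
  let ?U = "U1 \<times> U2 \<times> (UNIV :: real set)"
  obtain r1 r2 where con: "connected U1" "connected U2"
    and c: "centroaffine U1 f1 r1" "centroaffine U2 f2 r2"
    using f op by (auto simp: proper_centred_hypersphere_on_iff[OF dim])
  have s: "smooth_on U1 f1" "smooth_on U2 f2" using c by (auto simp: centroaffine_def)
  have U: "open ?U" using op by (intro open_Times) auto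
  have "connected ?U" by (intro connected_Times con) simp
  from affine_hypersphere_std[OF _ U this centroaffine_joined[OF op dim c]] dim
  obtain lam where lam: "lam \<noteq> 0"
    "affine_hypersphere (top_of_set ?U) (std_atlas ?U) (joined f1 f2) (\<lambda>x. - lam *\<^sub>R joined f1 f2 x) lam"
    by auto
  have "para_J (- lam *\<^sub>R joined f1 f2 p) \<in> tangent_image (joined f1 f2) p" if p: "p \<in> ?U" for p
  proof -
    obtain x y z where xyz: "p = (x, y, z)" "x \<in> U1" "y \<in> U2" using p by auto
    \<comment> \<open>The derivative of the join in \<open>z\<close> is minus \<open>para_J\<close>
      of its position, hence the preimage \<open>(0, 0, lam)\<close>.\<close>
    have "para_J (- lam *\<^sub>R joined f1 f2 p) = frechet_derivative (joined f1 f2) (at p) (0, 0, lam)"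
      using linear_0[OF smooth_on_linear_derivative[OF s(1) xyz(2)]] linear_0[OF smooth_on_linear_derivative[OF s(2) xyz(3)]]
      unfolding xyz(1) joined_frechet[OF op s xyz(2,3)] joined_eq_rot
      by (simp add: para_J_def rot_def algebra_simps)
    then show ?thesis by (auto simp: tangent_image_def)
  qed
  moreover have "tangent_image (in_chart (?U, id) (joined f1 f2)) p = tangent_image (joined f1 f2) p" if "p \<in> ?U" for p
    unfolding tangent_image_def
    by (subst frechet_derivative_cong(1)[OF U that, of _ "joined f1 f2"]) (simp_all add: in_chart_std)
  ultimately have J: "J_tangent para_J (std_atlas ?U) (joined f1 f2) (\<lambda>x. - lam *\<^sub>R joined f1 f2 x)"
    unfolding J_tangent_def std_atlas_def by (simp add: chart_image_std in_chart_std)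
  have "distribution_D para_J (in_chart (?U, id) (joined f1 f2)) p = {v. snd (snd v) = 0}" if p: "p \<in> ?U" for p
  proof -
    obtain x y z where xyz: "p = (x, y, z)" "x \<in> U1" "y \<in> U2" using p by auto
    have "distribution_D para_J (in_chart (?U, id) (joined f1 f2)) p = distribution_D para_J (joined f1 f2) p"
      by (rule distribution_D_cong[OF U p]) (simp add: in_chart_std)
    also have "\<dots> = {v. snd (snd v) = 0}"
      unfolding xyz(1) by (rule distribution_D_joined[OF op s xyz(2,3)]) (use c xyz in \<open>auto simp: centroaffine_def\<close>)
    finally show ?thesis .
  qed
  then have "involutive_on ?U (distribution_D para_J (in_chart (?U, id) (joined f1 f2)))"
    by (intro involutive_on_hyperplane[where l = "\<lambda>v. snd (snd v)"]) (auto simp: linear_iff)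
  then have "involutive_D para_J (std_atlas ?U) (joined f1 f2)"
    by (simp add: involutive_D_def std_atlas_def chart_image_std)
  with lam J show ?thesis unfolding Let_def by blast
qed

lemma dd_apply_family:
  fixes L :: "'a::euclidean_space \<Rightarrow> 'c::euclidean_space \<Rightarrow> 'b::real_normed_vector"
  assumes V: "open V" "x \<in> V" and L: "\<And>y. y \<in> V \<Longrightarrow> linear (L y)" "\<And>w. smooth_on V (\<lambda>y. L y w)"
    and G: "smooth_on V G"
  shows "dd u (\<lambda>y. L y (G y)) x = dd u (\<lambda>y. L y (G x)) x + L x (dd u G x)"
proof -
  note DG = smooth_on_has_derivative[OF G V(2)] and DL = smooth_on_has_derivative[OF L(2) V(2)]
  have lin: "linear (\<lambda>w. dd u (\<lambda>y. L y w) x)"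
    by (rule dd_linear_family[OF V L(1)]) (use differentiableI[OF DL] in auto)
  have "((\<lambda>y. \<Sum>b\<in>Basis. inner (G y) b *\<^sub>R L y b) has_derivative
      (\<lambda>u. \<Sum>b\<in>Basis. inner (G x) b *\<^sub>R dd u (\<lambda>y. L y b) x + inner (dd u G x) b *\<^sub>R L x b)) (at x)"
    by (intro has_derivative_sum has_derivative_scaleR has_derivative_inner_left DG DL)
  from dd_eq[OF this, of u]
  have "dd u (\<lambda>y. \<Sum>b\<in>Basis. inner (G y) b *\<^sub>R L y b) x
      = dd u (\<lambda>y. L y (G x)) x + L x (dd u G x)"
    by (simp add: sum.distrib apply_linear_expand[OF L(1)[OF V(2)], of "dd u G x"]
        apply_linear_expand[OF lin, of "G x"])
  moreover have "dd u (\<lambda>y. L y (G y)) x = dd u (\<lambda>y. \<Sum>b\<in>Basis. inner (G y) b *\<^sub>R L y b) x"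
    by (rule dd_cong[OF V]) (rule apply_linear_expand[OF L(1)])
  ultimately show ?thesis by simp
qed

lemma dd_const: "dd u (\<lambda>y. c) x = 0"
  by (rule dd_eq) simp

lemma para_J_linear: "linear para_J"
  by (auto simp: para_J_def linear_iff)

lemma para_J_para_J [simp]: "para_J (para_J p) = p"
  by (cases p) (simp add: para_J_def)

lemma para_J_bounded_linear: "bounded_linear (para_J :: 'b::euclidean_space \<times> 'b \<Rightarrow> _)"
  using para_J_linear linear_conv_bounded_linear by blast

section \<open>The one-form annihilating the distribution\<close>

definition conormal :: "('a::euclidean_space \<Rightarrow> 'b::euclidean_space) \<Rightarrow> 'a \<Rightarrow> 'b \<Rightarrow> real" where
  "conormal g x w = snd (linv (frame g x) w)"

definition tangential :: "('a::euclidean_space \<Rightarrow> 'b::euclidean_space) \<Rightarrow> 'a \<Rightarrow> 'b \<Rightarrow> 'a" where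
  "tangential g x w = fst (linv (frame g x) w)"

text \<open>The sign is chosen so that for a join, whose derivative in \<open>z\<close> is minus
  \<open>para_J\<close> of the position, the form becomes dz.\<close>

definition eta :: "('a::euclidean_space \<Rightarrow> 'b::euclidean_space \<times> 'b) \<Rightarrow> 'a \<Rightarrow> 'a \<Rightarrow> real" where
  "eta g x v = - conormal g x (para_J (dd v g x))"

text \<open>The tangent vector with image \<open>- para_J (g x)\<close>, which exists when
  \<open>para_J (g x)\<close> is tangent. It is the Reeb-like field normalised by
  \<open>eta_reeb\<close>; for a join it is the coordinate field of \<open>z\<close>.\<close>

definition reeb :: "('a::euclidean_space \<Rightarrow> 'b::euclidean_space \<times> 'b) \<Rightarrow> 'a \<Rightarrow> 'a" where
  "reeb g x = tangential g x (- para_J (g x))"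

context
  fixes V :: "'a::euclidean_space set" and g :: "'a \<Rightarrow> 'b::euclidean_space \<times> 'b"
  assumes V: "open V" and g: "smooth_on V g" and b: "\<And>x. x \<in> V \<Longrightarrow> bij (frame g x)"
    and Jt: "\<And>x. x \<in> V \<Longrightarrow> para_J (g x) \<in> tangent_image g x"
begin

lemma decompose: "x \<in> V \<Longrightarrow> w = dd (tangential g x w) g x + conormal g x w *\<^sub>R g x"
proof -
  assume "x \<in> V"
  then have "frame g x (linv (frame g x) w) = w" using b by (simp add: bij_is_surj surj_f_inv_f)
  then show ?thesis by (simp add: frame_def tangential_def conormal_def flat_D_def case_prod_unfold)
qed

lemma conormal_linear: "x \<in> V \<Longrightarrow> linear (conormal g x)"
  and tangential_linear: "x \<in> V \<Longrightarrow> linear (tangential g x)"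
  using linear_bij_inv[OF frame_linear[OF g] b]
  by (auto simp: conormal_def tangential_def linear_iff)

lemma dd_linear_arg: "x \<in> V \<Longrightarrow> linear (\<lambda>v. dd v g x)"
  by (rule has_derivative_linear[OF smooth_on_has_derivative[OF g]])

lemma conormal_tangent: "x \<in> V \<Longrightarrow> conormal g x (dd v g x) = 0"
  and tangential_tangent: "x \<in> V \<Longrightarrow> tangential g x (dd v g x) = v"
  using frame_inverse_tangent[OF b, of x v] by (simp_all add: conormal_def tangential_def flat_D_def)

lemma position_parts:
  assumes "x \<in> V"
  shows "conormal g x (g x) = 1" "tangential g x (g x) = 0"
proof -
  have "frame g x (0, 1) = g x"
    using linear_0[OF smooth_on_linear_derivative[OF g assms]] by (simp add: frame_def)
  then have "linv (frame g x) (g x) = (0, 1)" using inv_f_f[OF bij_is_inj[OF b[OF assms]]] by metis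
  then show "conormal g x (g x) = 1" "tangential g x (g x) = 0"
    by (simp_all add: conormal_def tangential_def)
qed

lemma conormal_J_position: "x \<in> V \<Longrightarrow> conormal g x (para_J (g x)) = 0"
  using Jt[of x] conormal_tangent[of x] by (auto simp: tangent_image_def flat_D_def)

lemma dd_reeb: "x \<in> V \<Longrightarrow> dd (reeb g x) g x = - para_J (g x)"
  using decompose[of x "- para_J (g x)"] conormal_J_position[of x] linear_neg[OF conormal_linear, of x]
  by (simp add: reeb_def)

lemma eta_linear: "x \<in> V \<Longrightarrow> linear (eta g x)"
  by (rule linearI)
     (simp_all add: eta_def linear_add[OF dd_linear_arg] linear_cmul[OF dd_linear_arg] linear_add[OF para_J_linear]
       linear_cmul[OF para_J_linear] linear_add[OF conormal_linear] linear_cmul[OF conormal_linear])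

lemma eta_reeb: "x \<in> V \<Longrightarrow> eta g x (reeb g x) = 1"
  by (simp add: eta_def dd_reeb linear_neg[OF para_J_linear] linear_neg[OF conormal_linear] position_parts)

lemma J_tangent_decompose:
  "x \<in> V \<Longrightarrow> para_J (dd v g x) = dd (tangential g x (para_J (dd v g x))) g x - eta g x v *\<^sub>R g x"
  using decompose[of x "para_J (dd v g x)"] by (simp add: eta_def)

text \<open>Since \<open>para_J\<close> is an involution, \<open>v\<close> lies in the distribution
  exactly when \<open>para_J\<close> maps its image to a tangent vector, that is, to one with
  vanishing conormal component.\<close>

lemma distribution_D_eq_ker: "x \<in> V \<Longrightarrow> distribution_D para_J g x = {v. eta g x v = 0}"
proof -
  assume x: "x \<in> V"
  have "v \<in> distribution_D para_J g x \<longleftrightarrow> eta g x v = 0" for v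
  proof
    assume "v \<in> distribution_D para_J g x"
    then obtain w where "dd v g x = para_J (dd w g x)"
      by (auto simp: distribution_D_def tangent_image_def flat_D_def)
    then show "eta g x v = 0" using conormal_tangent[OF x] by (simp add: eta_def)
  next
    assume "eta g x v = 0"
    then have "para_J (dd v g x) = dd (tangential g x (para_J (dd v g x))) g x"
      using J_tangent_decompose[OF x, of v] by simp
    then have "dd v g x = para_J (dd (tangential g x (para_J (dd v g x))) g x)"
      using para_J_para_J[of "dd v g x"] by simp
    then show "v \<in> distribution_D para_J g x"
      unfolding distribution_D_def tangent_image_def flat_D_def by auto
  qed
  then show ?thesis by auto
qed

lemma smooth_on_conormal: "smooth_on V (\<lambda>x. conormal g x w)"
  unfolding conormal_def
  by (intro smooth_on_linear[OF bounded_linear_snd V] smooth_on_frame_inverse[OF V g b] smooth_on_const V)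

lemma smooth_on_eta: "smooth_on V (\<lambda>x. eta g x v)"
  unfolding eta_def
  by (intro smooth_on_linear[OF bounded_linear_minus[OF bounded_linear_ident] V]
      smooth_on_apply[OF V conormal_linear smooth_on_conormal]
      smooth_on_linear[OF para_J_bounded_linear V] smooth_on_dd g)

lemma smooth_on_reeb: "smooth_on V (reeb g)"
proof -
  have "smooth_on V (\<lambda>x. tangential g x (- para_J (g x)))"
    unfolding tangential_def
    by (intro smooth_on_linear[OF bounded_linear_fst V] smooth_on_frame_inverse[OF V g b]
        smooth_on_linear[OF bounded_linear_minus[OF bounded_linear_ident] V]
        smooth_on_linear[OF para_J_bounded_linear V] g)
  then show ?thesis by (simp add: reeb_def[abs_def])
qed

section \<open>Structure equations of the conormal\<close>

lemma dd_conormal_linear: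
  assumes x: "x \<in> V"
  shows "linear (\<lambda>w. dd u (\<lambda>y. conormal g y w) x)"
  by (rule dd_linear_family[OF V x conormal_linear])
     (use differentiableI[OF smooth_on_has_derivative[OF smooth_on_conormal x]] in auto)

lemma dd_conormal_apply:
  assumes x: "x \<in> V" and G: "smooth_on V G"
  shows "dd u (\<lambda>y. conormal g y (G y)) x = dd u (\<lambda>y. conormal g y (G x)) x + conormal g x (dd u G x)"
  by (rule dd_apply_family[OF V x conormal_linear smooth_on_conormal G])

text \<open>This and the next two identities differentiate constant pairings of the conormal: 1 with
  the position, 0 with tangent vectors, 0 with \<open>para_J\<close> of the position.\<close>

lemma dd_conormal_position:
  assumes x: "x \<in> V"
  shows "dd u (\<lambda>y. conormal g y (g x)) x = 0"
proof -
  have "dd u (\<lambda>y. conormal g y (g y)) x = dd u (\<lambda>y. 1) x"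
    by (rule dd_cong[OF V x]) (simp add: position_parts)
  then show ?thesis
    using dd_conormal_apply[OF x g, of u] conormal_tangent[OF x] by (simp add: dd_const)
qed

lemma dd_conormal_tangent:
  assumes x: "x \<in> V"
  shows "dd u (\<lambda>y. conormal g y (dd v g x)) x = - hess g x u v"
proof -
  have "dd u (\<lambda>y. conormal g y (dd v g y)) x = dd u (\<lambda>y. 0) x"
    by (rule dd_cong[OF V x]) (simp add: conormal_tangent)
  then show ?thesis
    using dd_conormal_apply[OF x smooth_on_dd[OF g], of u v]
    by (simp add: dd_const hess_def conormal_def eq_neg_iff_add_eq_0)
qed

lemma dd_conormal_J_position:
  assumes x: "x \<in> V"
  shows "dd u (\<lambda>y. conormal g y (para_J (g x))) x = eta g x u"
proof -
  have "dd u (\<lambda>y. conormal g y (para_J (g y))) x = dd u (\<lambda>y. 0) x"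
    by (rule dd_cong[OF V x]) (simp add: conormal_J_position)
  then show ?thesis
    using dd_conormal_apply[OF x smooth_on_linear[OF para_J_bounded_linear V g], of u]
      dd_linear_image[OF para_J_bounded_linear g x, of u]
    by (simp add: dd_const eta_def eq_neg_iff_add_eq_0)
qed

section \<open>The exterior derivative of \<open>eta\<close>\<close>

definition d_eta :: "'a \<Rightarrow> 'a \<Rightarrow> 'a \<Rightarrow> real" where
  "d_eta x u v = dd u (\<lambda>y. eta g y v) x - dd v (\<lambda>y. eta g y u) x"

text \<open>The vector \<open>para_J (dd v g x)\<close> splits into a tangent part and a multiple of
  the position. The differentiated conormal gives minus \<open>hess\<close> on the former and 0 on
  the latter.\<close>

lemma dd_eta:
  assumes x: "x \<in> V"
  shows "dd u (\<lambda>y. eta g y v) x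
    = hess g x u (tangential g x (para_J (dd v g x))) - conormal g x (para_J (dd u (dd v g) x))"
proof -
  let ?w = "tangential g x (para_J (dd v g x))"
  note l = dd_conormal_linear[OF x, of u]
  have s: "smooth_on V (\<lambda>y. para_J (dd v g y))"
    by (rule smooth_on_linear[OF para_J_bounded_linear V smooth_on_dd[OF g]])
  have "dd u (\<lambda>y. eta g y v) x = - dd u (\<lambda>y. conormal g y (para_J (dd v g y))) x"
    unfolding eta_def
    by (rule dd_linear_image[OF bounded_linear_minus[OF bounded_linear_ident]
          smooth_on_apply[OF V conormal_linear smooth_on_conormal s] x])
  also have "dd u (\<lambda>y. conormal g y (para_J (dd v g y))) x
      = dd u (\<lambda>y. conormal g y (para_J (dd v g x))) x + conormal g x (para_J (dd u (dd v g) x))"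
    using dd_conormal_apply[OF x s, of u] dd_linear_image[OF para_J_bounded_linear smooth_on_dd[OF g] x]
    by simp
  also have "dd u (\<lambda>y. conormal g y (para_J (dd v g x))) x
      = dd u (\<lambda>y. conormal g y (dd ?w g x - eta g x v *\<^sub>R g x)) x"
    using J_tangent_decompose[OF x, of v] by simp
  also have "\<dots> = - hess g x u ?w"
    by (simp add: linear_diff[OF l] linear_cmul[OF l] dd_conormal_position[OF x] dd_conormal_tangent[OF x])
  finally show ?thesis by simp
qed

text \<open>The terms with second derivatives of \<open>g\<close> are symmetric in \<open>u\<close>
  and \<open>v\<close> and cancel.\<close>

lemma d_eta_eq:
  assumes x: "x \<in> V"
  shows "d_eta x u v = hess g x u (tangential g x (para_J (dd v g x))) - hess g x v (tangential g x (para_J (dd u g x)))"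
  unfolding d_eta_def dd_eta[OF x] second_derivative_symmetric[OF V x g, of u v] by simp

lemma hess_symmetric: "x \<in> V \<Longrightarrow> hess g x u v = hess g x v u"
  unfolding hess_def by (subst second_derivative_symmetric[OF V _ g]) auto

text \<open>Two evaluations of the differentiated conormal on \<open>para_J (g x)\<close>, which is
  minus the image of \<open>reeb g x\<close>, are compared. Thus \<open>reeb\<close> is the metric
  dual of \<open>eta\<close>.\<close>

lemma hess_reeb:
  assumes x: "x \<in> V"
  shows "hess g x w (reeb g x) = eta g x w"
proof -
  have "dd w (\<lambda>y. conormal g y (- para_J (g x))) x = - hess g x w (reeb g x)"
    using dd_conormal_tangent[OF x, of w "reeb g x"] by (simp add: dd_reeb[OF x])
  then show ?thesis
    using linear_neg[OF dd_conormal_linear[OF x, of w], of "para_J (g x)"] dd_conormal_J_position[OF x, of w]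
    by simp
qed

text \<open>A consequence of the structure equations, without involutivity. One term of
  \<open>d_eta_eq\<close> vanishes because \<open>para_J\<close> sends the image of
  \<open>reeb\<close> to minus the position; the other is, up to sign, \<open>eta\<close> of the
  tangential part of \<open>para_J (dd u g x)\<close>, which is zero as \<open>para_J\<close> is an
  involution.\<close>

lemma d_eta_reeb:
  assumes x: "x \<in> V"
  shows "d_eta x u (reeb g x) = 0"
proof -
  let ?w = "tangential g x (para_J (dd u g x))"
  have "para_J (dd (reeb g x) g x) = - g x" by (simp add: dd_reeb[OF x] linear_neg[OF para_J_linear])
  then have 1: "tangential g x (para_J (dd (reeb g x) g x)) = 0"
    by (simp add: linear_neg[OF tangential_linear[OF x]] position_parts[OF x])
  have "dd ?w g x = para_J (dd u g x) + eta g x u *\<^sub>R g x"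
    by (rule sym, rule iffD1[OF eq_diff_eq], rule J_tangent_decompose[OF x])
  then have "eta g x ?w = 0"
    by (simp add: eta_def linear_diff[OF para_J_linear] linear_cmul[OF para_J_linear]
        linear_diff[OF conormal_linear[OF x]] linear_cmul[OF conormal_linear[OF x]]
        conormal_tangent[OF x] conormal_J_position[OF x])
  then show ?thesis
    unfolding d_eta_eq[OF x] 1
    using bilinear_rzero[OF hess_bilinear[OF V x g b[OF x]]] hess_reeb[OF x, of ?w] hess_symmetric[OF x, of ?w]
    by simp
qed

lemma d_eta_fields:
  assumes x: "x \<in> V" and X: "smooth_on V X" "\<And>y. y \<in> V \<Longrightarrow> eta g y (X y) = 0"
    and Y: "smooth_on V Y" "\<And>y. y \<in> V \<Longrightarrow> eta g y (Y y) = 0"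
  shows "d_eta x (X x) (Y x) = - eta g x (lie_bracket X Y x)"
proof -
  have *: "dd u (\<lambda>y. eta g y (Z x)) x = - eta g x (dd u Z x)"
    if Z: "smooth_on V Z" "\<And>y. y \<in> V \<Longrightarrow> eta g y (Z y) = 0" for u Z
  proof -
    have "dd u (\<lambda>y. eta g y (Z y)) x = dd u (\<lambda>y. 0) x" by (rule dd_cong[OF V x Z(2)])
    then show ?thesis
      using dd_apply_family[OF V x eta_linear smooth_on_eta Z(1), of u] by (simp add: dd_const)
  qed
  have "dd (X x) (\<lambda>y. eta g y (Y x)) x = - eta g x (dd (X x) Y x)"
    "dd (Y x) (\<lambda>y. eta g y (X x)) x = - eta g x (dd (Y x) X x)"
    by (rule *; use X Y in simp)+
  moreover have "lie_bracket X Y x = dd (X x) Y x - dd (Y x) X x"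
    by (simp add: lie_bracket_def flat_D_def)
  ultimately show ?thesis
    unfolding d_eta_def by (simp add: linear_diff[OF eta_linear[OF x]])
qed

lemma d_eta_bilinear:
  assumes x: "x \<in> V"
  shows "bilinear (d_eta x)"
proof -
  have 1: "linear (\<lambda>u. dd u (\<lambda>y. eta g y v) x)" for v
    by (rule has_derivative_linear[OF smooth_on_has_derivative[OF smooth_on_eta x]])
  have 2: "linear (\<lambda>v. dd u (\<lambda>y. eta g y v) x)" for u
    by (rule dd_linear_family[OF V x eta_linear])
       (use differentiableI[OF smooth_on_has_derivative[OF smooth_on_eta x]] in auto)
  show ?thesis
    unfolding bilinear_def d_eta_def
    by (auto intro!: linearI simp: linear_add[OF 1] linear_add[OF 2] linear_cmul[OF 1] linear_cmul[OF 2] algebra_simps)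
qed

lemma eta_closed:
  assumes inv: "involutive_on V (distribution_D para_J g)" and x: "x \<in> V"
  shows "dd u (\<lambda>y. eta g y v) x = dd v (\<lambda>y. eta g y u) x"
proof -
  \<comment> \<open>The constant field \<open>u\<close> projected to the kernel of
    \<open>eta\<close> along \<open>reeb\<close>: a smooth section of the distribution, to which
    involutivity applies. The remaining multiples of \<open>reeb\<close> are handled by
    \<open>d_eta_reeb\<close>.\<close>
  define P where "P = (\<lambda>u y. u - eta g y u *\<^sub>R reeb g y)"
  have P: "smooth_on V (P u)" "\<And>y. y \<in> V \<Longrightarrow> eta g y (P u y) = 0" for u
    unfolding P_def
    by (intro smooth_on_diff V smooth_on_const smooth_on_bilinear[OF bounded_bilinear_scaleR] smooth_on_eta smooth_on_reeb)
       (simp add: linear_diff[OF eta_linear] linear_cmul[OF eta_linear] eta_reeb)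
  note bil = d_eta_bilinear[OF x]
  have anti: "d_eta x u v = - d_eta x v u" for u v by (simp add: d_eta_def)
  have "lie_bracket (P u) (P v) x \<in> distribution_D para_J g x"
    using inv P V x unfolding involutive_on_def
    by (elim allE[of _ V] allE[of _ "P u"] allE[of _ "P v"]) (simp add: distribution_D_eq_ker)
  then have "d_eta x (P u x) (P v x) = 0"
    using d_eta_fields[OF x P P, of u v] x by (simp add: distribution_D_eq_ker)
  moreover have "u = P u x + eta g x u *\<^sub>R reeb g x" for u by (simp add: P_def)
  then have "d_eta x u v = d_eta x (P u x + eta g x u *\<^sub>R reeb g x) (P v x + eta g x v *\<^sub>R reeb g x)" by metis
  ultimately have "d_eta x u v = 0"
    using d_eta_reeb[OF x] anti[of "reeb g x"]
    by (simp add: bilinear_ladd[OF bil] bilinear_radd[OF bil] bilinear_lmul[OF bil] bilinear_rmul[OF bil])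
  then show ?thesis by (simp add: d_eta_def)
qed

end

section \<open>Recovering the two factors\<close>

text \<open>The second derivatives of \<Psi> contribute only tangent terms, so \<open>hess\<close>
  is pulled back as a tensor. Its determinant and the squared determinant of the frame both acquire
  the squared determinant of the derivative of \<Psi>, and \<open>r\<close> is unchanged.\<close>

lemma centroaffine_compose:
  fixes g :: "'a::euclidean_space \<Rightarrow> 'b::euclidean_space" and \<Psi> :: "'a \<Rightarrow> 'a"
  assumes dim: "DIM('b) = DIM('a) + 1" and V: "open V" and W: "open W" and g: "centroaffine V g r"
    and \<Psi>: "smooth_on W \<Psi>" "\<Psi> ` W \<subseteq> V" "\<And>y. y \<in> W \<Longrightarrow> bij (frechet_derivative \<Psi> (at y))"
  shows "centroaffine W (\<lambda>y. g (\<Psi> y)) r"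
proof -
  have s: "smooth_on V g" and r: "r > 0" using g by (auto simp: centroaffine_def)
  have sm: "smooth_on W (\<lambda>y. g (\<Psi> y))" by (rule smooth_on_compose[OF W V \<Psi>(2,1) s])
  have "bij (frame (\<lambda>y. g (\<Psi> y)) y) \<and> \<bar>form_det (hess (\<lambda>y. g (\<Psi> y)) y)\<bar> = r * (map_det (frame (\<lambda>y. g (\<Psi> y)) y))\<^sup>2"
    if y: "y \<in> W" for y
  proof -
    let ?G = "\<lambda>y. g (\<Psi> y)"
    let ?P = "frechet_derivative \<Psi> (at y)"
    let ?Q = "\<lambda>(w, c :: real). (?P w, c)"
    have x: "\<Psi> y \<in> V" using \<Psi>(2) y by auto
    have b: "bij (frame g (\<Psi> y))" and det: "\<bar>form_det (hess g (\<Psi> y))\<bar> = r * (map_det (frame g (\<Psi> y)))\<^sup>2"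
      using g x by (auto simp: centroaffine_def)
    note Pl = smooth_on_linear_derivative[OF \<Psi>(1) y]
    have fd: "frechet_derivative ?G (at y) v = frechet_derivative g (at (\<Psi> y)) (?P v)" for v
      using has_derivative_compose[OF smooth_on_has_derivative'[OF \<Psi>(1) y] smooth_on_has_derivative'[OF s x]]
      by (simp add: frechet_derivative_at[symmetric])
    have fr: "frame ?G y = (\<lambda>w. frame g (\<Psi> y) (?Q w))"
      by (auto simp: frame_def fd fun_eq_iff)
    have Qb: "bij ?Q"
    proof (rule o_bij)
      show "(\<lambda>(w, c). (linv ?P w, c)) \<circ> ?Q = id" using \<Psi>(3)[OF y] by (auto simp: fun_eq_iff bij_is_inj)
      show "?Q \<circ> (\<lambda>(w, c). (linv ?P w, c)) = id"
        using \<Psi>(3)[OF y] by (auto simp: fun_eq_iff bij_is_surj surj_f_inv_f)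
    qed
    have Ql: "linear ?Q" using Pl by (auto simp: linear_iff)
    have fb: "bij (frame ?G y)" using bij_comp[OF Qb b] unfolding fr o_def .
    have sd: "dd u (dd v ?G) y = dd (?P u) (dd (?P v) g) (\<Psi> y) + frechet_derivative g (at (\<Psi> y)) (dd u (dd v \<Psi>) y)" for u v
    proof -
      have "dd v ?G z = frechet_derivative g (at (\<Psi> z)) (dd v \<Psi> z)" if z: "z \<in> W" for z
        using has_derivative_compose[OF smooth_on_has_derivative'[OF \<Psi>(1) z] smooth_on_has_derivative'[OF s]] \<Psi>(2) z
        by (auto simp: flat_D_def frechet_derivative_at[symmetric])
      then have "dd u (dd v ?G) y = dd u (\<lambda>z. frechet_derivative g (at (\<Psi> z)) (dd v \<Psi> z)) y"
        by (rule dd_cong[OF W y])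
      also have "\<dots> = dd (?P u) (dd (dd v \<Psi> y) g) (\<Psi> y) + frechet_derivative g (at (\<Psi> y)) (dd u (dd v \<Psi>) y)"
        by (rule dd_eq[OF derivative_along_has_derivative[OF V x s smooth_on_has_derivative'[OF \<Psi>(1) y]
              smooth_on_has_derivative[OF smooth_on_dd[OF \<Psi>(1)] y]]])
      finally show ?thesis by (simp add: flat_D_def)
    qed
    have h: "hess ?G y = (\<lambda>u v. hess g (\<Psi> y) (?P u) (?P v))"
    proof (intro ext)
      fix u v
      obtain w c where wc: "linv (frame g (\<Psi> y)) (dd (?P u) (dd (?P v) g) (\<Psi> y)) = (w, c)" by force
      have "dd (?P u) (dd (?P v) g) (\<Psi> y) = frame g (\<Psi> y) (w, c)" using wc b by (metis bij_inv_eq_iff)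
      moreover have "w + dd u (dd v \<Psi>) y = ?P (linv ?P (w + dd u (dd v \<Psi>) y))"
        using \<Psi>(3)[OF y] by (simp add: bij_is_surj surj_f_inv_f)
      ultimately have "dd u (dd v ?G) y = frame ?G y (linv ?P (w + dd u (dd v \<Psi>) y), c)"
        unfolding sd fr by (simp add: frame_def linear_add[OF smooth_on_linear_derivative[OF s x], symmetric])
      then have "linv (frame ?G y) (dd u (dd v ?G) y) = (linv ?P (w + dd u (dd v \<Psi>) y), c)"
        using inv_f_f[OF bij_is_inj[OF fb]] by simp
      then show "hess ?G y u v = hess g (\<Psi> y) (?P u) (?P v)" using wc by (simp add: hess_def)
    qed
    have "form_det (hess ?G y) = (map_det ?P)\<^sup>2 * form_det (hess g (\<Psi> y))"
      unfolding h by (rule form_det_pullback[OF hess_bilinear[OF V x s b] refl])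
    moreover have "map_det (frame ?G y) = map_det (frame g (\<Psi> y)) * map_det ?Q"
      unfolding fr by (rule map_det_compose[OF frame_linear[OF s x]]) (simp add: dim)
    moreover have "\<bar>map_det ?Q\<bar> = \<bar>map_det ?P\<bar>"
      using map_det_product[of ?P "\<lambda>c :: real. c", OF Pl linear_ident] map_det_id[where 'b = real] by simp
    then have "(map_det ?Q)\<^sup>2 = (map_det ?P)\<^sup>2" by (metis power2_abs)
    ultimately show ?thesis
      using fb det by (simp add: abs_mult power_mult_distrib)
  qed
  with sm r show ?thesis by (simp add: centroaffine_def)
qed

text \<open>Being onto forces the range of \<open>L\<close> to have dimension exactly
  \<open>DIM('u)\<close>, so \<pi> is injective on it: a section \<open>R\<close> of the composite
  already reaches the whole range.\<close>

lemma linear_kernel_of_surj_comp: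
  fixes L :: "'a::euclidean_space \<Rightarrow> 'b::euclidean_space" and \<pi> :: "'b \<Rightarrow> 'u::euclidean_space"
  assumes L: "linear L" and \<pi>: "linear \<pi>" and surj: "\<And>u. \<exists>w. \<pi> (L w) = u"
    and dim: "dim (range L) \<le> DIM('u)" and 0: "\<pi> (L w) = 0"
  shows "L w = 0"
proof -
  have "surj (\<lambda>w. \<pi> (L w))" unfolding surj_def using surj by metis
  moreover have "linear (\<lambda>w. \<pi> (L w))" using linear_compose[OF L \<pi>] by (simp add: o_def)
  ultimately obtain R where R: "linear R" "(\<lambda>w. \<pi> (L w)) \<circ> R = id"
    using linear_surjective_right_inverse by blast
  then have R': "\<pi> (L (R u)) = u" for u by (metis comp_apply id_apply)
  have LR: "linear (\<lambda>u. L (R u))" using linear_compose[OF R(1) L] by (simp add: o_def)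
  have "inj (\<lambda>u. L (R u))" by (rule inj_on_inverseI[of _ \<pi>]) (simp add: R')
  then have "dim (range (\<lambda>u. L (R u))) = DIM('u)"
    using dim_image_eq[OF LR, of UNIV] by simp
  then have "range (\<lambda>u. L (R u)) = range L"
    using dim by (intro subspace_dim_equal linear_subspace_image LR L subspace_UNIV) auto
  then obtain u where "L w = L (R u)" by (metis rangeE rangeI)
  then show ?thesis using 0 R'[of u] linear_0[OF L] linear_0[OF R(1)] by simp
qed

text \<open>The range embeds isometrically into the target once its dimension is at most
  \<open>DIM('u)\<close>; at this stage only that upper bound on the rank is available.\<close>

lemma injective_projection:
  fixes L :: "'a::euclidean_space \<Rightarrow> 'b::euclidean_space"
  assumes L: "linear L" and dim: "dim (range L) \<le> DIM('u::euclidean_space)"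
  obtains \<pi> :: "'b \<Rightarrow> 'u::euclidean_space" where "linear \<pi>" "\<And>w. \<pi> (L w) = 0 \<Longrightarrow> L w = 0"
proof -
  have S: "subspace (range L)" and T: "subspace (UNIV :: 'u set)"
    using linear_subspace_image[OF L subspace_UNIV] by simp_all
  have "dim (range L) \<le> dim (UNIV :: 'u set)" using dim by simp
  from isometry_subset_subspace[OF S T this]
  obtain \<pi> :: "'b \<Rightarrow> 'u" where \<pi>: "linear \<pi>" "\<And>x. x \<in> range L \<Longrightarrow> norm (\<pi> x) = norm x"
    by metis
  show ?thesis by (rule that[OF \<pi>(1)]) (use \<pi>(2) in \<open>metis norm_eq_zero rangeI\<close>)
qed

lemma range_dim_less:
  fixes L :: "'a::euclidean_space \<Rightarrow> 'b::euclidean_space"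
  assumes L: "linear L" and "p \<notin> range L"
  shows "dim (range L) < DIM('b)"
proof -
  have "dim (range L) \<noteq> DIM('b)"
    using assms(2) dim_eq_full[of "range L"] linear_subspace_image[OF L subspace_UNIV]
    by (metis UNIV_I span_eq_iff)
  then show ?thesis using dim_subset_UNIV[of "range L"] by simp
qed

text \<open>With \<open>part_b\<close> the inverse of \<open>rot\<close>: the components of the
  position in the eigenspaces of \<open>para_J\<close>.\<close>

definition part_a :: "('a \<Rightarrow> 'b::real_vector \<times> 'b) \<Rightarrow> 'a \<Rightarrow> 'b" where
  "part_a g y = (1 / 2) *\<^sub>R (fst (g y) + snd (g y))"

definition part_b :: "('a \<Rightarrow> 'b::real_vector \<times> 'b) \<Rightarrow> 'a \<Rightarrow> 'b" where
  "part_b g y = (1 / 2) *\<^sub>R (fst (g y) - snd (g y))"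

lemma rot_half: "rot ((1 / 2) *\<^sub>R (fst p + snd p), (1 / 2) *\<^sub>R (fst p - snd p)) = p"
proof -
  have "(1 / 2) *\<^sub>R (fst p + snd p) + (1 / 2) *\<^sub>R (fst p - snd p) = (1 / 2 + 1 / 2) *\<^sub>R fst p"
    "(1 / 2) *\<^sub>R (fst p + snd p) - (1 / 2) *\<^sub>R (fst p - snd p) = (1 / 2 + 1 / 2) *\<^sub>R snd p"
    by (simp_all only: scaleR_add_left scaleR_add_right scaleR_diff_right) simp_all
  then show ?thesis by (cases p) (simp add: rot_def)
qed

lemma rot_parts: "rot (part_a g y, part_b g y) = g y"
  by (simp only: part_a_def part_b_def rot_half)

context
  fixes V :: "'a::euclidean_space set" and g :: "'a \<Rightarrow> 'b::euclidean_space \<times> 'b"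
  assumes V: "open V" and g: "smooth_on V g" and b: "\<And>x. x \<in> V \<Longrightarrow> bij (frame g x)"
    and Jt: "\<And>x. x \<in> V \<Longrightarrow> para_J (g x) \<in> tangent_image g x"
begin

lemma smooth_on_parts: "smooth_on V (part_a g)" "smooth_on V (part_b g)"
  unfolding part_a_def[abs_def] part_b_def[abs_def]
  by (intro smooth_on_linear[OF bounded_linear_scaleR_right] smooth_on_add smooth_on_diff
      smooth_on_linear[OF bounded_linear_fst] smooth_on_linear[OF bounded_linear_snd] V g)+

lemma dd_parts:
  assumes x: "x \<in> V"
  shows "dd v (part_a g) x = (1 / 2) *\<^sub>R (fst (dd v g x) + snd (dd v g x))"
    and "dd v (part_b g) x = (1 / 2) *\<^sub>R (fst (dd v g x) - snd (dd v g x))"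
proof -
  have "(part_a g has_derivative (\<lambda>v. (1 / 2) *\<^sub>R (fst (dd v g x) + snd (dd v g x)))) (at x)"
    "(part_b g has_derivative (\<lambda>v. (1 / 2) *\<^sub>R (fst (dd v g x) - snd (dd v g x)))) (at x)"
    unfolding part_a_def[abs_def] part_b_def[abs_def]
    by (intro has_derivative_scaleR_right has_derivative_add has_derivative_diff has_derivative_fst has_derivative_snd
        smooth_on_has_derivative[OF g x])+
  then show "dd v (part_a g) x = (1 / 2) *\<^sub>R (fst (dd v g x) + snd (dd v g x))"
    "dd v (part_b g) x = (1 / 2) *\<^sub>R (fst (dd v g x) - snd (dd v g x))"
    by (simp_all add: dd_eq)
qed

lemma rot_dd_parts: "x \<in> V \<Longrightarrow> rot (dd v (part_a g) x, dd v (part_b g) x) = dd v g x"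
  by (simp only: dd_parts rot_half)

text \<open>Equality would give \<open>dg w + J dg w = g + J g\<close> for the first part, or the
  same with minus signs for the second, where \<open>w\<close> is the component of \<open>v\<close>
  in the distribution. The conormal is 0 on the left side and 1 on the right.\<close>

lemma parts_transversal:
  assumes x: "x \<in> V"
  shows "dd v (part_a g) x + eta g x v *\<^sub>R part_a g x \<noteq> part_a g x"
    and "dd v (part_b g) x - eta g x v *\<^sub>R part_b g x \<noteq> part_b g x"
proof -
  note ctx = V g b Jt
  \<comment> \<open>Projection of \<open>v\<close> to the kernel of \<open>eta\<close>. It adds
    \<open>eta g x v\<close> times \<open>para_J (g x)\<close> to the image, which produces the
    correction terms of opposite sign in the two eigencomponents.\<close>
  define w where "w = v - eta g x v *\<^sub>R reeb g x"
  note dl = dd_linear_arg[OF ctx x] and nl = conormal_linear[OF ctx x] and el = eta_linear[OF ctx x]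
  have w: "dd w g x = dd v g x + eta g x v *\<^sub>R para_J (g x)"
    unfolding w_def by (simp add: linear_diff[OF dl] linear_cmul[OF dl] dd_reeb[OF ctx x])
  have "eta g x w = 0"
    unfolding w_def by (simp add: linear_diff[OF el] linear_cmul[OF el] eta_reeb[OF ctx x])
  then have J0: "conormal g x (para_J (dd w g x)) = 0" by (simp add: eta_def)
  have n: "conormal g x (dd w g x) = 0" "conormal g x (g x) = 1" "conormal g x (para_J (g x)) = 0"
    using conormal_tangent[OF ctx x] position_parts[OF ctx x] conormal_J_position[OF ctx x] by auto
  show "dd v (part_a g) x + eta g x v *\<^sub>R part_a g x \<noteq> part_a g x"
  proof
    assume "dd v (part_a g) x + eta g x v *\<^sub>R part_a g x = part_a g x"
    then have "(1 / 2) *\<^sub>R (fst (dd w g x) + snd (dd w g x)) = (1 / 2) *\<^sub>R (fst (g x) + snd (g x))"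
      unfolding w by (simp add: dd_parts[OF x] part_a_def para_J_def case_prod_unfold algebra_simps)
    then have "fst (dd w g x) + snd (dd w g x) = fst (g x) + snd (g x)" by simp
    then have "dd w g x + para_J (dd w g x) = g x + para_J (g x)"
      by (simp add: para_J_def case_prod_unfold prod_eq_iff add.commute)
    then have "conormal g x (dd w g x) + conormal g x (para_J (dd w g x))
        = conormal g x (g x) + conormal g x (para_J (g x))"
      by (simp only: linear_add[OF nl, symmetric])
    then show False using n J0 by simp
  qed
  show "dd v (part_b g) x - eta g x v *\<^sub>R part_b g x \<noteq> part_b g x"
  proof
    assume "dd v (part_b g) x - eta g x v *\<^sub>R part_b g x = part_b g x"
    then have "(1 / 2) *\<^sub>R (fst (dd w g x) - snd (dd w g x)) = (1 / 2) *\<^sub>R (fst (g x) - snd (g x))"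
      unfolding w by (simp add: dd_parts[OF x] part_b_def para_J_def case_prod_unfold algebra_simps)
    then have "fst (dd w g x) - snd (dd w g x) = fst (g x) - snd (g x)" by simp
    moreover from this have "snd (dd w g x) - fst (dd w g x) = snd (g x) - fst (g x)"
      by (metis minus_diff_eq)
    ultimately have "dd w g x - para_J (dd w g x) = g x - para_J (g x)"
      by (simp add: para_J_def case_prod_unfold prod_eq_iff)
    then have "conormal g x (dd w g x) - conormal g x (para_J (dd w g x))
        = conormal g x (g x) - conormal g x (para_J (g x))"
      by (simp only: linear_diff[OF nl, symmetric])
    then show False using n J0 by simp
  qed
qed

end

text \<open>As \<open>P\<close> after \<Phi> is a submersion equal to \<pi> after \<alpha>, the
  projected derivative of \<alpha> is onto; the rank bound then makes \<pi> lose nothing, so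
  \<alpha> is stationary along the fibres of the coordinate.\<close>

lemma factor_through_coordinate:
  fixes \<alpha> :: "'a::euclidean_space \<Rightarrow> 'b::euclidean_space" and \<pi> :: "'b \<Rightarrow> 'u::euclidean_space"
    and \<Phi> :: "'a \<Rightarrow> 'v::euclidean_space" and P :: "'v \<Rightarrow> 'u"
  assumes U: "open U" and \<alpha>: "smooth_on U \<alpha>" and \<pi>: "linear \<pi>" and P: "linear P" and \<Phi>: "smooth_on U \<Phi>"
    and coord: "\<And>x. x \<in> U \<Longrightarrow> P (\<Phi> x) = \<pi> (\<alpha> x)"
    and rank: "\<And>x. x \<in> U \<Longrightarrow> dim (range (\<lambda>v. dd v \<alpha> x)) \<le> DIM('u)"
    and surj: "surj P" "\<And>x. x \<in> U \<Longrightarrow> surj (frechet_derivative \<Phi> (at x))"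
    and x: "x \<in> U" and 0: "P (frechet_derivative \<Phi> (at x) w) = 0"
  shows "dd w \<alpha> x = 0"
proof -
  have bP: "bounded_linear P" and b\<pi>: "bounded_linear \<pi>" using P \<pi> linear_conv_bounded_linear by auto
  have eq: "P (dd v \<Phi> x) = \<pi> (dd v \<alpha> x)" for v
  proof -
    have "P (dd v \<Phi> x) = dd v (\<lambda>x. P (\<Phi> x)) x" by (rule dd_linear_image[OF bP \<Phi> x, symmetric])
    also have "\<dots> = dd v (\<lambda>x. \<pi> (\<alpha> x)) x" by (rule dd_cong[OF U x coord])
    also have "\<dots> = \<pi> (dd v \<alpha> x)" by (rule dd_linear_image[OF b\<pi> \<alpha> x])
    finally show ?thesis .
  qed
  show ?thesis
  proof (rule linear_kernel_of_surj_comp[OF has_derivative_linear[OF smooth_on_has_derivative[OF \<alpha> x]] \<pi> _ rank[OF x]])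
    fix u
    obtain q where "P q = u" using surj(1) by (metis surjD)
    moreover obtain v where "frechet_derivative \<Phi> (at x) v = q" using surj(2)[OF x] by (metis surjD)
    ultimately have "\<pi> (dd v \<alpha> x) = u" using eq[of v] by (simp add: flat_D_def)
    then show "\<exists>w. \<pi> (dd w \<alpha> x) = u" by blast
  next
    show "\<pi> (dd w \<alpha> x) = 0" using eq[of w] 0 by (simp add: flat_D_def)
  qed
qed

lemma constant_along_slice:
  fixes F :: "'a::euclidean_space \<Rightarrow> 'b::euclidean_space" and j :: "'c::euclidean_space \<Rightarrow> 'a"
  assumes F: "smooth_on Q F" and j: "\<And>s. (j has_derivative j') (at s)" "j ` S \<subseteq> Q" and S: "convex S"
    and 0: "\<And>s h. s \<in> S \<Longrightarrow> dd (j' h) F (j s) = 0" and st: "s \<in> S" "t \<in> S"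
  shows "F (j s) = F (j t)"
proof -
  have "((\<lambda>s. F (j s)) has_derivative (\<lambda>h. 0)) (at s within S)" if s: "s \<in> S" for s
  proof -
    have "((\<lambda>s. F (j s)) has_derivative (\<lambda>h. dd (j' h) F (j s))) (at s)"
      by (rule has_derivative_compose[OF j(1) smooth_on_has_derivative[OF F]]) (use j(2) s in auto)
    then show ?thesis using 0[OF s] by (simp add: has_derivative_at_withinI)
  qed
  from has_derivative_zero_constant[OF S this] show ?thesis using st by metis
qed

lemma locally_joined:
  fixes V :: "('u::euclidean_space \<times> 'u \<times> real) set" and g :: "'u \<times> 'u \<times> real \<Rightarrow> 'b::euclidean_space \<times> 'b"
  assumes dim: "DIM('b) = DIM('u) + 1" and V: "open V" and ca: "centroaffine V g r"
    and Jt: "\<And>x. x \<in> V \<Longrightarrow> para_J (g x) \<in> tangent_image g x"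
    and inv: "involutive_on V (distribution_D para_J g)" and p: "p \<in> V"
  obtains U \<Phi> \<Psi> and U1 U2 :: "'u set" and I f1 f2 where "open U" "U \<subseteq> V" "p \<in> U" "open U1" "open U2" "open (I :: real set)"
    "connected U1" "connected U2" "homeomorphism U (U1 \<times> U2 \<times> I) \<Phi> \<Psi>"
    "smooth_on U \<Phi>" "smooth_on (U1 \<times> U2 \<times> I) \<Psi>"
    "\<exists>r. centroaffine U1 f1 r" "\<exists>r. centroaffine U2 f2 r" "\<And>x. x \<in> U \<Longrightarrow> g x = joined f1 f2 (\<Phi> x)"
proof -
  have g: "smooth_on V g" and b: "\<And>x. x \<in> V \<Longrightarrow> bij (frame g x)"
    using ca by (auto simp: centroaffine_def)
  note ctx = V g b Jt
  obtain \<rho> where \<rho>: "\<rho> > 0" "ball p \<rho> \<subseteq> V" using V p openE by blast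
  let ?B = "ball p \<rho>"
  have inV: "x \<in> V" if "x \<in> ?B" for x using that \<rho> by auto
  have l: "linear (eta g x)" if "x \<in> ?B" for x using eta_linear[OF ctx] inV[OF that] by blast
  have s: "smooth_on ?B (\<lambda>x. eta g x v)" for v by (rule smooth_on_subset[OF smooth_on_eta[OF ctx] \<rho>(2)])
  have c: "dd u (\<lambda>y. eta g y v) x = dd v (\<lambda>y. eta g y u) x" if "x \<in> ?B" for x u v
    by (rule eta_closed[OF ctx inv inV[OF that]])
  obtain z where z: "\<And>x. x \<in> ?B \<Longrightarrow> (z has_derivative eta g x) (at x)"
    by (rule poincare_lemma[OF l s c that])
  have zs: "smooth_on ?B z"
    by (rule smooth_onI[where F' = "\<lambda>v x. eta g x v"])
       (use z smooth_on_subset[OF smooth_on_eta[OF ctx] \<rho>(2)] in auto)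
  define \<alpha> where "\<alpha> = (\<lambda>x. exp (z x) *\<^sub>R part_a g x)"
  define \<beta> where "\<beta> = (\<lambda>x. exp (- z x) *\<^sub>R part_b g x)"
  note as = smooth_on_subset[OF smooth_on_parts(1)[OF ctx] \<rho>(2)] and bs = smooth_on_subset[OF smooth_on_parts(2)[OF ctx] \<rho>(2)]
  have mz: "smooth_on ?B (\<lambda>x. - z x)"
    by (rule smooth_on_linear[OF bounded_linear_minus[OF bounded_linear_ident] open_ball zs])
  have \<alpha>s: "smooth_on ?B \<alpha>"
    unfolding \<alpha>_def by (rule smooth_on_bilinear[OF bounded_bilinear_scaleR open_ball smooth_on_exp[OF open_ball zs] as])
  have \<beta>s: "smooth_on ?B \<beta>"
    unfolding \<beta>_def by (rule smooth_on_bilinear[OF bounded_bilinear_scaleR open_ball smooth_on_exp[OF open_ball mz] bs])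
  have d\<alpha>: "dd v \<alpha> x = exp (z x) *\<^sub>R (dd v (part_a g) x + eta g x v *\<^sub>R part_a g x)" if x: "x \<in> ?B" for v x
    using dd_eq[OF has_derivative_scaleR[OF has_derivative_exp[OF z[OF x]] smooth_on_has_derivative[OF as x]], of v]
    by (simp add: \<alpha>_def scaleR_add_right mult.commute)
  have d\<beta>: "dd v \<beta> x = exp (- z x) *\<^sub>R (dd v (part_b g) x - eta g x v *\<^sub>R part_b g x)" if x: "x \<in> ?B" for v x
    using dd_eq[OF has_derivative_scaleR[OF has_derivative_exp[OF has_derivative_minus[OF z[OF x]]] smooth_on_has_derivative[OF bs x]], of v]
    by (simp add: \<beta>_def scaleR_diff_right mult.commute)
  note l\<alpha> = has_derivative_linear[OF smooth_on_has_derivative[OF \<alpha>s]] and l\<beta> = has_derivative_linear[OF smooth_on_has_derivative[OF \<beta>s]]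
  \<comment> \<open>By \<open>parts_transversal\<close>, \<alpha> does not lie in the range of its
    own derivative, so this range is a proper subspace of a space of dimension
    \<open>DIM('u) + 1\<close>.\<close>
  have rank\<alpha>: "dim (range (\<lambda>v. dd v \<alpha> x)) \<le> DIM('u)" if x: "x \<in> ?B" for x
  proof -
    have "exp (z x) *\<^sub>R part_a g x \<notin> range (\<lambda>v. dd v \<alpha> x)"
    proof
      assume "exp (z x) *\<^sub>R part_a g x \<in> range (\<lambda>v. dd v \<alpha> x)"
      then obtain v where "exp (z x) *\<^sub>R part_a g x = dd v \<alpha> x" by (elim rangeE)
      then show False
        using parts_transversal(1)[OF ctx inV[OF x], of v]
        unfolding d\<alpha>[OF x] real_vector.scale_cancel_left by simp
    qed
    from range_dim_less[OF l\<alpha>[OF x] this] show ?thesis using dim by simp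
  qed
  have rank\<beta>: "dim (range (\<lambda>v. dd v \<beta> x)) \<le> DIM('u)" if x: "x \<in> ?B" for x
  proof -
    have "exp (- z x) *\<^sub>R part_b g x \<notin> range (\<lambda>v. dd v \<beta> x)"
    proof
      assume "exp (- z x) *\<^sub>R part_b g x \<in> range (\<lambda>v. dd v \<beta> x)"
      then obtain v where "exp (- z x) *\<^sub>R part_b g x = dd v \<beta> x" by (elim rangeE)
      then show False
        using parts_transversal(2)[OF ctx inV[OF x], of v]
        unfolding d\<beta>[OF x] real_vector.scale_cancel_left by simp
    qed
    from range_dim_less[OF l\<beta>[OF x] this] show ?thesis using dim by simp
  qed
  have pB: "p \<in> ?B" using \<rho> by simp
  obtain \<pi>1 :: "'b \<Rightarrow> 'u" where \<pi>1: "linear \<pi>1" "\<And>w. \<pi>1 (dd w \<alpha> p) = 0 \<Longrightarrow> dd w \<alpha> p = 0"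
    using injective_projection[OF l\<alpha>[OF pB] rank\<alpha>[OF pB]] by blast
  obtain \<pi>2 :: "'b \<Rightarrow> 'u" where \<pi>2: "linear \<pi>2" "\<And>w. \<pi>2 (dd w \<beta> p) = 0 \<Longrightarrow> dd w \<beta> p = 0"
    using injective_projection[OF l\<beta>[OF pB] rank\<beta>[OF pB]] by blast
  have b\<pi>: "bounded_linear \<pi>1" "bounded_linear \<pi>2" using \<pi>1(1) \<pi>2(1) linear_conv_bounded_linear by auto
  define \<Phi> where "\<Phi> = (\<lambda>x. (\<pi>1 (\<alpha> x), \<pi>2 (\<beta> x), z x))"
  have \<Phi>s: "smooth_on ?B \<Phi>"
    unfolding \<Phi>_def by (intro smooth_on_Pair open_ball smooth_on_linear[OF b\<pi>(1)] smooth_on_linear[OF b\<pi>(2)] \<alpha>s \<beta>s zs)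
  have d\<Phi>: "frechet_derivative \<Phi> (at x) v = (\<pi>1 (dd v \<alpha> x), \<pi>2 (dd v \<beta> x), eta g x v)" if x: "x \<in> ?B" for x v
  proof -
    have "(\<Phi> has_derivative (\<lambda>v. (\<pi>1 (dd v \<alpha> x), \<pi>2 (dd v \<beta> x), eta g x v))) (at x)"
      unfolding \<Phi>_def
      by (intro has_derivative_Pair bounded_linear.has_derivative[OF b\<pi>(1)] bounded_linear.has_derivative[OF b\<pi>(2)]
          smooth_on_has_derivative[OF \<alpha>s x] smooth_on_has_derivative[OF \<beta>s x] z[OF x])
    from dd_eq[OF this, of v] show ?thesis by (simp add: flat_D_def)
  qed
  \<comment> \<open>A kernel vector is annihilated by the derivatives of \<alpha>, \<beta> and
    \<open>z\<close>, hence by those of both eigencomponents, hence by the immersion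
    \<open>g\<close>.\<close>
  have "inj (frechet_derivative \<Phi> (at p))"
  proof (subst linear_injective_0[OF smooth_on_linear_derivative[OF \<Phi>s pB]], intro allI impI)
    fix v assume "frechet_derivative \<Phi> (at p) v = 0"
    then have 0: "dd v \<alpha> p = 0" "dd v \<beta> p = 0" "eta g p v = 0"
      using \<pi>1(2) \<pi>2(2) by (simp_all add: d\<Phi>[OF pB] zero_prod_def)
    then have "dd v (part_a g) p = 0" "dd v (part_b g) p = 0"
      by (simp_all add: d\<alpha>[OF pB] d\<beta>[OF pB])
    then have "dd v g p = 0" using rot_dd_parts[OF ctx p, of v] by (simp add: rot_def zero_prod_def)
    then show "v = 0"
      using tangential_tangent[OF ctx p, of v] linear_0[OF tangential_linear[OF ctx p]] by simp
  qed
  from smooth_inverse_function[OF open_ball pB \<Phi>s this]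
  obtain N W \<Psi> where N: "open N" "N \<subseteq> ?B" "p \<in> N" "open W" "homeomorphism N W \<Phi> \<Psi>" "smooth_on W \<Psi>"
    and \<Phi>b: "\<And>x. x \<in> N \<Longrightarrow> bij (frechet_derivative \<Phi> (at x))"
    and \<Psi>b: "\<And>y. y \<in> W \<Longrightarrow> bij (frechet_derivative \<Psi> (at y))" by metis
  obtain x0 y0 t0 where p0: "\<Phi> p = (x0, y0, t0)" by (metis prod_cases3)
  have "(x0, y0, t0) \<in> W" using N(3,5) p0 by (metis homeomorphism_def imageI)
  then obtain A1 A2 where A: "open A1" "open A2" "x0 \<in> A1" "(y0, t0) \<in> A2" "A1 \<times> A2 \<subseteq> W"
    using open_prod_elim[OF N(4)] by (metis mem_Sigma_iff)
  obtain A3 A4 where A': "open A3" "open A4" "y0 \<in> A3" "t0 \<in> A4" "A3 \<times> A4 \<subseteq> A2"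
    using open_prod_elim[OF A(2,4)] by (metis mem_Sigma_iff)
  obtain e1 e2 e3 where e: "e1 > 0" "ball x0 e1 \<subseteq> A1" "e2 > 0" "ball y0 e2 \<subseteq> A3" "e3 > 0" "ball t0 e3 \<subseteq> A4"
    using A A' openE by metis
  \<comment> \<open>Balls serve twice: they are convex, for constancy along coordinate slices, and
    connected, as hyperspheres must be.\<close>
  define U1 where "U1 = ball x0 e1"
  define U2 where "U2 = ball y0 e2"
  define I where "I = ball t0 e3"
  let ?Q = "U1 \<times> U2 \<times> I"
  have QW: "?Q \<subseteq> W" using e A(5) A'(5) unfolding U1_def U2_def I_def by blast
  have Q: "open ?Q" unfolding U1_def U2_def I_def by (intro open_Times open_ball)
  have mem0: "x0 \<in> U1" "y0 \<in> U2" "t0 \<in> I" using e by (auto simp: U1_def U2_def I_def)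
  define U where "U = \<Psi> ` ?Q"
  have hom: "homeomorphism ?Q U \<Psi> \<Phi>"
    by (rule homeomorphism_of_subsets[OF homeomorphism_symD[OF N(5)] QW _ U_def[symmetric]]) auto
  then have hom': "homeomorphism U ?Q \<Phi> \<Psi>" by (rule homeomorphism_symD)
  have UN: "U \<subseteq> N"
    unfolding U_def using homeomorphism_image2[OF N(5)] image_mono[OF QW, of \<Psi>] by simp
  have "U = N \<inter> \<Phi> -` ?Q"
  proof
    show "U \<subseteq> N \<inter> \<Phi> -` ?Q" using UN homeomorphism_image1[OF hom'] by blast
    show "N \<inter> \<Phi> -` ?Q \<subseteq> U"
    proof
      fix x assume x: "x \<in> N \<inter> \<Phi> -` ?Q"
      then have "\<Psi> (\<Phi> x) = x" using homeomorphism_apply1[OF N(5)] by blast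
      then show "x \<in> U" using x unfolding U_def by (metis IntD2 imageI vimageD)
    qed
  qed
  moreover have "continuous_on N \<Phi>" using N(5) by (simp add: homeomorphism_def)
  ultimately have Uo: "open U" using continuous_open_preimage[OF _ N(1) Q] by metis
  have "\<Psi> (\<Phi> p) = p" using N(3,5) by (simp add: homeomorphism_def)
  then have pU: "p \<in> U" unfolding U_def p0 using mem0 by (intro image_eqI[of _ _ "(x0, y0, t0)"]) auto
  have UB: "U \<subseteq> ?B" using UN N(2) by auto
  have UV: "U \<subseteq> V" using UB \<rho>(2) by auto
  have \<Psi>s: "smooth_on ?Q \<Psi>" by (rule smooth_on_subset[OF N(6) QW])
  have \<Psi>U: "\<Psi> q \<in> U" if "q \<in> ?Q" for q using that by (simp add: U_def)
  have \<Phi>\<Psi>: "\<Phi> (\<Psi> q) = q" if "q \<in> ?Q" for q by (rule homeomorphism_apply1[OF hom that])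
  have chain: "frechet_derivative \<Phi> (at (\<Psi> q)) (frechet_derivative \<Psi> (at q) w) = w" if q: "q \<in> ?Q" for q w
  proof -
    have "((\<lambda>q. \<Phi> (\<Psi> q)) has_derivative (\<lambda>w. frechet_derivative \<Phi> (at (\<Psi> q)) (frechet_derivative \<Psi> (at q) w))) (at q)"
      by (rule has_derivative_compose[OF smooth_on_has_derivative'[OF \<Psi>s q]
            smooth_on_has_derivative'[OF smooth_on_subset[OF \<Phi>s UB] \<Psi>U[OF q]]])
    then have "dd w (\<lambda>q. \<Phi> (\<Psi> q)) q = frechet_derivative \<Phi> (at (\<Psi> q)) (frechet_derivative \<Psi> (at q) w)"
      by (rule dd_eq)
    moreover have "dd w (\<lambda>q. \<Phi> (\<Psi> q)) q = dd w (\<lambda>q. q) q" by (rule dd_cong[OF Q q \<Phi>\<Psi>])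
    moreover have "dd w (\<lambda>q. q) q = w" by (rule dd_eq) (rule has_derivative_ident)
    ultimately show ?thesis by simp
  qed
  have \<Phi>surj: "surj (frechet_derivative \<Phi> (at x))" if "x \<in> U" for x
    by (rule bij_is_surj[OF \<Phi>b[OF subsetD[OF UN that]]])
  have s\<alpha>: "smooth_on U \<alpha>" and s\<beta>: "smooth_on U \<beta>" and s\<Phi>: "smooth_on U \<Phi>"
    by (rule smooth_on_subset[OF _ UB], fact \<alpha>s \<beta>s \<Phi>s)+
  \<comment> \<open>In the new coordinates \<alpha> does not vary with the second and third one;
    symmetrically, \<beta> below does not vary with the first and third.\<close>
  have k\<alpha>: "dd (frechet_derivative \<Psi> (at q) (0, v, t)) \<alpha> (\<Psi> q) = 0" if q: "q \<in> ?Q" for q v t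
  proof (rule factor_through_coordinate[OF Uo s\<alpha> \<pi>1(1) linear_fst s\<Phi> _ _ _ \<Phi>surj \<Psi>U[OF q]])
    show "fst (\<Phi> x) = \<pi>1 (\<alpha> x)" for x by (simp add: \<Phi>_def)
    show "dim (range (\<lambda>v. dd v \<alpha> x)) \<le> DIM('u)" if "x \<in> U" for x
      by (rule rank\<alpha>[OF subsetD[OF UB that]])
    show "surj (fst :: 'u \<times> 'u \<times> real \<Rightarrow> 'u)" by (rule surjI[of fst "\<lambda>u. (u, 0)"]) simp
    show "fst (frechet_derivative \<Phi> (at (\<Psi> q)) (frechet_derivative \<Psi> (at q) (0, v, t))) = 0"
      by (simp add: chain[OF q])
  qed
  have k\<beta>: "dd (frechet_derivative \<Psi> (at q) (u, 0, t)) \<beta> (\<Psi> q) = 0" if q: "q \<in> ?Q" for q u t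
  proof (rule factor_through_coordinate[OF Uo s\<beta> \<pi>2(1) _ s\<Phi> _ _ _ \<Phi>surj \<Psi>U[OF q]])
    show "linear (\<lambda>q :: 'u \<times> 'u \<times> real. fst (snd q))" by (simp add: linear_iff)
    show "fst (snd (\<Phi> x)) = \<pi>2 (\<beta> x)" for x by (simp add: \<Phi>_def)
    show "dim (range (\<lambda>v. dd v \<beta> x)) \<le> DIM('u)" if "x \<in> U" for x
      by (rule rank\<beta>[OF subsetD[OF UB that]])
    show "surj (\<lambda>q :: 'u \<times> 'u \<times> real. fst (snd q))" by (rule surjI[of _ "\<lambda>u. (0, u, 0)"]) simp
    show "fst (snd (frechet_derivative \<Phi> (at (\<Psi> q)) (frechet_derivative \<Psi> (at q) (u, 0, t)))) = 0"
      by (simp add: chain[OF q])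
  qed
  \<comment> \<open>Restriction to the slice through the centre; any other slice gives the same map
    by the vanishing derivatives.\<close>
  define f1 where "f1 = (\<lambda>x. \<alpha> (\<Psi> (x, y0, t0)))"
  define f2 where "f2 = (\<lambda>y. \<beta> (\<Psi> (x0, y, t0)))"
  have \<alpha>\<Psi>: "smooth_on ?Q (\<lambda>q. \<alpha> (\<Psi> q))" and \<beta>\<Psi>: "smooth_on ?Q (\<lambda>q. \<beta> (\<Psi> q))"
    using smooth_on_compose[OF Q Uo _ \<Psi>s s\<alpha>] smooth_on_compose[OF Q Uo _ \<Psi>s s\<beta>] U_def by auto
  have d\<Psi>: "dd w (\<lambda>q. F (\<Psi> q)) q = dd (frechet_derivative \<Psi> (at q) w) F (\<Psi> q)"
    if "smooth_on U F" "q \<in> ?Q" for F :: "'u \<times> 'u \<times> real \<Rightarrow> 'b" and q w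
    by (rule dd_eq[OF has_derivative_compose[OF smooth_on_has_derivative'[OF \<Psi>s that(2)]
          smooth_on_has_derivative[OF that(1) \<Psi>U[OF that(2)]]]])
  have f1: "\<alpha> (\<Psi> (x, y, t)) = f1 x" if xyt: "x \<in> U1" "y \<in> U2" "t \<in> I" for x y t
    unfolding f1_def
    by (rule constant_along_slice[OF \<alpha>\<Psi>, of "\<lambda>s. (x, s)" "\<lambda>h. (0, h)" "U2 \<times> I" "(y, t)" "(y0, t0)"])
       (use xyt mem0 k\<alpha> d\<Psi>[OF s\<alpha>] in \<open>auto simp: U2_def I_def convex_Times intro!: derivative_eq_intros\<close>)
  have f2: "\<beta> (\<Psi> (x, y, t)) = f2 y" if xyt: "x \<in> U1" "y \<in> U2" "t \<in> I" for x y t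
    unfolding f2_def
    by (rule constant_along_slice[OF \<beta>\<Psi>, of "\<lambda>s. (fst s, y, snd s)" "\<lambda>h. (fst h, 0, snd h)" "U1 \<times> I"
          "(x, t)" "(x0, t0)", simplified])
       (use xyt mem0 k\<beta> d\<Psi>[OF s\<beta>] in \<open>auto simp: U1_def I_def convex_Times intro!: derivative_eq_intros\<close>)
  have joined: "g (\<Psi> q) = joined f1 f2 q" if q: "q \<in> ?Q" for q
  proof -
    obtain x y t where xyt: "q = (x, y, t)" "x \<in> U1" "y \<in> U2" "t \<in> I" using q by auto
    \<comment> \<open>The potential itself is the third coordinate, so undoing the factors exp(z)
      and exp(-z) in \<alpha> and \<beta> gives exactly the exponentials of
      \<open>joined_eq_rot\<close>.\<close>
    have "z (\<Psi> q) = t" using \<Phi>\<Psi>[OF q] xyt(1) by (simp add: \<Phi>_def)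
    then have f: "f1 x = exp t *\<^sub>R part_a g (\<Psi> q)" "f2 y = exp (- t) *\<^sub>R part_b g (\<Psi> q)"
      using f1[OF xyt(2-4)] f2[OF xyt(2-4)] xyt(1) by (simp_all add: \<alpha>_def \<beta>_def)
    have "exp (- t) *\<^sub>R f1 x = part_a g (\<Psi> q)" "exp t *\<^sub>R f2 y = part_b g (\<Psi> q)"
      unfolding f by (simp_all add: exp_minus)
    then show ?thesis unfolding xyt(1) joined_eq_rot using rot_parts[of g "\<Psi> q"] xyt(1) by simp
  qed
  have op: "open U1" "open U2" "open I" by (auto simp: U1_def U2_def I_def)
  have pair1: "smooth_on U1 (\<lambda>x. (x, y0, t0))" and pair2: "smooth_on U2 (\<lambda>y. (x0, y, t0))"
    by (intro smooth_on_Pair smooth_on_id smooth_on_const op)+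
  have s1: "smooth_on U1 f1"
    unfolding f1_def by (rule smooth_on_compose[OF op(1) Q _ pair1 \<alpha>\<Psi>]) (use mem0 in auto)
  have s2: "smooth_on U2 f2"
    unfolding f2_def by (rule smooth_on_compose[OF op(2) Q _ pair2 \<beta>\<Psi>]) (use mem0 in auto)
  have "centroaffine ?Q (\<lambda>q. g (\<Psi> q)) r"
  proof (rule centroaffine_compose[OF _ V Q ca \<Psi>s])
    show "DIM('b \<times> 'b) = DIM('u \<times> 'u \<times> real) + 1" using dim by simp
    show "\<Psi> ` ?Q \<subseteq> V" using UV by (simp add: U_def)
    show "bij (frechet_derivative \<Psi> (at q))" if "q \<in> ?Q" for q
      by (rule \<Psi>b[OF subsetD[OF QW that]])
  qed
  then have "centroaffine ?Q (joined f1 f2) r"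
    by (rule centroaffine_cong[OF _ Q joined])
  from centroaffine_joinedD[OF op(1,2) dim s1 s2 _ _ _ this]
  have c: "\<exists>r. centroaffine U1 f1 r" "\<exists>r. centroaffine U2 f2 r" using mem0 by auto
  have "g x = joined f1 f2 (\<Phi> x)" if "x \<in> U" for x
  proof -
    have "\<Phi> x \<in> ?Q" using homeomorphism_image1[OF hom'] that by blast
    then show ?thesis using joined homeomorphism_apply1[OF hom' that] by metis
  qed
  then show ?thesis
    by (intro that[OF Uo UV pU op _ _ hom' s\<Phi> \<Psi>s c]) (auto simp: U1_def U2_def)
qed

section \<open>Charts\<close>

lemma chart_inverse:
  assumes "is_chart M c" "q \<in> fst c"
  shows "inv_into (fst c) (snd c) (snd c q) = q"
proof -
  have "fst c \<subseteq> topspace M" using assms(1) openin_subset by (auto simp: is_chart_def)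
  then have "topspace (subtopology M (fst c)) = fst c" by auto
  then have "inj_on (snd c) (fst c)"
    using assms(1) homeomorphic_imp_injective_map unfolding is_chart_def by metis
  then show ?thesis using assms(2) by (rule inv_into_f_f)
qed

lemma chart_open_image:
  assumes c: "is_chart M c" and S: "openin M S" "S \<subseteq> fst c"
  shows "open (snd c ` S)"
proof -
  have "openin (subtopology M (fst c)) S"
    using c S by (simp add: is_chart_def openin_open_subtopology)
  then have "openin (top_of_set (chart_image c)) (snd c ` S)"
    using c homeomorphic_imp_open_map unfolding is_chart_def open_map_def by blast
  then show ?thesis using c by (simp add: is_chart_def openin_open_eq)
qed

lemma overlap_open:
  assumes "is_chart M c" "openin M (fst d)"
  shows "open (overlap c d)"
  unfolding overlap_def
  by (rule chart_open_image[OF assms(1)]) (use assms in \<open>auto simp: is_chart_def\<close>)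

text \<open>The chart \<open>c\<close> restricted over \<open>U\<close> and followed by \<Phi>. Its
  transition maps are those of \<open>c\<close>, precomposed with \<Psi> or followed by \<Phi>, so
  they are smooth.\<close>

lemma admissible_chart_compose:
  fixes M :: "'m topology" and A :: "('m, 'a::euclidean_space) chart set"
  assumes M: "smooth_manifold M A" and c: "c \<in> A" and U: "open U" "U \<subseteq> chart_image c" and Q: "open Q"
    and hom: "homeomorphism U Q \<Phi> \<Psi>" and s: "smooth_on U \<Phi>" "smooth_on Q \<Psi>"
  shows "admissible_chart M A ({q \<in> fst c. snd c q \<in> U}, \<lambda>q. \<Phi> (snd c q))"
    and "(\<lambda>q. \<Phi> (snd c q)) ` {q \<in> fst c. snd c q \<in> U} = Q"
proof -
  let ?W = "{q \<in> fst c. snd c q \<in> U}" and ?\<psi> = "\<lambda>q. \<Phi> (snd c q)"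
  let ?e = "(?W, ?\<psi>)"
  have ch: "is_chart M d" if "d \<in> A" for d using M that by (simp add: smooth_manifold_def)
  note cc = ch[OF c]
  have fc: "openin M (fst c)" and hc: "homeomorphic_map (subtopology M (fst c)) (top_of_set (chart_image c)) (snd c)"
    using cc by (auto simp: is_chart_def)
  have sub: "fst c \<subseteq> topspace M" using fc openin_subset by auto
  have img: "snd c ` ?W = U" using U(2) by (auto simp: chart_image_def)
  then show Q_eq: "?\<psi> ` ?W = Q" using homeomorphism_image1[OF hom] by (metis image_image)
  have "openin (top_of_set (chart_image c)) U" using U by (simp add: open_openin_trans open_subset)
  then have "openin (subtopology M (fst c)) {q \<in> topspace (subtopology M (fst c)). snd c q \<in> U}"
    using openin_continuous_map_preimage[OF homeomorphic_imp_continuous_map[OF hc]] by blast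
  moreover have "{q \<in> topspace (subtopology M (fst c)). snd c q \<in> U} = ?W" using sub by auto
  ultimately have oW: "openin M ?W" using fc by (simp add: openin_open_subtopology)
  have "homeomorphic_map (subtopology (subtopology M (fst c)) ?W) (subtopology (top_of_set (chart_image c)) U) (snd c)"
  proof (rule homeomorphic_map_subtopologies[OF hc])
    have "topspace (subtopology M (fst c)) \<inter> ?W = ?W" "topspace (top_of_set (chart_image c)) \<inter> U = U"
      using sub U(2) by auto
    with img show "snd c ` (topspace (subtopology M (fst c)) \<inter> ?W) = topspace (top_of_set (chart_image c)) \<inter> U"
      by (simp only:)
  qed
  moreover have "fst c \<inter> ?W = ?W" "chart_image c \<inter> U = U" using U(2) by auto
  ultimately have h1: "homeomorphic_map (subtopology M ?W) (top_of_set U) (snd c)"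
    by (simp add: subtopology_subtopology)
  have "homeomorphic_map (top_of_set U) (top_of_set Q) \<Phi>"
    unfolding homeomorphic_map_maps homeomorphic_maps_def
    using hom by (intro exI[of _ \<Psi>]) (auto simp: homeomorphism_def)
  from homeomorphic_map_compose[OF h1 this]
  have h: "homeomorphic_map (subtopology M ?W) (top_of_set Q) ?\<psi>" by (simp add: o_def)
  have ce: "is_chart M ?e"
    unfolding is_chart_def chart_image_def using oW Q h Q_eq by simp
  have "compatible_charts ?e d" if d: "d \<in> A" for d
    unfolding compatible_charts_def
  proof
    note cd = ch[OF d]
    have od: "openin M (fst d)" using cd by (simp add: is_chart_def)
    have comp: "smooth_on (overlap c d) (in_chart c (snd d))" "smooth_on (overlap d c) (in_chart d (snd c))"
      using M c d by (auto simp: smooth_manifold_def compatible_charts_def)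
    have o1: "open (overlap ?e d)" by (rule overlap_open[OF ce od])
    have o2: "open (overlap d ?e)" by (rule overlap_open[OF cd]) (simp add: oW)
    have retract: "\<Psi> (?\<psi> q) = snd c q" if "q \<in> ?W" for q
      by (rule homeomorphism_apply1[OF hom]) (use that in simp)
    have "smooth_on (overlap ?e d) (\<lambda>y. in_chart c (snd d) (\<Psi> y))"
    proof (rule smooth_on_compose[OF o1 overlap_open[OF cc od] _ _ comp(1)])
      show "\<Psi> ` overlap ?e d \<subseteq> overlap c d" using retract by (auto simp: overlap_def)
      show "smooth_on (overlap ?e d) \<Psi>"
        by (rule smooth_on_subset[OF s(2)]) (use Q_eq in \<open>auto simp: overlap_def\<close>)
    qed
    then show "smooth_on (overlap ?e d) (in_chart ?e (snd d))"
    proof (rule smooth_on_cong[OF _ o1])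
      fix y assume "y \<in> overlap ?e d"
      then obtain q where q: "q \<in> ?W" "y = ?\<psi> q" by (auto simp: overlap_def)
      have "in_chart ?e (snd d) y = snd d q"
        using chart_inverse[OF ce, of q] q by (simp add: in_chart_def)
      moreover have "in_chart c (snd d) (\<Psi> y) = snd d q"
        using chart_inverse[OF cc, of q] retract[OF q(1)] q by (simp add: in_chart_def)
      ultimately show "in_chart c (snd d) (\<Psi> y) = in_chart ?e (snd d) y" by simp
    qed
    have sub': "overlap d ?e \<subseteq> overlap d c" by (auto simp: overlap_def)
    have "smooth_on (overlap d ?e) (\<lambda>y. \<Phi> (in_chart d (snd c) y))"
    proof (rule smooth_on_compose[OF o2 U(1) _ smooth_on_subset[OF comp(2) sub'] s(1)])
      show "in_chart d (snd c) ` overlap d ?e \<subseteq> U"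
        using chart_inverse[OF cd] by (auto simp: overlap_def in_chart_def)
    qed
    then show "smooth_on (overlap d ?e) (in_chart d (snd ?e))"
      by (simp add: in_chart_def[abs_def] o_def)
  qed
  with ce show "admissible_chart M A ?e" by (simp add: admissible_chart_def)
qed

lemma J_tangent_hypersphere_locally_joined:
  fixes M :: "'m topology" and A :: "('m, 'u::euclidean_space \<times> 'u \<times> real) chart set"
    and f C :: "'m \<Rightarrow> 'b::euclidean_space \<times> 'b"
  assumes dim: "DIM('b) = DIM('u) + 1"
    and f: "affine_hypersphere M A f C lam" "centred_at_origin M f C lam"
    and Jt: "J_tangent para_J A f C" and inv: "involutive_D para_J A f" and p: "p \<in> topspace M"
  shows "\<exists>W \<psi> U1 U2 (f1 :: 'u \<Rightarrow> 'b) (f2 :: 'u \<Rightarrow> 'b).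
           p \<in> W \<and> admissible_chart M A (W, \<psi>) \<and>
           open U1 \<and> open U2 \<and> \<psi> ` W \<subseteq> U1 \<times> U2 \<times> UNIV \<and>
           proper_centred_hypersphere_on U1 f1 \<and> proper_centred_hypersphere_on U2 f2 \<and>
           (\<forall>q\<in>W. f q = joined f1 f2 (\<psi> q))"
proof -
  have M: "smooth_manifold M A" using f by (simp add: affine_hypersphere_def)
  then have "p \<in> (\<Union>c\<in>A. fst c)" using p by (simp add: smooth_manifold_def)
  then obtain c where c: "c \<in> A" "p \<in> fst c" by (rule UN_E)
  have cc: "is_chart M c" using M c by (simp add: smooth_manifold_def)
  let ?V = "chart_image c" and ?g = "in_chart c f"
  have dim': "DIM('b \<times> 'b) = DIM('u \<times> 'u \<times> real) + 1" using dim by simp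
  note chart = affine_hypersphere_chart[OF dim' f c(1)]
  have lam: "lam \<noteq> 0" using f by (simp add: centred_at_origin_def)
  have s: "smooth_on ?V ?g" using chart(2) by (simp add: centroaffine_def)
  have Jg: "para_J (?g x) \<in> tangent_image ?g x" if x: "x \<in> ?V" for x
  proof -
    \<comment> \<open>The hypothesis speaks of the Blaschke field \<open>- lam\<close> times the
      position; tangent spaces being linear, division by \<open>- lam\<close> transfers it to the
      position.\<close>
    have "para_J (- lam *\<^sub>R ?g x) \<in> tangent_image ?g x"
      using Jt c(1) x chart(3)[OF x] unfolding J_tangent_def by metis
    then obtain w where w: "- lam *\<^sub>R para_J (?g x) = frechet_derivative ?g (at x) w"
      unfolding tangent_image_def linear_cmul[OF para_J_linear] by auto
    have "para_J (?g x) = (- 1 / lam) *\<^sub>R (- lam *\<^sub>R para_J (?g x))" using lam by simp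
    also have "\<dots> = frechet_derivative ?g (at x) ((- 1 / lam) *\<^sub>R w)"
      unfolding w by (rule linear_cmul[OF smooth_on_linear_derivative[OF s x], symmetric])
    finally show ?thesis by (simp add: tangent_image_def)
  qed
  have iv: "involutive_on ?V (distribution_D para_J ?g)" using inv c(1) by (simp add: involutive_D_def)
  have pV: "snd c p \<in> ?V" using c(2) by (simp add: chart_image_def)
  obtain U \<Phi> \<Psi> and U1 U2 :: "'u set" and I f1 f2 where loc: "open U" "U \<subseteq> ?V" "snd c p \<in> U" "open U1" "open U2" "open (I :: real set)"
    "connected U1" "connected U2" "homeomorphism U (U1 \<times> U2 \<times> I) \<Phi> \<Psi>"
    "smooth_on U \<Phi>" "smooth_on (U1 \<times> U2 \<times> I) \<Psi>"
    "\<exists>r. centroaffine U1 f1 r" "\<exists>r. centroaffine U2 f2 r" "\<And>x. x \<in> U \<Longrightarrow> ?g x = joined f1 f2 (\<Phi> x)"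
    using locally_joined[OF dim chart(1,2) Jg iv pV] by metis
  let ?W = "{q \<in> fst c. snd c q \<in> U}" and ?\<psi> = "\<lambda>q. \<Phi> (snd c q)"
  have Q: "open (U1 \<times> U2 \<times> I)" using loc by (intro open_Times)
  note adm = admissible_chart_compose[OF M c(1) loc(1,2) Q loc(9,10,11)]
  have "f q = joined f1 f2 (?\<psi> q)" if q: "q \<in> ?W" for q
  proof -
    have "?g (snd c q) = f q" using chart_inverse[OF cc, of q] q by (simp add: in_chart_def)
    then show ?thesis using loc(14)[of "snd c q"] q by simp
  qed
  moreover have "?\<psi> ` ?W \<subseteq> U1 \<times> U2 \<times> UNIV" unfolding adm(2) by auto
  moreover have "proper_centred_hypersphere_on U1 f1" "proper_centred_hypersphere_on U2 f2"
    using loc by (simp_all add: proper_centred_hypersphere_on_iff[OF dim])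
  moreover have "p \<in> ?W" using c(2) loc(3) by simp
  ultimately show ?thesis
    using adm(1) loc(4,5)
    by (intro exI[of _ ?W] exI[of _ ?\<psi>] exI[of _ U1] exI[of _ U2] exI[of _ f1] exI[of _ f2]) simp
qed

theorem theorem4p8:
  shows
    "(\<forall>(M :: 'm topology) (A :: ('m, 'n::finite coordinates) chart set)
        (f :: 'm \<Rightarrow> 'n affine_space \<times> 'n affine_space) C lam.
        affine_hypersphere M A f C lam \<and> centred_at_origin M f C lam \<and>
        J_tangent para_J A f C \<and> involutive_D para_J A f \<longrightarrow>
        (\<forall>p\<in>topspace M. \<exists>W \<psi> U1 U2 (f1 :: real ^ 'n \<Rightarrow> 'n affine_space)
             (f2 :: real ^ 'n \<Rightarrow> 'n affine_space).
           p \<in> W \<and> admissible_chart M A (W, \<psi>) \<and>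
           open U1 \<and> open U2 \<and> \<psi> ` W \<subseteq> U1 \<times> U2 \<times> UNIV \<and>
           proper_centred_hypersphere_on U1 f1 \<and> proper_centred_hypersphere_on U2 f2 \<and>
           (\<forall>q\<in>W. f q = joined f1 f2 (\<psi> q))))
     \<and>
     (\<forall>U1 U2 (f1 :: real ^ 'n \<Rightarrow> 'n affine_space) (f2 :: real ^ 'n \<Rightarrow> 'n affine_space).
        open U1 \<and> open U2 \<and>
        proper_centred_hypersphere_on U1 f1 \<and> proper_centred_hypersphere_on U2 f2 \<longrightarrow>
        (\<exists>C lam. let U = U1 \<times> U2 \<times> UNIV in
           affine_hypersphere (top_of_set U) (std_atlas U) (joined f1 f2) C lam \<and> lam \<noteq> 0 \<and>
           J_tangent para_J (std_atlas U) (joined f1 f2) C \<and>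
           involutive_D para_J (std_atlas U) (joined f1 f2)))"
proof -
  have dim: "DIM('n affine_space) = DIM(real ^ 'n) + 1" by simp
  show ?thesis
    by (intro conjI allI impI ballI; elim conjE)
       (rule J_tangent_hypersphere_locally_joined[OF dim] joined_J_tangent_hypersphere[OF _ _ dim]; assumption)+
qed

end
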